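(* Let $n\geqslant1$, $a,b>0$, $\sigma\in(0,1)\cup(1,+\infty)$, $\sigma_{\min}:=\min\{1,\sigma\}$, $p_{\mathrm{crit}}:=1+\frac{2\sigma_{\min}}{n}$, and $1<p\leqslant p_{\mathrm{crit}}$. Let $u_0,u_1$ be such that $u_0+u_1\in L^1(\mathbb{R}^n)$ and $\int_{\mathbb{R}^n}(u_0+u_1)(x)\,dx>0$. Then there is no global in-time solution $u\in\mathcal{C}([0,+\infty),L^2(\mathbb{R}^n))$ of $$u_{tt}-a\Delta u+b(-\Delta)^{\sigma}u+u_t=|u|^p,\qquad u(0,x)=\varepsilon u_0(x),\ u_t(0,x)=\varepsilon u_1(x).$$ Furthermore, there exist constants $C,C'>0$ independent of $\varepsilon$ such that the lifespan satisfies, for all sufficiently small $\varepsilon>0$, $T_\varepsilon\leqslant C'\,\Gamma(\varepsilon;p,\sigma_{\min})$, where $\Gamma(\varepsilon;p,\sigma_{\min}):=\exp(C\varepsilon^{-(p-1)})$ if $p=p_{\mathrm{crit}}$ and $\Gamma(\varepsilon;p,\sigma_{\min}):=\varepsilon^{-\frac{2\sigma_{\min}(p-1)}{2\sigma_{\min}-n(p-1)}}$ if $p<p_{\mathrm{crit}}$.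
   Context: $(-\Delta)^\sigma$ is the Fourier multiplier with symbol $|\xi|^{2\sigma}$. A (weak) solution on $[0,T)$ is $u\in\mathcal{C}([0,T),L^2(\mathbb{R}^n))$ with $|u|^p\in L^1_{\mathrm{loc}}([0,T)\times\mathbb{R}^n)$ such that for all test functions $\phi\in C_0^\infty([0,T)\times\mathbb{R}^n)$, $\int_0^T\!\!\int|u|^p\phi\,dx\,dt=-\varepsilon\int(u_0+u_1)\phi(0,x)\,dx+\varepsilon\int u_0\,\partial_t\phi(0,x)\,dx+\int_0^T\!\!\int u\,(\partial_t^2\phi-\partial_t\phi-a\Delta\phi+b(-\Delta)^\sigma\phi)\,dx\,dt$. The lifespan $T_\varepsilon$ is the supremum of $T>0$ such that a solution exists on $[0,T)$. *)

theory Defs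
  imports "HOL-Analysis.Analysis"
begin

fun iter_dderiv :: "'a::real_normed_vector list \<Rightarrow> ('a \<Rightarrow> real) \<Rightarrow> 'a \<Rightarrow> real" where
  "iter_dderiv [] f = f"
| "iter_dderiv (v # vs) f = (\<lambda>x. frechet_derivative (iter_dderiv vs f) (at x) v)"

definition smooth_fun :: "('a::euclidean_space \<Rightarrow> real) \<Rightarrow> bool" where
  "smooth_fun f \<longleftrightarrow> (\<forall>vs. set vs \<subseteq> Basis \<longrightarrow> (\<forall>x. iter_dderiv vs f differentiable (at x)))"

definition fourier_tr :: "('a::euclidean_space \<Rightarrow> real) \<Rightarrow> 'a \<Rightarrow> complex" where
  "fourier_tr f \<xi> = (LINT x|lborel. cis (- (x \<bullet> \<xi>)) * complex_of_real (f x))"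

definition frac_lap :: "real \<Rightarrow> ('a::euclidean_space \<Rightarrow> real) \<Rightarrow> 'a \<Rightarrow> real" where
  "frac_lap \<sigma> f x = Re (complex_of_real (1 / (2 * pi) ^ DIM('a)) *
       (LINT \<xi>|lborel. cis (x \<bullet> \<xi>) * complex_of_real (norm \<xi> powr (2 * \<sigma>)) * fourier_tr f \<xi>))"

definition dt :: "(real \<times> 'a::euclidean_space \<Rightarrow> real) \<Rightarrow> real \<times> 'a \<Rightarrow> real" where
  "dt \<phi> = iter_dderiv [(1, 0)] \<phi>"

definition dtt :: "(real \<times> 'a::euclidean_space \<Rightarrow> real) \<Rightarrow> real \<times> 'a \<Rightarrow> real" where
  "dtt \<phi> = iter_dderiv [(1, 0), (1, 0)] \<phi>"

definition lap_x :: "(real \<times> 'a::euclidean_space \<Rightarrow> real) \<Rightarrow> real \<times> 'a \<Rightarrow> real" where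
  "lap_x \<phi> = (\<lambda>z. \<Sum>b\<in>Basis. iter_dderiv [(0, b), (0, b)] \<phi> z)"

definition time_int :: "ereal \<Rightarrow> real set" where
  "time_int T = {t. 0 \<le> t \<and> ereal t < T}"

text \<open>C_0^infinity([0,T) x R^n), realised as smooth functions on R x R^n whose support is compact and
  contained in {t < T}.\<close>
definition test_fun :: "ereal \<Rightarrow> (real \<times> 'a::euclidean_space \<Rightarrow> real) \<Rightarrow> bool" where
  "test_fun T \<phi> \<longleftrightarrow> smooth_fun \<phi> \<and> compact (closure {z. \<phi> z \<noteq> 0}) \<and> closure {z. \<phi> z \<noteq> 0} \<subseteq> {z. ereal (fst z) < T}"

definition weak_sol ::
  "real \<Rightarrow> real \<Rightarrow> real \<Rightarrow> real \<Rightarrow> real \<Rightarrow> ('a::euclidean_space \<Rightarrow> real) \<Rightarrow> ('a \<Rightarrow> real)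
     \<Rightarrow> ereal \<Rightarrow> (real \<Rightarrow> 'a \<Rightarrow> real) \<Rightarrow> bool" where
  "weak_sol a b \<sigma> p \<epsilon> u0 u1 T u \<longleftrightarrow>
     \<comment> \<open>u in C([0,T), L^2(R^n))\<close>
     (\<forall>t\<in>time_int T. u t \<in> borel_measurable lborel \<and> integrable lborel (\<lambda>x. (u t x)\<^sup>2)) \<and>
     (\<forall>t\<in>time_int T. ((\<lambda>s. LINT x|lborel. (u s x - u t x)\<^sup>2) \<longlongrightarrow> 0) (at t within time_int T)) \<and>
     \<comment> \<open>|u|^p in L^1_loc([0,T) x R^n)\<close>
     set_borel_measurable lborel (time_int T \<times> UNIV) (\<lambda>(t, x). u t x) \<and>
     (\<forall>K. compact K \<and> K \<subseteq> time_int T \<times> UNIV \<longrightarrow>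
          set_integrable lborel K (\<lambda>(t, x). \<bar>u t x\<bar> powr p)) \<and>
     \<comment> \<open>weak formulation\<close>
     (\<forall>\<phi>. test_fun T \<phi> \<longrightarrow>
        (LINT z:time_int T \<times> UNIV|lborel. \<bar>u (fst z) (snd z)\<bar> powr p * \<phi> z)
        = - \<epsilon> * (LINT x|lborel. (u0 x + u1 x) * \<phi> (0, x))
          + \<epsilon> * (LINT x|lborel. u0 x * dt \<phi> (0, x))
          + (LINT z:time_int T \<times> UNIV|lborel. u (fst z) (snd z) *
               (dtt \<phi> z - dt \<phi> z - a * lap_x \<phi> z
                + b * frac_lap \<sigma> (\<lambda>y. \<phi> (fst z, y)) (snd z))))"

definition lifespan ::
  "real \<Rightarrow> real \<Rightarrow> real \<Rightarrow> real \<Rightarrow> real \<Rightarrow> ('a::euclidean_space \<Rightarrow> real) \<Rightarrow> ('a \<Rightarrow> real) \<Rightarrow> ereal" where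
  "lifespan a b \<sigma> p \<epsilon> u0 u1 = Sup {T. T > 0 \<and> (\<exists>u. weak_sol a b \<sigma> p \<epsilon> u0 u1 T u)}"

end

theory Submission
  imports Defs "HOL-Probability.Characteristic_Functions"
begin

text \<open>
  The equation is tested with \<open>\<phi>(t, x) = \<beta>(t/r) \<Psi>(x/K)\<close>, where \<open>K\<^bsup>2s\<^esup> = r\<close> and \<open>s = min 1 \<sigma>\<close>.
  As the fractional Laplacian is nonlocal, \<open>\<Psi>\<close> has to dominate its own image. It is therefore a sum of
  dilations \<open>2\<^bsup>-qk\<^esup> \<Gamma>(y/2\<^sup>k)\<close> of a compactly supported profile with \<open>q = n + \<sigma>\<close>, so that it behaves like
  \<open>J(y) = (1 + |y|)\<^bsup>-q\<^esup>\<close>; since the fractional Laplacian of a bump function decays like \<open>J\<close>, the residual is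
  bounded by a multiple of \<open>J/r\<close> uniformly in the number of summands.

  The lifespan in the critical case needs more. With \<open>\<Gamma>(y) = 2\<^bsup>2s\<^esup> \<gamma>(y/2) - \<gamma>(y)\<close>, the leading operator (of order
  \<open>2s\<close>) sends \<open>\<Gamma>\<close> to a function vanishing at the origin, so the residual is small for \<open>t \<lless> r\<close> and
  \<open>|x| \<lless> K\<close>. If \<open>X(r)\<close> and \<open>Z(r)\<close> denote the integrals of \<open>|u|\<^sup>p \<phi>\<close> without and with this extra weight, then
  \<open>(X(r) + \<epsilon>)\<^sup>p \<le> C r\<^bsup>-\<kappa>\<^esup> Z(r)\<close> with \<open>\<kappa> = 1 - n(p-1)/(2s)\<close>. In the subcritical case \<open>\<kappa> > 0\<close> and
  \<open>Z \<le> 3 X\<close> suffice. In the critical case \<open>\<kappa> = 0\<close>, and the weights at the scales \<open>r = 2\<^sup>j\<close> sum up to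
  \<open>\<Sum>\<^bsub>j\<le>N\<^esub> Z(2\<^sup>j) \<le> C X(2\<^sup>N)\<close>, which gives a discrete version of \<open>S' \<ge> c (S + \<epsilon>)\<^sup>p\<close> and hence at most
  \<open>C \<epsilon>\<^bsup>1-p\<^esup>\<close> dyadic scales.
\<close>

section \<open>A bump function and its derivatives\<close>

text \<open>Test functions must have compact support, while for non-integer \<open>\<sigma>\<close>
  the fractional Laplacian of such a function has an algebraic tail. Truncated sums of dilations
  reconcile the two. Every truncation is admissible, the operator acts on a dilate by a power of the
  scale, so that a single explicit bump has to be estimated, and the truncation index
  \<open>N\<close> tends to infinity only after testing, with all constants independent of it. The
  bump is a tensor product because its Fourier transform and its heat evolution then factor into
  one-dimensional ones. The exponent \<open>n + \<sigma>\<close> is the decay that the subordination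
  argument delivers; it exceeds \<open>n\<close>, so the weight is integrable. The terms of the
  residual differ in size. The first time derivative and the operator of order \<open>2s\<close>
  have the critical size \<open>1/r\<close> and gain only by vanishing at \<open>t = 0\<close> and
  \<open>x = 0\<close> respectively. The second time derivative and the operator of higher order
  carry a surplus \<open>r^(-\<delta>)\<close>. This is the origin of the three summands of
  \<open>weight\<close>.\<close>

definition exp_inv :: "nat \<Rightarrow> real \<Rightarrow> real" where
  "exp_inv k y = (if y > 0 then exp (- 1 / y) / y ^ k else 0)"

lemma exp_inv_nonneg: "exp_inv k y \<ge> 0"
  by (simp add: exp_inv_def)

text \<open>One term of the exponential series against the whole series.\<close>

lemma power_le_fact_exp:
  fixes x :: real
  assumes "x \<ge> 0"
  shows "x ^ n \<le> fact n * exp x"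
proof -
  have "(\<Sum>k\<in>{n}. inverse (fact k) * x ^ k) \<le> (\<Sum>k. inverse (fact k) * x ^ k)"
    using assms by (intro sum_le_suminf) (auto intro!: summable_exp)
  then have "x ^ n / fact n \<le> exp x"
    by (simp add: exp_def divide_inverse mult.commute scaleR_conv_of_real)
  then show ?thesis
    by (simp add: field_simps)
qed

text \<open>The factor \<open>exp (-1/y)\<close> beats every pole, by one term of the series of
  \<open>exp (1/y)\<close>. Since \<open>j\<close> is free, the function vanishes to any order at
  0.\<close>

lemma exp_inv_le_power:
  assumes "y > 0"
  shows "exp_inv k y \<le> fact (k + j) * y ^ j"
proof -
  have "(1 / y) ^ (k + j) \<le> fact (k + j) * exp (1 / y)"
    using assms by (intro power_le_fact_exp) auto
  then have "1 \<le> fact (k + j) * exp (1 / y) * y ^ (k + j)"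
    using assms by (simp add: power_divide field_simps)
  then have "exp (- (1 / y)) * 1 \<le> exp (- (1 / y)) * (fact (k + j) * exp (1 / y) * y ^ (k + j))"
    by (rule mult_left_mono) simp
  also have "\<dots> = fact (k + j) * y ^ (k + j)"
    by (simp add: exp_minus field_simps)
  finally show ?thesis
    using assms by (simp add: exp_inv_def power_add field_simps)
qed

lemma DERIV_exp_inv:
  "(exp_inv k has_real_derivative (exp_inv (k + 2) y - real k * exp_inv (k + 1) y)) (at y)"
proof -
  consider "y > 0" | "y < 0" | "y = 0" by linarith
  then show ?thesis
  proof cases
    case 1
    have "((\<lambda>y. exp (- 1 / y) / y ^ k) has_real_derivative
        (exp_inv (k + 2) y - real k * exp_inv (k + 1) y)) (at y)"
      using 1 by (auto intro!: derivative_eq_intros simp: exp_inv_def field_simps power2_eq_square)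
        (cases k; simp add: field_simps)
    then show ?thesis
    proof (rule has_field_derivative_transform_within_open[of _ _ _ "{0<..}"])
    qed (use 1 in \<open>auto simp: exp_inv_def\<close>)
  next
    case 2
    have "((\<lambda>y. 0) has_real_derivative (exp_inv (k + 2) y - real k * exp_inv (k + 1) y)) (at y)"
      using 2 by (auto simp: exp_inv_def)
    then show ?thesis
    proof (rule has_field_derivative_transform_within_open[of _ _ _ "{..<0}"])
    qed (use 2 in \<open>auto simp: exp_inv_def\<close>)
  next
    case 3
    have "((\<lambda>h. (exp_inv k (0 + h) - exp_inv k 0) / h) \<longlongrightarrow> 0) (at 0)"
    proof (rule Lim_null_comparison)
      show "\<forall>\<^sub>F h in at 0. norm ((exp_inv k (0 + h) - exp_inv k 0) / h) \<le> fact (k + 2) * \<bar>h\<bar>"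
      proof (rule always_eventually, rule allI)
        fix h :: real
        show "norm ((exp_inv k (0 + h) - exp_inv k 0) / h) \<le> fact (k + 2) * \<bar>h\<bar>"
        proof (cases "h > 0")
          case True
          \<comment> \<open>Vanishing to second order (\<open>j = 2\<close>) leaves one power of
            \<open>h\<close> after the division.\<close>
          then show ?thesis
            using exp_inv_le_power[OF True, of k 2] exp_inv_nonneg[of k h]
            by (simp add: exp_inv_def[of k 0] field_simps power2_eq_square)
        next
          case False
          have "fact (k + 2) * \<bar>h\<bar> \<ge> 0" by (intro mult_nonneg_nonneg) auto
          with False show ?thesis by (auto simp: exp_inv_def)
        qed
      qed
      show "((\<lambda>h. fact (k + 2) * \<bar>h\<bar>) \<longlongrightarrow> 0) (at (0::real))"
        by (auto intro!: tendsto_eq_intros)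
    qed
    then show ?thesis
      using 3 by (simp add: DERIV_def exp_inv_def)
  qed
qed

text \<open>With \<open>w = 1 - x^2\<close>, the \<open>k\<close>-th derivative of
  \<open>exp (-1/w)\<close> is this polynomial times \<open>w^(-2k) exp (-1/w)\<close>. The three
  summands come from differentiating the polynomial, the power of \<open>w\<close> and the
  exponential.\<close>

fun bump_poly :: "nat \<Rightarrow> real poly" where
  "bump_poly 0 = 1"
| "bump_poly (Suc k) = pderiv (bump_poly k) * [:1, 0, -1:]\<^sup>2
     + smult (4 * real k) ([:0, 1:] * [:1, 0, -1:] * bump_poly k) - [:0, 2:] * bump_poly k"

text \<open>The \<open>k\<close>-th derivative of the function \<open>exp (-1 / (1 - x\<^sup>2))\<close>, extended by \<open>0\<close>.\<close>

definition bump :: "nat \<Rightarrow> real \<Rightarrow> real" where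
  "bump k x = poly (bump_poly k) x * exp_inv (2 * k) (1 - x\<^sup>2)"

lemma exp_inv_Suc: "exp_inv k y = y * exp_inv (Suc k) y"
  by (simp add: exp_inv_def)

lemma DERIV_bump: "(bump k has_real_derivative bump (Suc k) x) (at x)"
proof -
  let ?w = "1 - x\<^sup>2"
  have 1: "((\<lambda>x. exp_inv (2 * k) (1 - x\<^sup>2)) has_real_derivative
      (exp_inv (2 * k + 2) ?w - real (2 * k) * exp_inv (2 * k + 1) ?w) * (- 2 * x)) (at x)"
    by (rule DERIV_chain2[where f = "exp_inv (2 * k)", OF DERIV_exp_inv])
      (auto intro!: derivative_eq_intros)
  have e1: "exp_inv (Suc (2 * k)) ?w = ?w * exp_inv (2 * k + 2) ?w"
    using exp_inv_Suc[of "Suc (2 * k)" ?w] by simp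
  have e2: "exp_inv (2 * k) ?w = ?w * (?w * exp_inv (2 * k + 2) ?w)"
    using exp_inv_Suc[of "2 * k" ?w] e1 by simp
  have alg: "A' * (w * (w * E)) + (E - real (2 * k) * (w * E)) * (- 2 * x) * A
      = (A' * w\<^sup>2 + 4 * real k * (x * w * A) - x * 2 * A) * E" for A A' w E :: real
    by (simp add: algebra_simps power2_eq_square)
  have "((\<lambda>x. poly (bump_poly k) x * exp_inv (2 * k) (1 - x\<^sup>2)) has_real_derivative
      (poly (pderiv (bump_poly k)) x * exp_inv (2 * k) ?w
       + (exp_inv (2 * k + 2) ?w - real (2 * k) * exp_inv (2 * k + 1) ?w) * (- 2 * x)
         * poly (bump_poly k) x)) (at x)"
    by (rule DERIV_mult[OF poly_DERIV 1])
  also have "poly (pderiv (bump_poly k)) x * exp_inv (2 * k) ?w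
       + (exp_inv (2 * k + 2) ?w - real (2 * k) * exp_inv (2 * k + 1) ?w) * (- 2 * x)
         * poly (bump_poly k) x
     = (poly (pderiv (bump_poly k)) x * ?w\<^sup>2 + 4 * real k * (x * ?w * poly (bump_poly k) x)
         - x * 2 * poly (bump_poly k) x) * exp_inv (2 * k + 2) ?w"
    unfolding e2 Suc_eq_plus1[symmetric] e1 alg[symmetric] by simp
  also have "\<dots> = bump (Suc k) x"
    by (simp add: bump_def power2_eq_square) (simp add: algebra_simps)
  finally have "((\<lambda>x. poly (bump_poly k) x * exp_inv (2 * k) (1 - x\<^sup>2)) has_real_derivative
      bump (Suc k) x) (at x)" .
  then show ?thesis
    by (simp add: bump_def[abs_def])
qed

lemma bump_eq_0: "\<bar>x\<bar> \<ge> 1 \<Longrightarrow> bump k x = 0"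
  by (simp add: bump_def exp_inv_def abs_square_less_1 not_less[symmetric])

lemma isCont_bump: "isCont (bump k) x"
  using DERIV_bump DERIV_isCont by blast

lemma continuous_on_bump: "continuous_on S (bump k)"
  using isCont_bump continuous_at_imp_continuous_on by blast

lemma bump_measurable [measurable]: "bump k \<in> borel_measurable borel"
  by (intro borel_measurable_continuous_onI continuous_on_bump)

lemma bump_bounded: "\<exists>C>0. \<forall>x. \<bar>bump k x\<bar> \<le> C"
proof -
  have "compact (bump k ` {-1..1})"
    by (intro compact_continuous_image continuous_on_bump compact_Icc)
  then obtain C where C: "\<And>x. x \<in> {-1..1} \<Longrightarrow> norm (bump k x) \<le> C"
    by (meson compact_imp_bounded bounded_iff imageI)
  have "\<bar>bump k x\<bar> \<le> max C 1" for x
  proof (cases "\<bar>x\<bar> \<ge> 1")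
    case False
    then have "x \<in> {-1..1}" by auto
    from C[OF this] show ?thesis by simp
  qed (simp add: bump_eq_0)
  then show ?thesis
    by (intro exI[of _ "max C 1"]) auto
qed

lemma bump_0: "bump 0 x = (if \<bar>x\<bar> < 1 then exp (- 1 / (1 - x\<^sup>2)) else 0)"
  by (simp add: bump_def exp_inv_def abs_square_less_1)

lemma bump_0_nonneg: "bump 0 x \<ge> 0"
  by (simp add: bump_0)

lemma bump_0_pos: "\<bar>x\<bar> < 1 \<Longrightarrow> bump 0 x > 0"
  by (simp add: bump_0)

lemma bump_0_le_1: "bump 0 x \<le> 1"
  by (auto simp: bump_0 abs_square_less_1 intro: less_imp_le)

lemma bump_0_antimono:
  assumes "\<bar>x\<bar> \<le> \<bar>y\<bar>"
  shows "bump 0 y \<le> bump 0 x"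
proof (cases "\<bar>y\<bar> < 1")
  case True
  have "x\<^sup>2 \<le> y\<^sup>2" "y\<^sup>2 < 1"
    using assms True by (auto simp: abs_le_square_iff abs_square_less_1)
  then have "1 / (1 - x\<^sup>2) \<le> 1 / (1 - y\<^sup>2)"
    by (intro divide_left_mono) (auto intro!: mult_pos_pos)
  then show ?thesis
    using True assms by (simp add: bump_0)
qed (simp add: bump_0)

text \<open>Split \<open>exp (-1/y)\<close> into \<open>exp (-\<theta>/y)\<close> and
  \<open>exp (-(1-\<theta>)/y)\<close>: the second factor absorbs the pole of order
  \<open>k\<close>.\<close>

lemma exp_inv_le_powr:
  assumes "\<theta> < 1"
  shows "\<exists>C>0. \<forall>y. exp_inv k y \<le> C * exp_inv 0 y powr \<theta>"
proof (intro exI conjI allI)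
  show "fact k / (1 - \<theta>) ^ k > 0" using assms by simp
  fix y :: real
  show "exp_inv k y \<le> fact k / (1 - \<theta>) ^ k * exp_inv 0 y powr \<theta>"
  proof (cases "y > 0")
    case True
    have "((1 - \<theta>) / y) ^ k \<le> fact k * exp ((1 - \<theta>) / y)"
      using True assms by (intro power_le_fact_exp) auto
    then have "1 / y ^ k \<le> fact k / (1 - \<theta>) ^ k * exp ((1 - \<theta>) / y)"
      using True assms by (simp add: power_divide field_simps)
    then have "exp (- 1 / y) * (1 / y ^ k) \<le> exp (- 1 / y) * (fact k / (1 - \<theta>) ^ k * exp ((1 - \<theta>) / y))"
      by (intro mult_left_mono) auto
    also have "\<dots> = fact k / (1 - \<theta>) ^ k * exp (- \<theta> / y)"
      by (simp add: mult_exp_exp algebra_simps diff_divide_distrib)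
    also have "exp (- \<theta> / y) = exp_inv 0 y powr \<theta>"
      using True by (simp add: exp_inv_def powr_def)
    finally show ?thesis
      using True by (simp add: exp_inv_def)
  qed (use assms in \<open>auto simp: exp_inv_def\<close>)
qed

text \<open>With \<open>\<theta> = 1/p\<close> the \<open>p\<close>-th power of \<open>|u|\<close>
  times a derivative of the time cutoff is bounded by a multiple of \<open>|u|^p\<close> times the
  cutoff, although the cutoff vanishes at the end of its support. The factor \<open>|x|\<close> in
  the first bound is the gain near \<open>t = 0\<close>.\<close>

lemma bump_derivative_bounds:
  assumes "\<theta> < 1"
  obtains C where "C > 0" "\<And>x. \<bar>bump 1 x\<bar> \<le> C * \<bar>x\<bar> * bump 0 x powr \<theta>"
    "\<And>x. \<bar>bump 2 x\<bar> \<le> C * bump 0 x powr \<theta>"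
proof -
  obtain C1 where C1: "C1 > 0" "\<And>y. exp_inv 2 y \<le> C1 * exp_inv 0 y powr \<theta>"
    using exp_inv_le_powr[OF assms] by blast
  obtain C2 where C2: "C2 > 0" "\<And>y. exp_inv 4 y \<le> C2 * exp_inv 0 y powr \<theta>"
    using exp_inv_le_powr[OF assms] by blast
  have b0: "bump 0 x = exp_inv 0 (1 - x\<^sup>2)" for x
    by (simp add: bump_def)
  have "compact (poly (bump_poly 2) ` {-1..1::real})"
    by (intro compact_continuous_image compact_Icc) (auto intro!: continuous_intros)
  then obtain M where M: "\<And>x. x \<in> {-1..1} \<Longrightarrow> norm (poly (bump_poly 2) x) \<le> M"
    by (meson compact_imp_bounded bounded_iff imageI)
  have M0: "M \<ge> 0"
    using M[of 0] by (meson atLeastAtMost_iff neg_le_0_iff_le norm_ge_zero order_trans zero_le_one)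
  define C where "C = 2 * C1 + M * C2"
  have C: "C > 0" "2 * C1 \<le> C" "M * C2 \<le> C"
    using C1(1) C2(1) M0 by (auto simp: C_def add_pos_nonneg)
  show ?thesis
  proof
    show "C > 0" by fact
    show "\<bar>bump 1 x\<bar> \<le> C * \<bar>x\<bar> * bump 0 x powr \<theta>" for x
    proof -
      have "\<bar>bump 1 x\<bar> = 2 * \<bar>x\<bar> * exp_inv 2 (1 - x\<^sup>2)"
        by (simp add: bump_def exp_inv_nonneg abs_mult mult.commute)
      also have "\<dots> \<le> 2 * \<bar>x\<bar> * (C1 * bump 0 x powr \<theta>)"
        unfolding b0 by (intro mult_left_mono C1) auto
      also have "\<dots> = (2 * C1) * (\<bar>x\<bar> * bump 0 x powr \<theta>)" by simp
      also have "\<dots> \<le> C * (\<bar>x\<bar> * bump 0 x powr \<theta>)"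
        by (intro mult_right_mono C) auto
      finally show ?thesis by (simp add: mult.assoc)
    qed
    show "\<bar>bump 2 x\<bar> \<le> C * bump 0 x powr \<theta>" for x
    proof (cases "\<bar>x\<bar> \<ge> 1")
      case False
      have "\<bar>bump 2 x\<bar> = \<bar>poly (bump_poly 2) x\<bar> * exp_inv 4 (1 - x\<^sup>2)"
        by (simp add: bump_def exp_inv_nonneg abs_mult)
      also have "\<dots> \<le> M * (C2 * bump 0 x powr \<theta>)"
        unfolding b0 using False M[of x] M0 abs_le_iff[of x 1] by (intro mult_mono C2) (auto simp: exp_inv_nonneg)
      also have "\<dots> = (M * C2) * bump 0 x powr \<theta>" by simp
      also have "\<dots> \<le> C * bump 0 x powr \<theta>"
        by (intro mult_right_mono C) auto
      finally show ?thesis .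
    qed (use C in \<open>simp add: bump_eq_0\<close>)
  qed
qed

section \<open>Smooth functions built from the bump function\<close>

text \<open>Smoothness is defined through iterated Frechet derivatives, so it follows by induction
  on the list of directions for every class that is closed under directional derivatives. An
  arbitrary vector \<open>v\<close> covers coordinates and dilations at once, in space and in
  space-time.\<close>

inductive bump_alg :: "('a::euclidean_space \<Rightarrow> real) \<Rightarrow> bool" where
  const: "bump_alg (\<lambda>x. c)"
| bump: "bump_alg (\<lambda>x. bump k (x \<bullet> v))"
| add: "bump_alg f \<Longrightarrow> bump_alg g \<Longrightarrow> bump_alg (\<lambda>x. f x + g x)"
| mult: "bump_alg f \<Longrightarrow> bump_alg g \<Longrightarrow> bump_alg (\<lambda>x. f x * g x)"

lemma has_derivative_bump_inner:
  "((\<lambda>x. bump k (x \<bullet> v)) has_derivative (\<lambda>h. bump (Suc k) (x \<bullet> v) * (h \<bullet> v))) (at x)"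
proof -
  have "((\<lambda>x. x \<bullet> v) has_derivative (\<lambda>h. h \<bullet> v)) (at x)"
    by (auto intro!: derivative_eq_intros)
  from has_derivative_compose[OF this DERIV_bump[unfolded has_field_derivative_def]]
  show ?thesis .
qed

lemma bump_alg_derivative:
  "bump_alg f \<Longrightarrow> \<exists>f'. (\<forall>x. (f has_derivative f' x) (at x)) \<and> (\<forall>v. bump_alg (\<lambda>x. f' x v))"
proof (induction rule: bump_alg.induct)
  case (const c)
  show ?case
    by (intro exI[of _ "\<lambda>x h. 0"]) (auto intro: bump_alg.const)
next
  case (bump k v)
  show ?case
    by (intro exI[of _ "\<lambda>x h. bump (Suc k) (x \<bullet> v) * (h \<bullet> v)"])
      (auto intro!: has_derivative_bump_inner bump_alg.intros)
next
  case (add f g)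
  then obtain f' g' where "\<forall>x. (f has_derivative f' x) (at x)" "\<forall>v. bump_alg (\<lambda>x. f' x v)"
    "\<forall>x. (g has_derivative g' x) (at x)" "\<forall>v. bump_alg (\<lambda>x. g' x v)" by blast
  then show ?case
    by (intro exI[of _ "\<lambda>x h. f' x h + g' x h"]) (auto intro!: has_derivative_add bump_alg.add)
next
  case (mult f g)
  then obtain f' g' where "\<forall>x. (f has_derivative f' x) (at x)" "\<forall>v. bump_alg (\<lambda>x. f' x v)"
    "\<forall>x. (g has_derivative g' x) (at x)" "\<forall>v. bump_alg (\<lambda>x. g' x v)" by blast
  then show ?case
    using mult.hyps by (intro exI[of _ "\<lambda>x h. f x * g' x h + f' x h * g x"])
      (auto intro!: has_derivative_mult bump_alg.add bump_alg.mult)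
qed

lemma bump_alg_frechet_derivative:
  assumes "bump_alg f"
  shows "bump_alg (\<lambda>x. frechet_derivative f (at x) v)"
proof -
  obtain f' where "\<And>x. (f has_derivative f' x) (at x)" and f': "bump_alg (\<lambda>x. f' x v)"
    using bump_alg_derivative[OF assms] by blast
  then have "frechet_derivative f (at x) = f' x" for x
    by (metis frechet_derivative_at)
  then show ?thesis using f' by simp
qed

lemma bump_alg_smooth:
  assumes "bump_alg f"
  shows "smooth_fun f"
proof -
  have "bump_alg (iter_dderiv vs f)" for vs
    by (induction vs) (auto intro: assms bump_alg_frechet_derivative)
  then show ?thesis
    unfolding smooth_fun_def differentiable_def using bump_alg_derivative by blast
qed

lemma bump_alg_sum: "(\<And>i. i \<in> A \<Longrightarrow> bump_alg (f i)) \<Longrightarrow> bump_alg (\<lambda>x. \<Sum>i\<in>A. f i x)"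
  by (induction A rule: infinite_finite_induct) (auto intro: bump_alg.intros)

lemma bump_alg_prod: "(\<And>i. i \<in> A \<Longrightarrow> bump_alg (f i)) \<Longrightarrow> bump_alg (\<lambda>x. \<Prod>i\<in>A. f i x)"
  by (induction A rule: infinite_finite_induct) (auto intro: bump_alg.intros)

section \<open>Integrals over Euclidean space\<close>

lemma measurable_cis [measurable]:
  "f \<in> borel_measurable M \<Longrightarrow> (\<lambda>x. cis (f x)) \<in> borel_measurable M"
  by (rule borel_measurable_continuous_on[where f = cis]) (auto intro!: continuous_intros)

text \<open>Lebesgue measure is the image of the product measure indexed by \<open>Basis\<close>, so
  integrals of tensor products factor. This reduces Fourier transforms and heat kernels to dimension
  one.\<close>

lemma
  fixes f :: "'a::euclidean_space \<Rightarrow> real \<Rightarrow> 'b::{real_normed_field,banach,second_countable_topology}"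
  assumes "\<And>b. b \<in> Basis \<Longrightarrow> integrable lborel (f b)"
  shows lborel_integrable_prod: "integrable lborel (\<lambda>x::'a. \<Prod>b\<in>Basis. f b (x \<bullet> b))"
    and lborel_integral_prod:
      "(LINT x|lborel. (\<Prod>b\<in>Basis. f b ((x::'a) \<bullet> b))) = (\<Prod>b\<in>Basis. LINT y|lborel. f b y)"
proof -
  interpret product_sigma_finite "\<lambda>_::'a. lborel :: real measure"
    by standard
  have [measurable]: "f b \<in> borel_measurable borel" if "b \<in> Basis" for b
    using borel_measurable_integrable[OF assms[OF that]] by simp
  let ?T = "\<lambda>y. \<Sum>b\<in>Basis. y b *\<^sub>R (b::'a)"
  have T: "?T y \<bullet> b = y b" if "b \<in> Basis" for y b
    using that by simp
  have eq: "(\<Prod>b\<in>Basis. f b (?T y \<bullet> b)) = (\<Prod>b\<in>Basis. f b (y b))" for y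
    by (intro prod.cong) (auto simp: T)
  have meas: "?T \<in> measurable (\<Pi>\<^sub>M b\<in>Basis. lborel) borel"
    by measurable
  have measf: "(\<lambda>x::'a. \<Prod>b\<in>Basis. f b (x \<bullet> b)) \<in> borel_measurable borel"
    by measurable
  have int: "integrable (\<Pi>\<^sub>M b\<in>Basis. lborel) (\<lambda>y. \<Prod>b\<in>Basis. f b (y b))"
    by (intro product_integrable_prod assms) auto
  show "integrable lborel (\<lambda>x::'a. \<Prod>b\<in>Basis. f b (x \<bullet> b))"
    by (subst lborel_eq, subst integrable_distr_eq[OF meas measf]) (simp add: eq int)
  show "(LINT x|lborel. (\<Prod>b\<in>Basis. f b ((x::'a) \<bullet> b))) = (\<Prod>b\<in>Basis. LINT y|lborel. f b y)"
    by (subst lborel_eq, subst integral_distr[OF meas measf])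
      (simp add: eq, rule product_integral_prod, auto intro: assms)
qed

lemma
  fixes f :: "'a::euclidean_space \<Rightarrow> 'b::{banach, second_countable_topology}"
  assumes "c > 0"
  shows lborel_integral_scale:
      "(LINT x|lborel. f (x /\<^sub>R c)) = c ^ DIM('a) *\<^sub>R (LINT x|lborel. f x)"
    and lborel_integrable_scale: "integrable lborel f \<Longrightarrow> integrable lborel (\<lambda>x. f (x /\<^sub>R c))"
proof -
  have *: "integrable lborel (\<lambda>x. f (x /\<^sub>R c)) \<and>
      (LINT x|lborel. f (x /\<^sub>R c)) = c ^ DIM('a) *\<^sub>R (LINT x|lborel. f x)"
    if "integrable lborel f" "c > 0" for f :: "'a \<Rightarrow> 'b" and c :: real
  proof -
    have [measurable]: "f \<in> borel_measurable borel"
      using borel_measurable_integrable[OF that(1)] by simp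
    have M: "lborel = density (distr lborel borel (\<lambda>x::'a. 0 + c *\<^sub>R x)) (\<lambda>_. ennreal (c ^ DIM('a)))"
      using lborel_affine[of c "0::'a"] that(2) by simp
    have f: "integrable lborel (\<lambda>x. c ^ DIM('a) *\<^sub>R f x)"
      using that(1) by simp
    have "integrable lborel (\<lambda>x. f (x /\<^sub>R c))"
      using that f by (subst M) (simp add: integrable_density integrable_distr_eq)
    moreover have "(LINT x|lborel. f (x /\<^sub>R c)) = c ^ DIM('a) *\<^sub>R (LINT x|lborel. f x)"
      using that f by (subst M) (simp add: integral_density integral_distr)
    ultimately show ?thesis ..
  qed
  show "integrable lborel f \<Longrightarrow> integrable lborel (\<lambda>x. f (x /\<^sub>R c))"
    using * assms by blast
  show "(LINT x|lborel. f (x /\<^sub>R c)) = c ^ DIM('a) *\<^sub>R (LINT x|lborel. f x)"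
  proof (cases "integrable lborel f")
    \<comment> \<open>A non-integrable function has integral 0 by convention, so the identity
      persists once the dilated function is known to be non-integrable; dilating back by
      \<open>1 / c\<close> shows this.\<close>
    case False
    have "\<not> integrable lborel (\<lambda>x. f (x /\<^sub>R c))"
      using *[of "\<lambda>x. f (x /\<^sub>R c)" "1 / c"] assms False by auto
    with False show ?thesis by (simp add: not_integrable_integral_eq)
  qed (use * assms in blast)
qed

lemma integrable_one_plus_abs_powr:
  assumes "s > 1"
  shows "integrable lborel (\<lambda>x::real. (1 + \<bar>x\<bar>) powr (- s))"
proof -
  let ?g = "\<lambda>x::real. indicator {0..} x *\<^sub>R (1 + \<bar>x\<bar>) powr (- s)"
  have "(\<integral>\<^sup>+x. ennreal ((1 + \<bar>x\<bar>) powr (- s)) * indicator {0 ..} x \<partial>lborel)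
      = ennreal (0 - (- ((1 + 0) powr (1 - s) / (s - 1))))"
  proof (rule nn_integral_FTC_atLeast[where F = "\<lambda>x. - ((1 + x) powr (1 - s) / (s - 1))"])
    show "((\<lambda>x. - ((1 + x) powr (1 - s) / (s - 1))) has_real_derivative (1 + \<bar>x\<bar>) powr (- s)) (at x)"
      if "0 \<le> x" for x
    proof -
      have "((\<lambda>x. - ((1 + x) powr (1 - s) / (s - 1))) has_real_derivative
          - ((1 - s) * (1 + x) powr (1 - s - 1) / (s - 1))) (at x)"
        using that assms by (auto intro!: derivative_eq_intros)
      also have "- ((1 - s) * (1 + x) powr (1 - s - 1) / (s - 1)) = (1 + \<bar>x\<bar>) powr (- s)"
        using that assms by (simp add: minus_divide_left[symmetric] minus_mult_left[symmetric] del: minus_mult_left minus_divide_left)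
           (simp add: field_simps)
      finally show ?thesis .
    qed
    have "((\<lambda>x::real. (1 + x) powr (1 - s)) \<longlongrightarrow> 0) at_top"
      using assms by (intro tendsto_neg_powr filterlim_tendsto_add_at_top[OF tendsto_const])
        (auto simp: filterlim_ident)
    from tendsto_minus[OF tendsto_divide[OF this tendsto_const[of "s - 1"]]]
    show "((\<lambda>x. - ((1 + x) powr (1 - s) / (s - 1))) \<longlongrightarrow> 0) at_top"
      using assms by simp
  qed auto
  then have g: "integrable lborel ?g"
    by (intro integrableI_bounded) (auto simp: mult.commute ennreal_mult'' ennreal_indicator
        intro: order_le_less_trans[OF _ ennreal_less_top])
  \<comment> \<open>The half-line function plus its reflection dominates the two-sided one; that the
    origin is counted twice does no harm.\<close>
  have "integrable lborel (\<lambda>x. ?g x + ?g (0 + (-1) * x))"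
    using g lborel_integrable_real_affine[OF g, of "-1" 0] by (intro Bochner_Integration.integrable_add) auto
  then show ?thesis
    by (rule Bochner_Integration.integrable_bound) (auto split: split_indicator)
qed

text \<open>Equivalent to the power \<open>-q\<close> of the Japanese bracket. With
  \<open>1 + norm x\<close> in place of the square root, dilations act by plain algebra:
  \<open>2^k (1 + |y|/2^k) = 2^k + |y|\<close>.\<close>

definition jap :: "real \<Rightarrow> 'a::real_normed_vector \<Rightarrow> real" where
  "jap q x = (1 + norm x) powr (- q)"

lemma jap_measurable [measurable]: "jap q \<in> borel_measurable borel"
  unfolding jap_def[abs_def] by measurable

lemma jap_pos: "jap q x > 0"
  by (simp add: jap_def add_pos_nonneg add_nonneg_eq_0_iff)

text \<open>Each \<open>1 + |x_b|\<close> is at most \<open>1 + |x|\<close>. Splitting the exponent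
  evenly, with \<open>q/n > 1\<close> for each coordinate, gives an integrable tensor product as
  majorant.\<close>

lemma integrable_jap:
  assumes "q > real DIM('a)"
  shows "integrable lborel (jap q :: 'a::euclidean_space \<Rightarrow> real)"
proof -
  have "q / DIM('a) > 1" using assms by simp
  then have "integrable lborel (\<lambda>x::'a. \<Prod>b\<in>Basis. (1 + \<bar>x \<bullet> b\<bar>) powr (- (q / DIM('a))))"
    by (intro lborel_integrable_prod integrable_one_plus_abs_powr)
  then show ?thesis
  proof (rule Bochner_Integration.integrable_bound)
    have "jap q x \<le> (\<Prod>b\<in>Basis. (1 + \<bar>x \<bullet> b\<bar>) powr (- (q / DIM('a))))" for x :: 'a
    proof -
      have "jap q x = (\<Prod>b\<in>(Basis :: 'a set). (1 + norm x) powr (- (q / DIM('a))))"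
      proof -
        have "1 + norm x > 0" by (simp add: add_pos_nonneg)
        then have "((1 + norm x) powr (- (q / DIM('a)))) ^ DIM('a) = (1 + norm x) powr (- q)"
          by (subst powr_realpow[symmetric]) (auto simp: powr_powr)
        then show ?thesis by (simp add: jap_def)
      qed
      also have "\<dots> \<le> (\<Prod>b\<in>Basis. (1 + \<bar>x \<bullet> b\<bar>) powr (- (q / DIM('a))))"
        using assms by (intro prod_mono conjI powr_mono2') (auto simp: Basis_le_norm)
      finally show ?thesis .
    qed
    then show "AE x in lborel. norm (jap q x :: real)
        \<le> norm (\<Prod>b\<in>Basis. (1 + \<bar>(x::'a) \<bullet> b\<bar>) powr (- (q / DIM('a))))"
      by (auto intro!: AE_I2 intro: order_trans simp: less_imp_le[OF jap_pos] prod_nonneg)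
  qed auto
qed

section \<open>The Fourier transform of the bump function\<close>

lemma integrable_bump: "integrable lborel (bump k)"
proof -
  have "integrable lborel (\<lambda>x. indicator {-1..1} x *\<^sub>R bump k x)"
    by (intro borel_integrable_compact continuous_on_bump compact_Icc)
  also have "(\<lambda>x. indicator {-1..1} x *\<^sub>R bump k x) = bump k"
    using bump_eq_0[of _ k] by (auto simp: fun_eq_iff abs_le_iff split: split_indicator)
  finally show ?thesis .
qed

lemma integrable_cis_mult:
  fixes f :: "'a \<Rightarrow> real"
  assumes "integrable M f" "g \<in> borel_measurable M"
  shows "integrable M (\<lambda>x. cis (g x) * complex_of_real (f x))"
  using assms(1)
  by (rule Bochner_Integration.integrable_bound)
    (use assms in \<open>auto simp: norm_mult intro: borel_measurable_integrable\<close>)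

lemma fourier_tr_measurable [measurable]:
  fixes f :: "'a::euclidean_space \<Rightarrow> real"
  assumes [measurable]: "f \<in> borel_measurable borel"
  shows "fourier_tr f \<in> borel_measurable borel"
  unfolding fourier_tr_def[abs_def] by measurable

text \<open>Integration by parts; the boundary terms at -1 and 1 vanish.\<close>

lemma fourier_tr_bump_Suc:
  "fourier_tr (bump (Suc k)) \<xi> = \<i> * complex_of_real \<xi> * fourier_tr (bump k) \<xi>"
proof -
  let ?F = "\<lambda>x. cis (- (x * \<xi>)) * complex_of_real (bump k x)"
  let ?f = "\<lambda>x. cis (- (x * \<xi>)) * complex_of_real (bump (Suc k) x)
    - \<i> * complex_of_real \<xi> * (cis (- (x * \<xi>)) * complex_of_real (bump k x))"
  have b: "((\<lambda>x. complex_of_real (bump k x)) has_vector_derivative complex_of_real (bump (Suc k) x)) (at x)" for x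
    using DERIV_bump[of k x] by (simp add: has_real_derivative_iff_has_vector_derivative has_vector_derivative_of_real)
  have c: "((\<lambda>x. cis (- (x * \<xi>))) has_vector_derivative - \<i> * complex_of_real \<xi> * cis (- (x * \<xi>))) (at x)" for x
  proof -
    have "((\<lambda>x. - (x * \<xi>)) has_vector_derivative - \<xi>) (at x)"
      by (auto intro!: derivative_eq_intros simp flip: has_real_derivative_iff_has_vector_derivative)
    from vector_diff_chain_at[OF this has_vector_derivative_iexp] show ?thesis
      by (simp add: o_def cis_conv_exp scaleR_conv_of_real mult_ac)
  qed
  have der: "(?F has_vector_derivative ?f x) (at x within S)" for x S
    using has_vector_derivative_mult[OF c b, of x] has_vector_derivative_at_within
    by (fastforce simp: algebra_simps)
  have "(LINT x|lborel. indicator {-1..1} x *\<^sub>R ?f x) = ?F 1 - ?F (-1)"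
    by (rule integral_FTC_atLeastAtMost)
      (auto intro!: der continuous_intros continuous_on_bump)
  also have "\<dots> = 0"
    by (simp add: bump_eq_0)
  also have "(\<lambda>x. indicator {-1..1} x *\<^sub>R ?f x) = ?f"
    using bump_eq_0 by (auto simp: fun_eq_iff abs_le_iff split: split_indicator)
  finally have "(LINT x|lborel. ?f x) = 0" .
  moreover have "(LINT x|lborel. ?f x) = fourier_tr (bump (Suc k)) \<xi> - \<i> * complex_of_real \<xi> * fourier_tr (bump k) \<xi>"
    unfolding fourier_tr_def
    by (subst Bochner_Integration.integral_diff)
      (auto intro!: integrable_cis_mult integrable_bump integrable_mult_right)
  ultimately show ?thesis by simp
qed

lemma fourier_tr_bump_bounded: "\<exists>C. \<forall>\<xi>. norm (fourier_tr (bump k) \<xi>) \<le> C"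
proof (intro exI allI)
  fix \<xi> :: real
  have "norm (fourier_tr (bump k) \<xi>) \<le> (LINT x|lborel. norm (cis (- (x \<bullet> \<xi>)) * complex_of_real (bump k x)))"
    unfolding fourier_tr_def by (rule integral_norm_bound)
  then show "norm (fourier_tr (bump k) \<xi>) \<le> (LINT x|lborel. \<bar>bump k x\<bar>)"
    by (simp add: norm_mult)
qed

text \<open>Multiplication by \<open>\<xi>^N\<close> turns the transform into that of the
  \<open>N\<close>-th derivative up to a unimodular factor, and the latter is bounded by an L1
  norm.\<close>

lemma fourier_tr_bump_decay: "\<exists>C>0. \<forall>\<xi>. norm (fourier_tr (bump 0) \<xi>) * (1 + \<bar>\<xi>\<bar>) ^ N \<le> C"
proof -
  have pw: "fourier_tr (bump N) \<xi> = (\<i> * complex_of_real \<xi>) ^ N * fourier_tr (bump 0) \<xi>" for \<xi> N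
    by (induction N) (auto simp: fourier_tr_bump_Suc)
  obtain C0 where C0: "\<And>\<xi>. norm (fourier_tr (bump 0) \<xi>) \<le> C0"
    using fourier_tr_bump_bounded by blast
  obtain C1 where C1: "\<And>\<xi>. norm (fourier_tr (bump N) \<xi>) \<le> C1"
    using fourier_tr_bump_bounded by blast
  have C0_nonneg: "C0 \<ge> 0" using C0[of 0] norm_ge_zero order_trans by blast
  have C1_nonneg: "C1 \<ge> 0" using C1[of 0] norm_ge_zero order_trans by blast
  have "norm (fourier_tr (bump 0) \<xi>) * (1 + \<bar>\<xi>\<bar>) ^ N \<le> 2 ^ N * (C0 + C1) + 1" for \<xi>
  proof -
    have "(1 + \<bar>\<xi>\<bar>) ^ N \<le> 2 ^ N * (1 + \<bar>\<xi>\<bar> ^ N)"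
    proof (cases "\<bar>\<xi>\<bar> \<le> 1")
      case True
      then have "(1 + \<bar>\<xi>\<bar>) ^ N \<le> 2 ^ N" by (intro power_mono) auto
      then show ?thesis by (smt (verit) mult_left_le_imp_le mult_le_cancel_left1 zero_le_power abs_ge_zero)
    next
      case False
      then have "(1 + \<bar>\<xi>\<bar>) ^ N \<le> (2 * \<bar>\<xi>\<bar>) ^ N" by (intro power_mono) auto
      then show ?thesis by (simp add: power_mult_distrib distrib_left)
          (smt (verit) zero_le_power)
    qed
    then have "norm (fourier_tr (bump 0) \<xi>) * (1 + \<bar>\<xi>\<bar>) ^ N
        \<le> norm (fourier_tr (bump 0) \<xi>) * (2 ^ N * (1 + \<bar>\<xi>\<bar> ^ N))"
      by (intro mult_left_mono) auto
    also have "\<dots> = 2 ^ N * (norm (fourier_tr (bump 0) \<xi>) + norm (fourier_tr (bump N) \<xi>))"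
      unfolding pw[of N] by (simp add: norm_mult norm_power distrib_left mult.commute)
    also have "\<dots> \<le> 2 ^ N * (C0 + C1)"
      by (intro mult_left_mono add_mono C0 C1) auto
    finally show ?thesis by simp
  qed
  moreover have "2 ^ N * (C0 + C1) + 1 > 0"
    using C0_nonneg C1_nonneg by (simp add: add_nonneg_pos)
  ultimately show ?thesis by blast
qed

lemma integrable_fourier_tr_bump: "integrable lborel (\<lambda>\<xi>. fourier_tr (bump 0) \<xi>)"
proof -
  obtain C where C: "C > 0" "\<And>\<xi>. norm (fourier_tr (bump 0) \<xi>) * (1 + \<bar>\<xi>\<bar>) ^ 2 \<le> C"
    using fourier_tr_bump_decay by blast
  have "integrable lborel (\<lambda>\<xi>::real. C * (1 + \<bar>\<xi>\<bar>) powr (- 2))"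
    by (intro integrable_mult_right integrable_one_plus_abs_powr) auto
  then show ?thesis
  proof (rule Bochner_Integration.integrable_bound)
    show "AE \<xi> in lborel. norm (fourier_tr (bump 0) \<xi>) \<le> norm (C * (1 + \<bar>\<xi>\<bar>) powr (- 2))"
      using C by (auto intro!: AE_I2 simp: powr_minus_divide field_simps abs_mult)
  qed auto
qed

section \<open>The heat semigroup on the bump function\<close>

text \<open>Rescaling by \<open>sqrt (2 * t)\<close> turns these integrals into the characteristic
  function of the standard normal law.\<close>

lemma gaussian_integrable:
  assumes "t > 0"
  shows "integrable lborel (\<lambda>\<xi>. exp (- t * \<xi>\<^sup>2))"
    and "(LINT \<xi>|lborel. exp (- t * \<xi>\<^sup>2)) = sqrt (pi / t)"
    and "(LINT \<xi>|lborel. cis (y * \<xi>) * complex_of_real (exp (- t * \<xi>\<^sup>2)))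
      = complex_of_real (sqrt (pi / t) * exp (- (y\<^sup>2 / (4 * t))))"
proof -
  define c where "c = sqrt (2 * t)"
  have c: "c > 0" "c\<^sup>2 = 2 * t" using assms by (auto simp: c_def)
  have g: "exp (- t * \<xi>\<^sup>2) = sqrt (2 * pi) * std_normal_density (0 + c * \<xi>)" for \<xi>
    using c by (simp add: std_normal_density_def power_mult_distrib)
  show "integrable lborel (\<lambda>\<xi>. exp (- t * \<xi>\<^sup>2))"
    unfolding g using c by (intro integrable_mult_right lborel_integrable_real_affine) auto
  have ch: "(LINT \<xi>|lborel. cis (y * \<xi>) * complex_of_real (exp (- t * \<xi>\<^sup>2)))
      = complex_of_real (sqrt (pi / t) * exp (- (y\<^sup>2 / (4 * t))))" for y
  proof -
    have "complex_of_real (exp (- ((y / c)\<^sup>2) / 2)) = char std_normal_distribution (y / c)"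
      by (simp add: char_std_normal_distribution)
    also have "\<dots> = (LINT x|lborel. std_normal_density x *\<^sub>R iexp (y / c * x))"
      unfolding char_def by (subst integral_density) auto
    also have "\<dots> = \<bar>c\<bar> *\<^sub>R (LINT \<xi>|lborel. std_normal_density (0 + c * \<xi>) *\<^sub>R iexp (y / c * (0 + c * \<xi>)))"
      using c by (intro lborel_integral_real_affine) auto
    also have "\<dots> = c *\<^sub>R (LINT \<xi>|lborel. complex_of_real (1 / sqrt (2 * pi)) *
        (cis (y * \<xi>) * complex_of_real (exp (- t * \<xi>\<^sup>2))))"
    proof -
      have "std_normal_density (0 + c * \<xi>) *\<^sub>R iexp (y / c * (0 + c * \<xi>)) =
          complex_of_real (1 / sqrt (2 * pi)) * (cis (y * \<xi>) * complex_of_real (exp (- t * \<xi>\<^sup>2)))" for \<xi>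
        using c unfolding g by (simp add: cis_conv_exp scaleR_conv_of_real mult_ac)
      then show ?thesis using c by (simp only: abs_of_pos)
    qed
    also have "\<dots> = complex_of_real (c / sqrt (2 * pi)) *
        (LINT \<xi>|lborel. cis (y * \<xi>) * complex_of_real (exp (- t * \<xi>\<^sup>2)))"
      by (subst integral_mult_right_zero) (simp add: scaleR_conv_of_real)
    finally have "(LINT \<xi>|lborel. cis (y * \<xi>) * complex_of_real (exp (- t * \<xi>\<^sup>2)))
       = complex_of_real (sqrt (2 * pi) / c * exp (- ((y / c)\<^sup>2) / 2))"
      using c by (simp add: field_simps)
    also have "sqrt (2 * pi) / c = sqrt (pi / t)"
      by (simp add: c_def real_sqrt_mult real_sqrt_divide)
    also have "- ((y / c)\<^sup>2) / 2 = - (y\<^sup>2 / (4 * t))"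
      using c by (simp add: power_divide)
    finally show ?thesis .
  qed
  show "(LINT \<xi>|lborel. cis (y * \<xi>) * complex_of_real (exp (- t * \<xi>\<^sup>2)))
      = complex_of_real (sqrt (pi / t) * exp (- (y\<^sup>2 / (4 * t))))" by (rule ch)
  have "complex_of_real (LINT \<xi>|lborel. exp (- t * \<xi>\<^sup>2)) = complex_of_real (sqrt (pi / t))"
    using ch[of 0] by (simp flip: of_real_mult add: integral_complex_of_real)
  then show "(LINT \<xi>|lborel. exp (- t * \<xi>\<^sup>2)) = sqrt (pi / t)"
    by (simp only: of_real_eq_iff)
qed

text \<open>The heat semigroup at time \<open>t\<close> applied to \<open>bump 0\<close>, up to the
  factor 2 pi of Fourier inversion. Written on the Fourier side it also makes sense for
  \<open>t = 0\<close>.\<close>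

definition heat_bump :: "real \<Rightarrow> real \<Rightarrow> complex" where
  "heat_bump t x = (LINT \<xi>|lborel. cis (x * \<xi>) * complex_of_real (exp (- t * \<xi>\<^sup>2)) * fourier_tr (bump 0) \<xi>)"

lemma integrable_heat_bump:
  assumes "t \<ge> 0"
  shows "integrable lborel (\<lambda>\<xi>. cis (x * \<xi>) * complex_of_real (exp (- t * \<xi>\<^sup>2)) * fourier_tr (bump 0) \<xi>)"
  by (rule Bochner_Integration.integrable_bound[OF integrable_fourier_tr_bump])
    (use assms in \<open>auto simp: norm_mult intro!: AE_I2 mult_left_le_one_le\<close>)

text \<open>Fubini turns the Fourier side into a convolution with the Gaussian kernel, where the
  compact support of the bump becomes visible.\<close>

lemma heat_bump_eq:
  assumes "t > 0"
  shows "heat_bump t x = (LINT y|lborel. complex_of_real (bump 0 y * (sqrt (pi / t) * exp (- ((x - y)\<^sup>2 / (4 * t))))))"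
proof -
  let ?f = "\<lambda>\<xi> y. cis ((x - y) * \<xi>) * complex_of_real (exp (- t * \<xi>\<^sup>2)) * complex_of_real (bump 0 y)"
  have int: "integrable (lborel \<Otimes>\<^sub>M lborel) (\<lambda>(\<xi>, y). ?f \<xi> y)"
  proof (rule lborel_pair.Fubini_integrable)
    show "integrable lborel (\<lambda>\<xi>. LINT y|lborel. norm (case (\<xi>, y) of (\<xi>, y) \<Rightarrow> ?f \<xi> y))"
      using gaussian_integrable(1)[OF assms] by (simp add: norm_mult)
    show "AE \<xi> in lborel. integrable lborel (\<lambda>y. case (\<xi>, y) of (\<xi>, y) \<Rightarrow> ?f \<xi> y)"
    proof (rule AE_I2)
      fix \<xi> :: real
      have "integrable lborel (\<lambda>y. complex_of_real (exp (- t * \<xi>\<^sup>2)) * (cis ((x - y) * \<xi>) * complex_of_real (bump 0 y)))"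
        by (intro integrable_mult_right integrable_cis_mult integrable_bump) auto
      then show "integrable lborel (\<lambda>y. case (\<xi>, y) of (\<xi>, y) \<Rightarrow> ?f \<xi> y)"
        by (simp add: mult_ac)
    qed
  qed (auto simp del: of_real_exp)
  have "heat_bump t x = (LINT \<xi>|lborel. (LINT y|lborel. ?f \<xi> y))"
    unfolding heat_bump_def fourier_tr_def
  proof (intro Bochner_Integration.integral_cong refl)
    fix \<xi> :: real
    have "cis (x * \<xi>) * complex_of_real (exp (- t * \<xi>\<^sup>2)) * (LINT y|lborel. cis (- (y \<bullet> \<xi>)) * complex_of_real (bump 0 y))
      = (LINT y|lborel. cis (x * \<xi>) * complex_of_real (exp (- t * \<xi>\<^sup>2)) * (cis (- (y \<bullet> \<xi>)) * complex_of_real (bump 0 y)))"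
      by simp
    also have "\<dots> = (LINT y|lborel. ?f \<xi> y)"
    proof (intro Bochner_Integration.integral_cong refl)
      fix y
      have "cis ((x - y) * \<xi>) = cis (x * \<xi>) * cis (- (y * \<xi>))"
        by (simp add: cis_mult algebra_simps)
      then show "cis (x * \<xi>) * complex_of_real (exp (- t * \<xi>\<^sup>2)) * (cis (- (y \<bullet> \<xi>)) * complex_of_real (bump 0 y)) = ?f \<xi> y"
        by (simp add: mult_ac)
    qed
    finally show "cis (x * \<xi>) * complex_of_real (exp (- t * \<xi>\<^sup>2)) * (LINT y|lborel. cis (- (y \<bullet> \<xi>)) * complex_of_real (bump 0 y))
      = (LINT y|lborel. ?f \<xi> y)" .
  qed
  also have "\<dots> = (LINT y|lborel. (LINT \<xi>|lborel. ?f \<xi> y))"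
    using lborel_pair.Fubini_integral[OF int] by simp
  also have "\<dots> = (LINT y|lborel. complex_of_real (bump 0 y * (sqrt (pi / t) * exp (- ((x - y)\<^sup>2 / (4 * t))))))"
  proof (intro Bochner_Integration.integral_cong refl)
    fix y
    have "(LINT \<xi>|lborel. ?f \<xi> y) =
        (LINT \<xi>|lborel. cis ((x - y) * \<xi>) * complex_of_real (exp (- t * \<xi>\<^sup>2))) * complex_of_real (bump 0 y)"
      by (rule integral_mult_left_zero)
    then show "(LINT \<xi>|lborel. ?f \<xi> y) =
        complex_of_real (bump 0 y * (sqrt (pi / t) * exp (- ((x - y)\<^sup>2 / (4 * t)))))"
      unfolding gaussian_integrable(3)[OF assms] by simp
  qed
  finally show ?thesis .
qed

lemma heat_bump_bound: "\<exists>C>0. \<forall>t>0. \<forall>x. norm (heat_bump t x) \<le> C * t powr (- 1 / 2)"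
proof -
  obtain C where C: "\<And>\<xi>. norm (fourier_tr (bump 0) \<xi>) \<le> C"
    using fourier_tr_bump_bounded by blast
  have C0: "C \<ge> 0" using C[of 0] norm_ge_zero order_trans by blast
  have "norm (heat_bump t x) \<le> (C * sqrt pi + 1) * t powr (- 1 / 2)" if "t > 0" for t x
  proof -
    have "norm (heat_bump t x) \<le> (LINT \<xi>|lborel. C * exp (- t * \<xi>\<^sup>2))"
      unfolding heat_bump_def
    proof (rule Bochner_Integration.integral_norm_bound_integral)
      show "integrable lborel (\<lambda>\<xi>. cis (x * \<xi>) * complex_of_real (exp (- t * \<xi>\<^sup>2)) * fourier_tr (bump 0) \<xi>)"
        using that by (intro integrable_heat_bump) auto
      show "integrable lborel (\<lambda>\<xi>. C * exp (- t * \<xi>\<^sup>2))"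
        using gaussian_integrable(1)[OF that] by (rule integrable_mult_right)
      show "norm (cis (x * \<xi>) * complex_of_real (exp (- t * \<xi>\<^sup>2)) * fourier_tr (bump 0) \<xi>)
          \<le> C * exp (- t * \<xi>\<^sup>2)" for \<xi>
        using C[of \<xi>] by (simp add: norm_mult mult_right_mono)
    qed
    also have "\<dots> = C * sqrt (pi / t)"
      using gaussian_integrable(2)[OF that] by simp
    also have "\<dots> = (C * sqrt pi) * t powr (- 1 / 2)"
      using that by (simp add: real_sqrt_divide powr_minus_divide powr_half_sqrt)
    also have "\<dots> \<le> (C * sqrt pi + 1) * t powr (- 1 / 2)"
      by (intro mult_right_mono) auto
    finally show ?thesis .
  qed
  moreover have "C * sqrt pi + 1 > 0" using C0 by (simp add: add_nonneg_pos)
  ultimately show ?thesis by blast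
qed

lemma heat_bump_far_bound:
  "\<exists>C>0. \<forall>t>0. \<forall>x. \<bar>x\<bar> \<ge> 2 \<longrightarrow> norm (heat_bump t x) \<le> C * t powr (- 1 / 2) * exp (- (x\<^sup>2 / (16 * t)))"
proof -
  define A where "A = (LINT y|lborel. bump 0 y)"
  have A0: "A \<ge> 0" unfolding A_def by (intro integral_nonneg_AE) (auto simp: bump_0_nonneg)
  have "norm (heat_bump t x) \<le> (A * sqrt pi + 1) * t powr (- 1 / 2) * exp (- (x\<^sup>2 / (16 * t)))"
    if "t > 0" "\<bar>x\<bar> \<ge> 2" for t x
  proof -
    let ?g = "sqrt (pi / t) * exp (- (x\<^sup>2 / (16 * t)))"
    have pt: "bump 0 y * (sqrt (pi / t) * exp (- ((x - y)\<^sup>2 / (4 * t)))) \<le> bump 0 y * ?g" for y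
    proof (cases "\<bar>y\<bar> \<ge> 1")
      case False
      \<comment> \<open>Since \<open>|x| \<ge> 2\<close> and \<open>|y| < 1\<close>, half of
        \<open>|x|\<close> remains; squaring the half turns the 4 of the Gaussian kernel into
        16.\<close>
      have "\<bar>x / 2\<bar> \<le> \<bar>x - y\<bar>" using that False by linarith
      then have "(x / 2)\<^sup>2 \<le> (x - y)\<^sup>2" by (simp only: abs_le_square_iff)
      then have "x\<^sup>2 / (16 * t) \<le> (x - y)\<^sup>2 / (4 * t)"
        using that by (simp add: field_simps power_divide)
      then show ?thesis
        using that by (intro mult_left_mono bump_0_nonneg) auto
    qed (simp add: bump_eq_0)
    have int: "integrable lborel (\<lambda>y. bump 0 y * ?g)"
      by (intro integrable_mult_left integrable_bump)
    have "norm (heat_bump t x) \<le> (LINT y|lborel. bump 0 y * ?g)"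
      unfolding heat_bump_eq[OF that(1)]
    proof (rule Bochner_Integration.integral_norm_bound_integral[OF _ int])
      have "integrable lborel (\<lambda>y. bump 0 y * (sqrt (pi / t) * exp (- ((x - y)\<^sup>2 / (4 * t)))))"
        by (rule Bochner_Integration.integrable_bound[OF int])
          (use pt that in \<open>auto intro!: AE_I2 simp: abs_mult bump_0_nonneg\<close>)
      then show "integrable lborel (\<lambda>y. complex_of_real (bump 0 y * (sqrt (pi / t) * exp (- ((x - y)\<^sup>2 / (4 * t))))))"
        by (rule integrable_of_real)
      show "norm (complex_of_real (bump 0 y * (sqrt (pi / t) * exp (- ((x - y)\<^sup>2 / (4 * t)))))) \<le> bump 0 y * ?g" for y
        using pt[of y] that bump_0_nonneg[of y] by (simp only: norm_of_real) simp
    qed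
    also have "\<dots> = A * ?g"
      unfolding A_def by simp
    also have "\<dots> = (A * sqrt pi) * t powr (- 1 / 2) * exp (- (x\<^sup>2 / (16 * t)))"
      using that by (simp add: real_sqrt_divide powr_minus_divide powr_half_sqrt)
    also have "\<dots> \<le> (A * sqrt pi + 1) * t powr (- 1 / 2) * exp (- (x\<^sup>2 / (16 * t)))"
      by (intro mult_right_mono) auto
    finally show ?thesis .
  qed
  moreover have "A * sqrt pi + 1 > 0" using A0 by (simp add: add_nonneg_pos)
  ultimately show ?thesis by blast
qed

lemma exp_minus_le_powr:
  fixes N :: real
  assumes "N \<ge> 0"
  shows "\<exists>C>0. \<forall>z::real>0. exp (- z) \<le> C * z powr (- N)"
proof -
  define k where "k = nat \<lceil>N\<rceil>"
  have k: "N \<le> real k" unfolding k_def by (rule real_nat_ceiling_ge)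
  have "exp (- z) \<le> (1 + fact k) * z powr (- N)" if "z > 0" for z :: real
  proof -
    have "z powr N \<le> 1 + z ^ k"
    proof (cases "z \<le> 1")
      case True
      have "z powr N \<le> 1" using True that assms by (simp add: powr_le1)
      moreover have "z ^ k \<ge> 0" using that by simp
      ultimately show ?thesis by linarith
    next
      case False
      then have "z powr N \<le> z powr real k" using k by (intro powr_mono) auto
      also have "z powr real k = z ^ k" using that by (simp add: powr_realpow)
      finally show ?thesis by simp
    qed
    also have "\<dots> \<le> exp z + fact k * exp z"
      using that power_le_fact_exp[of z k] by (intro add_mono) auto
    finally have "z powr N * exp (- z) \<le> (exp z + fact k * exp z) * exp (- z)"
      by (intro mult_right_mono) auto
    also have "\<dots> = 1 + fact k" by (simp add: exp_minus field_simps)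
    finally show ?thesis using that by (simp add: powr_minus field_simps)
  qed
  moreover have "1 + fact k > (0::real)" by (simp add: add_pos_pos)
  ultimately show ?thesis by blast
qed

text \<open>Fourier inversion away from the support, obtained as the limit \<open>t -> 0\<close> of
  the Gaussian tail bound. It removes the summand without heat flow from the binomial expansion of
  \<open>frac_kernel\<close>.\<close>

lemma heat_bump_0_eq_0:
  assumes "\<bar>x\<bar> \<ge> 2"
  shows "heat_bump 0 x = 0"
proof -
  obtain C where C: "C > 0"
    "\<And>t. t > 0 \<Longrightarrow> norm (heat_bump t x) \<le> C * t powr (- 1 / 2) * exp (- (x\<^sup>2 / (16 * t)))"
    using heat_bump_far_bound assms by blast
  obtain D :: real where D: "D > 0" "\<forall>z>0. exp (- z) \<le> D * z powr (- 1)"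
    using exp_minus_le_powr[OF zero_le_one] by blast
  have "(\<lambda>i. heat_bump (1 / real (Suc i)) x) \<longlonglongrightarrow> heat_bump 0 x"
    unfolding heat_bump_def
  proof (rule integral_dominated_convergence)
    show "integrable lborel (\<lambda>\<xi>. norm (fourier_tr (bump 0) \<xi>))"
      using integrable_fourier_tr_bump by (rule integrable_norm)
    show "AE \<xi> in lborel. (\<lambda>i. cis (x * \<xi>) * complex_of_real (exp (- (1 / real (Suc i)) * \<xi>\<^sup>2)) * fourier_tr (bump 0) \<xi>)
        \<longlonglongrightarrow> cis (x * \<xi>) * complex_of_real (exp (- 0 * \<xi>\<^sup>2)) * fourier_tr (bump 0) \<xi>"
      by (intro AE_I2 tendsto_intros LIMSEQ_Suc lim_1_over_n)
    show "AE \<xi> in lborel. norm (cis (x * \<xi>) * complex_of_real (exp (- (1 / real (Suc i)) * \<xi>\<^sup>2)) * fourier_tr (bump 0) \<xi>)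
        \<le> norm (fourier_tr (bump 0) \<xi>)" for i
      by (intro AE_I2) (auto simp: norm_mult intro!: mult_left_le_one_le)
  qed auto
  moreover have "(\<lambda>i. heat_bump (1 / real (Suc i)) x) \<longlonglongrightarrow> 0"
  proof (rule Lim_null_comparison[OF always_eventually], rule allI)
    fix i
    let ?t = "1 / real (Suc i)"
    have t: "?t > 0" by simp
    have x2: "x\<^sup>2 \<ge> 4" using abs_le_square_iff[of 2 x] assms by simp
    have "exp (- (x\<^sup>2 / (16 * ?t))) \<le> D * (x\<^sup>2 / (16 * ?t)) powr (- 1)"
      using x2 t by (intro D(2)[rule_format]) (auto intro!: divide_pos_pos mult_pos_pos)
    also have "\<dots> = D * 16 * ?t / x\<^sup>2"
      using x2 t by (simp add: powr_minus_divide)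
    also have "\<dots> \<le> D * 16 * ?t / 4"
      using D x2 by (intro divide_left_mono) auto
    also have "\<dots> = 4 * D * ?t" by (simp add: field_simps)
    finally have "exp (- (x\<^sup>2 / (16 * ?t))) \<le> 4 * D * ?t" .
    then have "norm (heat_bump ?t x) \<le> C * ?t powr (- 1 / 2) * (4 * D * ?t)"
      using C by (intro order_trans[OF C(2)[OF t]] mult_left_mono) auto
    also have "\<dots> = 4 * C * D * (?t powr (- 1 / 2) * ?t powr 1)"
      using t by simp
    also have "?t powr (- 1 / 2) * ?t powr 1 = ?t powr (1 / 2)"
      by (simp only: powr_add[symmetric]) simp
    finally show "norm (heat_bump ?t x) \<le> 4 * C * D * ?t powr (1 / 2)" .
  next
    have "(\<lambda>i. (1 / real (Suc i)) powr (1 / 2)) \<longlonglongrightarrow> 0 powr (1 / 2)"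
      by (rule tendsto_powr2[OF LIMSEQ_Suc[OF lim_1_over_n] tendsto_const]) auto
    from tendsto_mult_left[OF this, of "4 * C * D"]
    show "(\<lambda>i. 4 * C * D * (1 / real (Suc i)) powr (1 / 2)) \<longlonglongrightarrow> 0"
      by simp
  qed
  ultimately show ?thesis
    by (rule LIMSEQ_unique)
qed

section \<open>The fractional Laplacian of the tensor bump function\<close>

definition bump_n :: "'a::euclidean_space \<Rightarrow> real" where
  "bump_n x = (\<Prod>b\<in>Basis. bump 0 (x \<bullet> b))"

lemma bump_n_measurable [measurable]: "bump_n \<in> borel_measurable borel"
  unfolding bump_n_def[abs_def] by measurable

lemma integrable_bump_n: "integrable lborel bump_n"
  unfolding bump_n_def[abs_def] by (intro lborel_integrable_prod integrable_bump)

lemma cis_sum: "cis (\<Sum>i\<in>A. f i) = (\<Prod>i\<in>A. cis (f i))"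
  by (induction A rule: infinite_finite_induct) (auto simp: cis_mult[symmetric])

lemma cis_inner: "cis (x \<bullet> \<xi>) = (\<Prod>b\<in>Basis. cis ((x \<bullet> b) * (\<xi> \<bullet> b)))"
  by (subst euclidean_inner) (rule cis_sum)

lemma fourier_tr_bump_n:
  "fourier_tr bump_n \<xi> = (\<Prod>b\<in>Basis. fourier_tr (bump 0) (\<xi> \<bullet> b))"
proof -
  have "fourier_tr bump_n \<xi> =
      (LINT x|lborel. (\<Prod>b\<in>Basis. cis (- ((x \<bullet> b) \<bullet> (\<xi> \<bullet> b))) * complex_of_real (bump 0 (x \<bullet> b))))"
    unfolding fourier_tr_def
  proof (intro Bochner_Integration.integral_cong refl)
    fix x :: 'a
    have "cis (- (x \<bullet> \<xi>)) = (\<Prod>b\<in>Basis. cis (- ((x \<bullet> b) \<bullet> (\<xi> \<bullet> b))))"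
      using cis_inner[of x "- \<xi>"] by simp
    then show "cis (- (x \<bullet> \<xi>)) * complex_of_real (bump_n x) =
        (\<Prod>b\<in>Basis. cis (- ((x \<bullet> b) \<bullet> (\<xi> \<bullet> b))) * complex_of_real (bump 0 (x \<bullet> b)))"
      by (simp add: bump_n_def prod.distrib)
  qed
  also have "\<dots> = (\<Prod>b\<in>Basis. LINT y|lborel. cis (- (y \<bullet> (\<xi> \<bullet> b))) * complex_of_real (bump 0 y))"
    by (rule lborel_integral_prod) (auto intro!: integrable_cis_mult integrable_bump)
  finally show ?thesis
    by (simp add: fourier_tr_def)
qed

text \<open>Expanding the product already yields 1 plus the l1 norm. In this form a weight in the
  full norm is distributed over the coordinates.\<close>

lemma one_plus_norm_le_prod:
  "1 + norm \<xi> \<le> (\<Prod>b\<in>Basis. 1 + \<bar>(\<xi>::'a::euclidean_space) \<bullet> b\<bar>)"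
proof -
  have "1 + (\<Sum>b\<in>A. a b) \<le> (\<Prod>b\<in>A. 1 + a b)" if "finite A" "\<And>b. a b \<ge> (0::real)" for A :: "'a set" and a
    using that
  proof (induction A rule: finite_induct)
    case (insert b A)
    have "1 + (a b + sum a A) \<le> (1 + a b) * (1 + sum a A)"
      using insert.prems by (simp add: algebra_simps sum_nonneg)
    also have "\<dots> \<le> (1 + a b) * (\<Prod>b\<in>A. 1 + a b)"
      using insert by (intro mult_left_mono) (auto simp: add_nonneg_nonneg)
    finally show ?case using insert by simp
  qed simp
  from this[of Basis "\<lambda>b. \<bar>\<xi> \<bullet> b\<bar>"] show ?thesis
    using norm_le_l1[of \<xi>] by simp
qed

lemma integrable_powr_fourier_tr_bump_n:
  assumes "s \<ge> 0"
  shows "integrable lborel (\<lambda>\<xi>::'a::euclidean_space. (1 + norm \<xi>) powr s * norm (fourier_tr bump_n \<xi>))"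
proof -
  \<comment> \<open>Of the \<open>N\<close> powers of decay in each coordinate, \<open>s\<close> pay
    for the weight and 2 for integrability.\<close>
  define N where "N = nat \<lceil>s + 2\<rceil>"
  have N: "s + 2 \<le> real N" unfolding N_def by (rule real_nat_ceiling_ge)
  obtain C where C: "C > 0" "\<And>\<xi>. norm (fourier_tr (bump 0) \<xi>) * (1 + \<bar>\<xi>\<bar>) ^ N \<le> C"
    using fourier_tr_bump_decay by blast
  have *: "norm (fourier_tr (bump 0) y) * (1 + \<bar>y\<bar>) powr s \<le> C * (1 + \<bar>y\<bar>) powr (- 2)" for y :: real
  proof -
    have "(1 + \<bar>y\<bar>) powr s * (1 + \<bar>y\<bar>) powr 2 = (1 + \<bar>y\<bar>) powr (s + 2)"
      by (simp only: powr_add)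
    also have "\<dots> \<le> (1 + \<bar>y\<bar>) powr real N"
      using N by (intro powr_mono) auto
    also have "\<dots> = (1 + \<bar>y\<bar>) ^ N"
      by (rule powr_realpow) (simp add: add_pos_nonneg)
    finally have "norm (fourier_tr (bump 0) y) * ((1 + \<bar>y\<bar>) powr s * (1 + \<bar>y\<bar>) powr 2) \<le> C"
      by (intro order_trans[OF mult_left_mono C(2)]) auto
    moreover have "(1 + \<bar>y\<bar>) powr 2 > 0" by (simp add: add_pos_nonneg)
    ultimately show ?thesis
      by (simp add: powr_minus_divide mult.assoc pos_le_divide_eq)
  qed
  have "integrable lborel (\<lambda>\<xi>::'a. \<Prod>b\<in>Basis. C * (1 + \<bar>\<xi> \<bullet> b\<bar>) powr (- 2))"
    by (intro lborel_integrable_prod integrable_mult_right integrable_one_plus_abs_powr) auto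
  then show ?thesis
  proof (rule Bochner_Integration.integrable_bound)
    have "(1 + norm \<xi>) powr s * norm (fourier_tr bump_n \<xi>) \<le> (\<Prod>b\<in>Basis. C * (1 + \<bar>\<xi> \<bullet> b\<bar>) powr (- 2))"
      for \<xi> :: 'a
    proof -
      have "(1 + norm \<xi>) powr s \<le> (\<Prod>b\<in>Basis. 1 + \<bar>\<xi> \<bullet> b\<bar>) powr s"
        using assms one_plus_norm_le_prod by (intro powr_mono2) auto
      also have "\<dots> = (\<Prod>b\<in>Basis. (1 + \<bar>\<xi> \<bullet> b\<bar>) powr s)"
        by (rule prod_powr_distrib)
      finally have "(1 + norm \<xi>) powr s * norm (fourier_tr bump_n \<xi>)
          \<le> (\<Prod>b\<in>Basis. (1 + \<bar>\<xi> \<bullet> b\<bar>) powr s) * norm (fourier_tr bump_n \<xi>)"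
        by (rule mult_right_mono) simp
      also have "\<dots> = (\<Prod>b\<in>Basis. norm (fourier_tr (bump 0) (\<xi> \<bullet> b)) * (1 + \<bar>\<xi> \<bullet> b\<bar>) powr s)"
        by (simp add: fourier_tr_bump_n prod_norm prod.distrib mult.commute)
      also have "\<dots> \<le> (\<Prod>b\<in>Basis. C * (1 + \<bar>\<xi> \<bullet> b\<bar>) powr (- 2))"
        by (intro prod_mono conjI * mult_nonneg_nonneg) auto
      finally show ?thesis .
    qed
    then show "AE \<xi> in lborel. norm ((1 + norm \<xi>) powr s * norm (fourier_tr bump_n \<xi>))
        \<le> norm (\<Prod>b\<in>Basis. C * (1 + \<bar>(\<xi>::'a) \<bullet> b\<bar>) powr (- 2))"
      by (intro AE_I2) (auto intro: order_trans[OF _ abs_ge_self])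
  qed auto
qed

lemma
  assumes "t \<ge> 0"
  shows integrable_heat_bump_n: "integrable lborel
      (\<lambda>\<xi>::'a::euclidean_space. cis (x \<bullet> \<xi>) * complex_of_real (exp (- t * (norm \<xi>)\<^sup>2)) * fourier_tr bump_n \<xi>)" (is ?A)
    and heat_bump_n_eq: "(LINT \<xi>|lborel. cis (x \<bullet> \<xi>) * complex_of_real (exp (- t * (norm (\<xi>::'a))\<^sup>2)) * fourier_tr bump_n \<xi>)
      = (\<Prod>b\<in>Basis. heat_bump t (x \<bullet> b))" (is ?B)
proof -
  have *: "cis (x \<bullet> \<xi>) * complex_of_real (exp (- t * (norm \<xi>)\<^sup>2)) * fourier_tr bump_n \<xi> =
    (\<Prod>b\<in>Basis. cis ((x \<bullet> b) * (\<xi> \<bullet> b)) * complex_of_real (exp (- t * (\<xi> \<bullet> b)\<^sup>2)) * fourier_tr (bump 0) (\<xi> \<bullet> b))"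
    for \<xi> :: 'a
  proof -
    have "(norm \<xi>)\<^sup>2 = (\<Sum>b\<in>Basis. (\<xi> \<bullet> b)\<^sup>2)"
      by (subst power2_norm_eq_inner, subst euclidean_inner) (simp add: power2_eq_square)
    then have "exp (- t * (norm \<xi>)\<^sup>2) = (\<Prod>b\<in>Basis. exp (- t * (\<xi> \<bullet> b)\<^sup>2))"
      by (simp add: sum_distrib_left exp_sum[symmetric] sum_negf)
    then show ?thesis
      by (simp only: cis_inner fourier_tr_bump_n prod.distrib of_real_prod)
  qed
  show ?A unfolding *
    by (rule lborel_integrable_prod) (rule integrable_heat_bump[OF assms])
  show ?B unfolding * heat_bump_def
    by (rule lborel_integral_prod) (rule integrable_heat_bump[OF assms])
qed

lemma power2_powr:
  fixes x :: real
  assumes "x \<ge> 0"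
  shows "(x\<^sup>2) powr s = x powr (2 * s)"
proof (cases "x = 0")
  case False
  then have "x\<^sup>2 = x powr 2" using assms by simp
  then show ?thesis by (simp only: powr_powr)
qed simp

text \<open>Only the large coordinate \<open>b\<close> uses its Gaussian tail; every coordinate
  contributes \<open>t^(-1/2)\<close>, hence \<open>t^(-n/2)\<close> in all. As
  \<open>|x| \<le> n |x_b|\<close>, the tail is at most a multiple of \<open>(|x|^2/t)^(-N)\<close>.
  The free exponent \<open>N\<close> trades decay in \<open>x\<close> against growth in
  \<open>t\<close>.\<close>

lemma prod_heat_bump_bound:
  assumes "N \<ge> DIM('a) / 2"
  shows "\<exists>C>0. \<forall>t>0. \<forall>x::'a::euclidean_space. \<forall>b\<in>Basis.
    \<bar>x \<bullet> b\<bar> \<ge> 2 \<longrightarrow> norm x \<le> DIM('a) * \<bar>x \<bullet> b\<bar> \<longrightarrow>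
    norm (\<Prod>b\<in>Basis. heat_bump t (x \<bullet> b)) \<le> C * t powr (N - DIM('a) / 2) * norm x powr (- 2 * N)"
proof -
  let ?n = "real DIM('a)"
  obtain C1 where C1: "C1 > 0" "\<And>t x. t > 0 \<Longrightarrow> norm (heat_bump t x) \<le> C1 * t powr (- 1 / 2)"
    using heat_bump_bound by blast
  obtain C2 where C2: "C2 > 0" "\<And>t x. t > 0 \<Longrightarrow> \<bar>x\<bar> \<ge> 2 \<Longrightarrow>
      norm (heat_bump t x) \<le> C2 * t powr (- 1 / 2) * exp (- (x\<^sup>2 / (16 * t)))"
    using heat_bump_far_bound by blast
  have "N \<ge> 0" using assms by (simp add: order_trans[of 0 "?n / 2"])
  then obtain D :: real where D: "D > 0" "\<forall>z>0. exp (- z) \<le> D * z powr (- N)"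
    using exp_minus_le_powr by blast
  define C where "C = C1 ^ (DIM('a) - 1) * C2 * D * (1 / (16 * ?n\<^sup>2)) powr (- N)"
  have n: "?n > 0" by simp
  have "C > 0"
    using C1 C2 D n by (simp add: C_def)
  moreover have "norm (\<Prod>b\<in>Basis. heat_bump t (x \<bullet> b)) \<le> C * t powr (N - ?n / 2) * norm x powr (- 2 * N)"
    if t: "t > 0" and b: "b \<in> Basis" and xb: "\<bar>x \<bullet> b\<bar> \<ge> 2" "norm x \<le> ?n * \<bar>x \<bullet> b\<bar>" for t and x b :: 'a
  proof -
    have x0: "norm x > 0" using xb b by (metis abs_le_zero_iff inner_zero_left norm_le_zero_iff not_le
          not_numeral_le_zero order.trans)
    let ?z = "(norm x)\<^sup>2 / (16 * ?n\<^sup>2 * t)"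
    have "(norm x)\<^sup>2 \<le> (?n * \<bar>x \<bullet> b\<bar>)\<^sup>2"
      using xb by (intro power_mono) auto
    then have z: "?z \<le> (x \<bullet> b)\<^sup>2 / (16 * t)"
      using t n by (simp add: field_simps power_mult_distrib)
    have "norm (heat_bump t (x \<bullet> b)) \<le> C2 * t powr (- 1 / 2) * exp (- ((x \<bullet> b)\<^sup>2 / (16 * t)))"
      using C2 t xb by blast
    also have "\<dots> \<le> C2 * t powr (- 1 / 2) * exp (- ?z)"
      using z C2 by (intro mult_left_mono) auto
    also have "\<dots> \<le> C2 * t powr (- 1 / 2) * (D * ?z powr (- N))"
      using D C2 x0 t n by (intro mult_left_mono) auto
    finally have 1: "norm (heat_bump t (x \<bullet> b)) \<le> C2 * t powr (- 1 / 2) * (D * ?z powr (- N))" .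
    have "norm (\<Prod>b\<in>Basis. heat_bump t (x \<bullet> b)) =
        norm (heat_bump t (x \<bullet> b)) * (\<Prod>b\<in>Basis - {b}. norm (heat_bump t (x \<bullet> b)))"
      using b by (subst prod.remove[OF _ b]) (auto simp: norm_mult prod_norm)
    also have "\<dots> \<le> (C2 * t powr (- 1 / 2) * (D * ?z powr (- N))) * (\<Prod>b\<in>Basis - {b}. C1 * t powr (- 1 / 2))"
      using C1 C2 D t by (intro mult_mono 1 prod_mono conjI) (auto intro!: prod_nonneg mult_nonneg_nonneg)
    also have "\<dots> = (C1 ^ (DIM('a) - 1) * C2 * D) * ((t powr (- 1 / 2) * (t powr (- 1 / 2)) ^ (DIM('a) - 1)) * ?z powr (- N))"
      using b by (simp add: power_mult_distrib card_Diff_singleton mult_ac)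
    also have "t powr (- 1 / 2) * (t powr (- 1 / 2)) ^ (DIM('a) - 1) = (t powr (- 1 / 2)) ^ DIM('a)"
      by (subst mult.commute, rule power_minus_mult) simp
    also have "\<dots> = t powr (- ?n / 2)"
      using t by (subst powr_realpow[symmetric]) (auto simp: powr_powr)
    also have "?z = (1 / (16 * ?n\<^sup>2)) * (1 / t) * norm x powr 2"
      using x0 by simp
    also have "\<dots> powr (- N) = (1 / (16 * ?n\<^sup>2)) powr (- N) * t powr N * norm x powr (- 2 * N)"
      using t x0 n by (simp add: powr_mult powr_powr powr_minus_divide powr_divide power2_powr)
    also have "C1 ^ (DIM('a) - 1) * C2 * D * (t powr (- ?n / 2) *
        ((1 / (16 * ?n\<^sup>2)) powr (- N) * t powr N * norm x powr (- 2 * N)))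
        = C * (t powr N * t powr (- ?n / 2)) * norm x powr (- 2 * N)"
      by (simp add: C_def mult_ac)
    also have "t powr N * t powr (- ?n / 2) = t powr (N - ?n / 2)"
      by (simp add: powr_add[symmetric])
    finally show ?thesis .
  qed
  ultimately show ?thesis by blast
qed

section \<open>Subordination of fractional powers to the heat semigroup\<close>

definition subord :: "nat \<Rightarrow> real \<Rightarrow> real \<Rightarrow> real \<Rightarrow> real" where
  "subord m \<sigma> a t = indicator {0<..} t * ((1 - exp (- t * a)) ^ m * t powr (- 1 - \<sigma>))"

lemma subord_measurable [measurable]:
  assumes [measurable]: "f \<in> borel_measurable M" "g \<in> borel_measurable M"
  shows "(\<lambda>x. subord m \<sigma> (f x) (g x)) \<in> borel_measurable M"
  unfolding subord_def by measurable

lemma subord_nonneg: "a \<ge> 0 \<Longrightarrow> subord m \<sigma> a t \<ge> 0"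
  by (auto simp: subord_def split: split_indicator)

text \<open>Glues an estimate for large \<open>t\<close> to one for small \<open>t\<close>:
  \<open>1 + t\<close> is at most \<open>2 t\<close> in the first case and at most 2 in the
  second.\<close>

lemma one_plus_powr_bound:
  fixes s t y :: real
  assumes "t > 0" "s \<ge> 0" "t \<ge> 1 \<Longrightarrow> y \<le> t powr (- s)" "t < 1 \<Longrightarrow> y \<le> 1"
  shows "y \<le> 2 powr s * (1 + \<bar>t\<bar>) powr (- s)"
proof (cases "t \<ge> 1")
  case True
  have "t powr (- s) = 2 powr s * (2 * t) powr (- s)"
    using assms by (simp add: powr_mult powr_minus field_simps)
  also have "\<dots> \<le> 2 powr s * (1 + \<bar>t\<bar>) powr (- s)"
    using True assms by (intro mult_left_mono powr_mono2') auto
  finally show ?thesis using assms True by simp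
next
  case False
  have "2 powr s * 2 powr (- s) \<le> 2 powr s * (1 + \<bar>t\<bar>) powr (- s)"
    using False assms by (intro mult_left_mono powr_mono2') auto
  then show ?thesis using assms False by (simp add: powr_minus)
qed

lemma subord_le_power:
  assumes "t > 0"
  shows "0 \<le> (1 - exp (- t)) ^ m" "(1 - exp (- t)) ^ m \<le> t ^ m" "(1 - exp (- t)) ^ m \<le> (1::real)"
proof -
  have "1 - exp (- t) \<le> t" using exp_ge_add_one_self[of "- t"] by linarith
  then show "(1 - exp (- t)) ^ m \<le> t ^ m" using assms by (intro power_mono) auto
  show "0 \<le> (1 - exp (- t)) ^ m" "(1 - exp (- t)) ^ m \<le> (1::real)"
    using assms by (auto intro!: power_le_one)
qed

text \<open>Near 0 the \<open>m\<close>-th power supplies \<open>t^m\<close>, and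
  \<open>m \<ge> \<sigma> + 1\<close> keeps \<open>t^(m-1-\<sigma>)\<close> bounded. At infinity
  that power is at most 1, and \<open>t^(-1-\<sigma>)\<close> is integrable.\<close>

lemma integrable_subord_1:
  assumes "\<sigma> > 0" "\<sigma> + 1 \<le> real m"
  shows "integrable lborel (subord m \<sigma> 1)"
proof -
  have "integrable lborel (\<lambda>t::real. 2 powr (1 + \<sigma>) * (1 + \<bar>t\<bar>) powr (- (1 + \<sigma>)))"
    using assms by (intro integrable_mult_right integrable_one_plus_abs_powr) auto
  then show ?thesis
  proof (rule Bochner_Integration.integrable_bound)
    have "subord m \<sigma> 1 t \<le> 2 powr (1 + \<sigma>) * (1 + \<bar>t\<bar>) powr (- (1 + \<sigma>))" for t
    proof (cases "t > 0")
      case True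
      show ?thesis
      proof (rule one_plus_powr_bound[OF True])
        show "subord m \<sigma> 1 t \<le> t powr (- (1 + \<sigma>))"
          using subord_le_power(1,3)[OF True, of m] True by (simp add: subord_def mult_left_le_one_le)
        assume "t < 1"
        have "subord m \<sigma> 1 t \<le> t ^ m * t powr (- 1 - \<sigma>)"
          using subord_le_power(2)[OF True, of m] True by (simp add: subord_def mult_right_mono)
        also have "\<dots> = t powr (real m - 1 - \<sigma>)"
          using True by (simp add: powr_realpow[symmetric] powr_add[symmetric] algebra_simps)
        also have "\<dots> \<le> 1"
          using True \<open>t < 1\<close> assms by (intro powr_le1) auto
        finally show "subord m \<sigma> 1 t \<le> 1" .
      qed (use assms in auto)
    qed (auto simp: subord_def)
    then show "AE t in lborel. norm (subord m \<sigma> 1 t) \<le> norm (2 powr (1 + \<sigma>) * (1 + \<bar>t\<bar>) powr (- (1 + \<sigma>)))"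
      by (intro AE_I2) (auto simp: subord_nonneg abs_mult)
  qed auto
qed

definition subord_const :: "nat \<Rightarrow> real \<Rightarrow> real" where
  "subord_const m \<sigma> = (LINT t|lborel. subord m \<sigma> 1 t)"

lemma subord_const_pos:
  assumes "\<sigma> > 0" "\<sigma> + 1 \<le> real m"
  shows "subord_const m \<sigma> > 0"
proof -
  have "\<not> (AE t in lborel. subord m \<sigma> 1 t = 0)"
  proof
    assume ae: "AE t in lborel. subord m \<sigma> 1 t = 0"
    have pos: "subord m \<sigma> 1 t > 0" if "t > 0" for t
      using that by (simp add: subord_def)
    have "AE t in lborel. t \<notin> {0<..<1::real}"
      using ae by (rule eventually_mono) (use pos in force)
    then have "{0<..<1::real} \<in> null_sets lborel"
      by (subst (asm) AE_iff_null_sets[symmetric]) auto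
    then show False by (simp add: null_sets_def)
  qed
  then have "subord_const m \<sigma> \<noteq> 0"
    unfolding subord_const_def
    using integral_nonneg_eq_0_iff_AE[OF integrable_subord_1[OF assms]] by (auto simp: subord_nonneg)
  moreover have "subord_const m \<sigma> \<ge> 0"
    unfolding subord_const_def by (intro integral_nonneg_AE) (auto simp: subord_nonneg)
  ultimately show ?thesis by simp
qed

text \<open>Homogeneity: the substitution \<open>t -> a t\<close> pulls out
  \<open>a^\<sigma>\<close>.\<close>

lemma
  assumes "\<sigma> > 0" "\<sigma> + 1 \<le> real m" "a \<ge> 0"
  shows integrable_subord: "integrable lborel (subord m \<sigma> a)"
    and integral_subord: "(LINT t|lborel. subord m \<sigma> a t) = subord_const m \<sigma> * a powr \<sigma>"
proof -
  have "integrable lborel (subord m \<sigma> a) \<and> (LINT t|lborel. subord m \<sigma> a t) = subord_const m \<sigma> * a powr \<sigma>"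
  proof (cases "a = 0")
    case True
    have "m > 0" using assms by (cases m) auto
    then have "subord m \<sigma> a = (\<lambda>t. 0)" using True by (auto simp: subord_def fun_eq_iff)
    then show ?thesis using True by simp
  next
    case False
    then have a: "a > 0" using assms by simp
    have eq: "subord m \<sigma> a t = a powr (1 + \<sigma>) * subord m \<sigma> 1 (0 + a * t)" for t
    proof (cases "t > 0")
      case True
      then have "a powr (1 + \<sigma>) * (a * t) powr (- 1 - \<sigma>) = t powr (- 1 - \<sigma>)"
        using a by (simp add: powr_mult powr_add[symmetric] mult.assoc[symmetric])
      then show ?thesis using True a by (simp add: subord_def mult_ac)
    qed (use a in \<open>simp add: subord_def zero_less_mult_iff\<close>)
    have "(LINT t|lborel. subord m \<sigma> 1 t) = \<bar>a\<bar> *\<^sub>R (LINT t|lborel. subord m \<sigma> 1 (0 + a * t))"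
      using a by (intro lborel_integral_real_affine) auto
    then have "subord_const m \<sigma> / a = (LINT t|lborel. subord m \<sigma> 1 (0 + a * t))"
      using a by (simp add: subord_const_def)
    moreover have "integrable lborel (\<lambda>t. subord m \<sigma> 1 (0 + a * t))"
      using a by (intro lborel_integrable_real_affine integrable_subord_1 assms) auto
    ultimately show ?thesis
      unfolding eq[abs_def] using a by (simp add: powr_add field_simps)
  qed
  then show "integrable lborel (subord m \<sigma> a)" "(LINT t|lborel. subord m \<sigma> a t) = subord_const m \<sigma> * a powr \<sigma>"
    by auto
qed

section \<open>The fractional Laplacian of one bump: subordination formula, decay and Lipschitz
  bound\<close>

definition frac_kernel :: "real \<Rightarrow> 'a::euclidean_space \<Rightarrow> complex" where
  "frac_kernel \<sigma> x = (LINT \<xi>|lborel. cis (x \<bullet> \<xi>) * complex_of_real (norm \<xi> powr (2 * \<sigma>)) * fourier_tr bump_n \<xi>)"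

lemma norm_powr_le:
  assumes "s \<ge> 0" shows "norm (\<xi>::'a::real_normed_vector) powr s \<le> (1 + norm \<xi>) powr s"
  using assms by (intro powr_mono2) auto

lemma integrable_frac_kernel:
  assumes "\<sigma> > 0"
  shows "integrable lborel (\<lambda>\<xi>::'a::euclidean_space. cis (x \<bullet> \<xi>) * complex_of_real (norm \<xi> powr (2 * \<sigma>)) * fourier_tr bump_n \<xi>)"
  by (rule Bochner_Integration.integrable_bound[OF integrable_powr_fourier_tr_bump_n[of "2 * \<sigma>"]])
    (use assms in \<open>auto simp: norm_mult intro!: AE_I2 mult_right_mono norm_powr_le\<close>)

text \<open>For \<open>m > \<sigma>\<close> the power \<open>|\<xi>|\<^bsup>2\<sigma>\<^esup>\<close> is a constant multiple of
  \<open>\<integral>\<^sub>0\<^sup>\<infinity> (1 - exp (-t|\<xi>|\<^sup>2))\<^sup>m t\<^bsup>-1-\<sigma>\<^esup> dt\<close>. After binomial expansion each summand is a heat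
  semigroup applied to the bump, so away from its support only Gaussian tails remain.\<close>

lemma frac_kernel_subord:
  fixes x :: "'a::euclidean_space"
  assumes \<sigma>: "\<sigma> > 0" "\<sigma> + 1 \<le> real m"
  shows "complex_of_real (subord_const m \<sigma>) * frac_kernel \<sigma> x =
    (LINT t|lborel. complex_of_real (indicator {0<..} t * t powr (- 1 - \<sigma>)) *
       (\<Sum>j\<le>m. of_nat (m choose j) * (- 1) ^ j * (\<Prod>b\<in>Basis. heat_bump (real j * t) (x \<bullet> b))))"
proof -
  let ?f = "\<lambda>(\<xi>::'a) t. cis (x \<bullet> \<xi>) * fourier_tr bump_n \<xi> * complex_of_real (subord m \<sigma> ((norm \<xi>)\<^sup>2) t)"
  have nrm: "((norm \<xi>)\<^sup>2) powr \<sigma> = norm \<xi> powr (2 * \<sigma>)" for \<xi> :: 'a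
    by (rule power2_powr) simp
  \<comment> \<open>Fubini has to precede the binomial expansion: the unexpanded integrand in
    \<open>t\<close> is non-negative with integral a multiple of \<open>|\<xi>|^(2\<sigma>)\<close>,
    whereas single terms of the expansion are not integrable near \<open>t = 0\<close>.\<close>
  have int: "integrable (lborel \<Otimes>\<^sub>M lborel) (\<lambda>(\<xi>, t). ?f \<xi> t)"
  proof (rule lborel_pair.Fubini_integrable)
    have "(LINT t|lborel. norm (case (\<xi>, t) of (\<xi>, t) \<Rightarrow> ?f \<xi> t)) =
        subord_const m \<sigma> * (norm \<xi> powr (2 * \<sigma>) * norm (fourier_tr bump_n \<xi>))" for \<xi> :: 'a
      using integral_subord[OF \<sigma>, of "(norm \<xi>)\<^sup>2"]
      by (simp add: norm_mult subord_nonneg nrm mult_ac)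
    moreover have "integrable lborel (\<lambda>\<xi>::'a. subord_const m \<sigma> * (norm \<xi> powr (2 * \<sigma>) * norm (fourier_tr bump_n \<xi>)))"
      using integrable_norm[OF integrable_frac_kernel[OF \<sigma>(1), of 0]]
      by (intro integrable_mult_right) (simp add: norm_mult)
    ultimately show "integrable lborel (\<lambda>\<xi>. LINT t|lborel. norm (case (\<xi>, t) of (\<xi>, t) \<Rightarrow> ?f \<xi> t))"
      by simp
    show "AE \<xi> in lborel. integrable lborel (\<lambda>t. case (\<xi>, t) of (\<xi>, t) \<Rightarrow> ?f \<xi> t)"
      by (intro AE_I2) (auto intro!: integrable_mult_right integrable_of_real integrable_subord[OF \<sigma>])
  qed auto
  have "complex_of_real (subord_const m \<sigma>) * frac_kernel \<sigma> x = (LINT \<xi>|lborel. (LINT t|lborel. ?f \<xi> t))"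
    unfolding frac_kernel_def
    by (subst integral_mult_right_zero[symmetric])
      (intro Bochner_Integration.integral_cong refl,
        simp add: integral_subord[OF \<sigma>] nrm mult_ac integral_complex_of_real)
  also have "\<dots> = (LINT t|lborel. (LINT \<xi>|lborel. ?f \<xi> t))"
    using lborel_pair.Fubini_integral[OF int] by simp
  also have "\<dots> = (LINT t|lborel. complex_of_real (indicator {0<..} t * t powr (- 1 - \<sigma>)) *
       (\<Sum>j\<le>m. of_nat (m choose j) * (- 1) ^ j * (\<Prod>b\<in>Basis. heat_bump (real j * t) (x \<bullet> b))))"
  proof (intro Bochner_Integration.integral_cong refl)
    fix t :: real
    show "(LINT \<xi>|lborel. ?f \<xi> t) = complex_of_real (indicator {0<..} t * t powr (- 1 - \<sigma>)) *
       (\<Sum>j\<le>m. of_nat (m choose j) * (- 1) ^ j * (\<Prod>b\<in>Basis. heat_bump (real j * t) (x \<bullet> b)))"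
    proof (cases "t > 0")
      case True
      let ?h = "\<lambda>j \<xi>. cis (x \<bullet> \<xi>) * complex_of_real (exp (- (real j * t) * (norm \<xi>)\<^sup>2)) * fourier_tr bump_n \<xi>"
      have "?f \<xi> t = complex_of_real (t powr (- 1 - \<sigma>)) *
          (\<Sum>j\<le>m. of_nat (m choose j) * (- 1) ^ j * ?h j \<xi>)" for \<xi>
      proof -
        let ?e = "exp (- t * (norm \<xi>)\<^sup>2)"
        have "(1 - ?e) ^ m = (\<Sum>j\<le>m. of_nat (m choose j) * (- ?e) ^ j * 1 ^ (m - j))"
          using binomial_ring[of "- ?e" 1 m] by simp
        also have "\<dots> = (\<Sum>j\<le>m. of_nat (m choose j) * (- 1) ^ j * exp (- (real j * t) * (norm \<xi>)\<^sup>2))"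
          by (intro sum.cong refl, subst power_minus, subst exp_of_nat_mult[symmetric]) (simp add: mult_ac)
        finally have "complex_of_real ((1 - ?e) ^ m) =
            (\<Sum>j\<le>m. of_nat (m choose j) * (- 1) ^ j * complex_of_real (exp (- (real j * t) * (norm \<xi>)\<^sup>2)))"
          by (simp only: of_real_sum of_real_mult of_real_power of_real_minus of_real_1 of_real_of_nat_eq)
        then have "?f \<xi> t = complex_of_real (t powr (- 1 - \<sigma>)) * (cis (x \<bullet> \<xi>) * fourier_tr bump_n \<xi> *
          (\<Sum>j\<le>m. of_nat (m choose j) * (- 1) ^ j * complex_of_real (exp (- (real j * t) * (norm \<xi>)\<^sup>2))))"
          using True by (simp only: subord_def of_real_mult) simp
        then show ?thesis
          by (simp only: sum_distrib_left mult_ac)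
      qed
      then have "(LINT \<xi>|lborel. ?f \<xi> t) = complex_of_real (t powr (- 1 - \<sigma>)) *
          (LINT \<xi>|lborel. (\<Sum>j\<le>m. of_nat (m choose j) * (- 1) ^ j * ?h j \<xi>))"
        by (simp only: integral_mult_right_zero)
      also have "(LINT \<xi>|lborel. (\<Sum>j\<le>m. of_nat (m choose j) * (- 1) ^ j * ?h j \<xi>)) =
          (\<Sum>j\<le>m. (LINT \<xi>|lborel. of_nat (m choose j) * (- 1) ^ j * ?h j \<xi>))"
        using True by (intro Bochner_Integration.integral_sum integrable_mult_right integrable_heat_bump_n) auto
      also have "\<dots> = (\<Sum>j\<le>m. of_nat (m choose j) * (- 1) ^ j * (\<Prod>b\<in>Basis. heat_bump (real j * t) (x \<bullet> b)))"
        using True by (simp only: integral_mult_right_zero heat_bump_n_eq mult_nonneg_nonneg of_nat_0_le_iff less_imp_le)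
      finally show ?thesis using True by simp
    qed (simp add: subord_def)
  qed
  finally show ?thesis .
qed

text \<open>The heat bound is used with different exponents for large and small \<open>t\<close>. At
  infinity, integrability of \<open>t^(-1-\<sigma>) t^(N-n/2)\<close> requires
  \<open>N < n/2 + \<sigma>\<close>, and the choice halfway gives the decay
  \<open>n + \<sigma>\<close>. At 0 the singularity \<open>t^(-1-\<sigma>)\<close> must be
  cancelled, which takes a larger \<open>N\<close>.\<close>

lemma frac_kernel_far_bound:
  fixes \<sigma> :: real
  assumes \<sigma>: "\<sigma> > 0"
  shows "\<exists>C>0. \<forall>x::'a::euclidean_space. \<forall>b\<in>Basis. \<bar>x \<bullet> b\<bar> \<ge> 2 \<longrightarrow> norm x \<le> DIM('a) * \<bar>x \<bullet> b\<bar> \<longrightarrow>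
    norm (frac_kernel \<sigma> x) \<le> C * norm x powr (- (DIM('a) + \<sigma>))"
proof -
  let ?n = "real DIM('a)"
  define m where "m = nat \<lceil>\<sigma> + 1\<rceil>"
  have m: "\<sigma> + 1 \<le> real m" unfolding m_def by (rule real_nat_ceiling_ge)
  define c where "c = subord_const m \<sigma>"
  have c: "c > 0" unfolding c_def by (rule subord_const_pos[OF \<sigma> m])
  \<comment> \<open>\<open>N1\<close> serves \<open>t \<ge> 1\<close> and \<open>N2\<close> serves
    \<open>t < 1\<close>, where \<open>t^(\<sigma>+1)\<close> cancels the singularity exactly. Since
    \<open>|x| \<ge> 2\<close>, the faster decay in \<open>x\<close> from \<open>N2\<close> is
    weakened to the common power.\<close>
  define N1 where "N1 = ?n / 2 + \<sigma> / 2"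
  define N2 where "N2 = ?n / 2 + \<sigma> + 1"
  have N: "?n / 2 \<le> N1" "?n / 2 \<le> N2" using \<sigma> by (auto simp: N1_def N2_def)
  obtain C1 where C1: "C1 > 0" "\<And>t x b. t > 0 \<Longrightarrow> b \<in> Basis \<Longrightarrow> \<bar>x \<bullet> b\<bar> \<ge> 2 \<Longrightarrow> norm x \<le> ?n * \<bar>x \<bullet> b\<bar> \<Longrightarrow>
      norm (\<Prod>b\<in>Basis. heat_bump t ((x::'a) \<bullet> b)) \<le> C1 * t powr (N1 - ?n / 2) * norm x powr (- 2 * N1)"
    using prod_heat_bump_bound[OF N(1)] by blast
  obtain C2 where C2: "C2 > 0" "\<And>t x b. t > 0 \<Longrightarrow> b \<in> Basis \<Longrightarrow> \<bar>x \<bullet> b\<bar> \<ge> 2 \<Longrightarrow> norm x \<le> ?n * \<bar>x \<bullet> b\<bar> \<Longrightarrow>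
      norm (\<Prod>b\<in>Basis. heat_bump t ((x::'a) \<bullet> b)) \<le> C2 * t powr (N2 - ?n / 2) * norm x powr (- 2 * N2)"
    using prod_heat_bump_bound[OF N(2)] by blast
  define B where "B = C1 * real m powr (\<sigma> / 2) + C2 * real m powr (\<sigma> + 1)"
  define E where "E = (\<Sum>j\<le>m. real (m choose j)) * B * 2 powr (1 + \<sigma> / 2)"
  define C where "C = E * (LINT t|lborel. (1 + \<bar>t\<bar>) powr (- (1 + \<sigma> / 2))) / c"
  have m0: "m > 0" using m \<sigma> by (cases m) auto
  have B: "B \<ge> 0" using C1 C2 by (simp add: B_def)
  have E: "E \<ge> 0" using B by (simp add: E_def sum_nonneg)
  have "norm (frac_kernel \<sigma> x) \<le> (C + 1) * norm x powr (- (?n + \<sigma>))"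
    if b: "b \<in> Basis" and xb: "\<bar>x \<bullet> b\<bar> \<ge> 2" "norm x \<le> ?n * \<bar>x \<bullet> b\<bar>" for x b :: 'a
  proof -
    let ?X = "norm x powr (- (?n + \<sigma>))"
    let ?P = "\<lambda>s. \<Prod>b\<in>Basis. heat_bump s (x \<bullet> b)"
    have x2: "norm x \<ge> 2" using xb(1) Basis_le_norm[OF b, of x] by linarith
    have P0: "?P 0 = 0"
      using b xb heat_bump_0_eq_0 by (intro prod_zero) auto
    have P1: "norm (?P (real j * t)) \<le> B * t powr (\<sigma> / 2) * ?X" if "t \<ge> 1" "j \<le> m" for j t
    proof (cases "j = 0")
      case False
      then have j: "real j * t > 0" "real j * t \<le> real m * t" using that by auto
      have "norm (?P (real j * t)) \<le> C1 * (real j * t) powr (\<sigma> / 2) * ?X"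
        using C1(2)[OF j(1) b xb] by (simp add: N1_def)
      also have "\<dots> \<le> C1 * (real m * t) powr (\<sigma> / 2) * ?X"
        using j \<sigma> C1(1) that by (intro mult_right_mono mult_left_mono powr_mono2) auto
      also have "\<dots> = (C1 * real m powr (\<sigma> / 2)) * (t powr (\<sigma> / 2) * ?X)"
        using that by (simp add: powr_mult)
      also have "\<dots> \<le> B * (t powr (\<sigma> / 2) * ?X)"
        using C2 by (intro mult_right_mono) (auto simp: B_def)
      finally show ?thesis by (simp add: mult.assoc)
    next
      case True
      have "norm (?P (real j * t)) = 0" unfolding True by (simp only: of_nat_0 mult_zero_left P0 norm_zero)
      then show ?thesis by (rule ord_eq_le_trans) (use B in simp)
    qed
    have P2: "norm (?P (real j * t)) \<le> B * t powr (\<sigma> + 1) * ?X" if "t > 0" "j \<le> m" for j t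
    proof (cases "j = 0")
      case False
      then have j: "real j * t > 0" "real j * t \<le> real m * t" using that by auto
      have "norm (?P (real j * t)) \<le> C2 * (real j * t) powr (\<sigma> + 1) * norm x powr (- 2 * N2)"
        using C2(2)[OF j(1) b xb] by (simp add: N2_def)
      also have "\<dots> \<le> C2 * (real m * t) powr (\<sigma> + 1) * ?X"
        using j \<sigma> C2(1) x2 that by (intro mult_mono mult_left_mono powr_mono2 powr_mono) (auto simp: N2_def)
      also have "\<dots> = (C2 * real m powr (\<sigma> + 1)) * (t powr (\<sigma> + 1) * ?X)"
        using that by (simp add: powr_mult)
      also have "\<dots> \<le> B * (t powr (\<sigma> + 1) * ?X)"
        using C1 by (intro mult_right_mono) (auto simp: B_def)
      finally show ?thesis by (simp add: mult.assoc)
    next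
      case True
      have "norm (?P (real j * t)) = 0" unfolding True by (simp only: of_nat_0 mult_zero_left P0 norm_zero)
      then show ?thesis by (rule ord_eq_le_trans) (use B in simp)
    qed
    let ?g = "\<lambda>t. complex_of_real (indicator {0<..} t * t powr (- 1 - \<sigma>)) *
       (\<Sum>j\<le>m. of_nat (m choose j) * (- 1) ^ j * ?P (real j * t))"
    have g: "norm (?g t) \<le> E * ?X * (1 + \<bar>t\<bar>) powr (- (1 + \<sigma> / 2))" for t
    proof (cases "t > 0")
      case True
      have P: "t powr (- 1 - \<sigma>) * norm (?P (real j * t)) \<le> B * ?X * (2 powr (1 + \<sigma> / 2) * (1 + \<bar>t\<bar>) powr (- (1 + \<sigma> / 2)))"
        if "j \<le> m" for j
      proof -
        have "t powr (- 1 - \<sigma>) * norm (?P (real j * t)) \<le> B * ?X * (if t \<ge> 1 then t powr (- (1 + \<sigma> / 2)) else 1)"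
        proof (cases "t \<ge> 1")
          case t1: True
          have "t powr (- 1 - \<sigma>) * norm (?P (real j * t)) \<le> t powr (- 1 - \<sigma>) * (B * t powr (\<sigma> / 2) * ?X)"
            using P1[OF t1 that] by (intro mult_left_mono) auto
          also have "\<dots> = B * ?X * (t powr (- 1 - \<sigma>) * t powr (\<sigma> / 2))" by (simp add: mult_ac)
          also have "t powr (- 1 - \<sigma>) * t powr (\<sigma> / 2) = t powr (- (1 + \<sigma> / 2))"
            by (simp add: powr_add[symmetric] algebra_simps)
          finally show ?thesis using t1 by simp
        next
          case t1: False
          have "t powr (- 1 - \<sigma>) * norm (?P (real j * t)) \<le> t powr (- 1 - \<sigma>) * (B * t powr (\<sigma> + 1) * ?X)"
            using P2[OF True that] by (intro mult_left_mono) auto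
          also have "\<dots> = B * ?X * (t powr (- 1 - \<sigma>) * t powr (\<sigma> + 1))" by (simp add: mult_ac)
          also have "t powr (- 1 - \<sigma>) * t powr (\<sigma> + 1) = 1"
            using True by (simp add: powr_add[symmetric])
          finally show ?thesis using t1 by simp
        qed
        also have "\<dots> \<le> B * ?X * (2 powr (1 + \<sigma> / 2) * (1 + \<bar>t\<bar>) powr (- (1 + \<sigma> / 2)))"
          using \<sigma> B by (intro mult_left_mono one_plus_powr_bound[OF True]) auto
        finally show ?thesis .
      qed
      have "norm (?g t) = t powr (- 1 - \<sigma>) * norm (\<Sum>j\<le>m. of_nat (m choose j) * (- 1) ^ j * ?P (real j * t))"
        using True by (simp add: norm_mult)
      also have "\<dots> \<le> t powr (- 1 - \<sigma>) * (\<Sum>j\<le>m. real (m choose j) * norm (?P (real j * t)))"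
        by (intro mult_left_mono order_trans[OF norm_sum] sum_mono) (auto simp: norm_mult norm_power)
      also have "\<dots> = (\<Sum>j\<le>m. real (m choose j) * (t powr (- 1 - \<sigma>) * norm (?P (real j * t))))"
        by (simp add: sum_distrib_left mult_ac)
      also have "\<dots> \<le> (\<Sum>j\<le>m. real (m choose j) * (B * ?X * (2 powr (1 + \<sigma> / 2) * (1 + \<bar>t\<bar>) powr (- (1 + \<sigma> / 2)))))"
        by (intro sum_mono mult_left_mono P) auto
      also have "\<dots> = E * ?X * (1 + \<bar>t\<bar>) powr (- (1 + \<sigma> / 2))"
        unfolding sum_distrib_right[symmetric] E_def by (simp only: mult_ac)
      finally show ?thesis .
    qed (use E in simp)
    have "c * norm (frac_kernel \<sigma> x) = norm (LINT t|lborel. ?g t)"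
      using frac_kernel_subord[OF \<sigma> m, of x] c by (metis c_def norm_mult norm_of_real abs_of_pos)
    also have "\<dots> \<le> (LINT t|lborel. norm (?g t))"
      by (rule integral_norm_bound)
    also have "\<dots> \<le> (LINT t|lborel. E * ?X * (1 + \<bar>t\<bar>) powr (- (1 + \<sigma> / 2)))"
    proof (rule integral_mono')
      show "integrable lborel (\<lambda>t. E * ?X * (1 + \<bar>t\<bar>) powr (- (1 + \<sigma> / 2)))"
        using \<sigma> by (intro integrable_mult_right integrable_one_plus_abs_powr) auto
    qed (use g E in auto)
    also have "\<dots> = c * (C * ?X)"
      using c by (simp add: C_def)
    finally have "norm (frac_kernel \<sigma> x) \<le> C * ?X" using c by simp
    also have "\<dots> \<le> (C + 1) * ?X" by (intro mult_right_mono) auto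
    finally show ?thesis .
  qed
  moreover have "C + 1 > 0"
    using E c by (auto simp: C_def intro!: add_nonneg_pos divide_nonneg_pos mult_nonneg_nonneg integral_nonneg_AE)
  ultimately show ?thesis by blast
qed

text \<open>Outside the ball of radius \<open>2n\<close> some coordinate is at least
  \<open>|x|/n\<close>, hence at least 2, and the far bound applies. Inside, the kernel is bounded
  by the L1 norm of its Fourier data and \<open>jap\<close> is bounded below.\<close>

lemma frac_kernel_decay:
  fixes \<sigma> :: real
  assumes \<sigma>: "\<sigma> > 0"
  shows "\<exists>C>0. \<forall>x::'a::euclidean_space. norm (frac_kernel \<sigma> x) \<le> C * jap (DIM('a) + \<sigma>) x"
proof -
  let ?n = "real DIM('a)"
  have n: "?n \<ge> 1" by (simp add: Suc_le_eq)
  obtain C where C: "C > 0" "\<And>x b. b \<in> Basis \<Longrightarrow> \<bar>x \<bullet> b\<bar> \<ge> 2 \<Longrightarrow> norm x \<le> ?n * \<bar>x \<bullet> b\<bar> \<Longrightarrow>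
    norm (frac_kernel \<sigma> (x::'a)) \<le> C * norm x powr (- (?n + \<sigma>))"
    using frac_kernel_far_bound[OF \<sigma>, where 'a = 'a] by blast
  define D where "D = (LINT \<xi>|lborel. norm (\<xi>::'a) powr (2 * \<sigma>) * norm (fourier_tr bump_n \<xi>))"
  have D: "norm (frac_kernel \<sigma> x) \<le> D" for x :: 'a
    unfolding frac_kernel_def D_def
    by (rule order_trans[OF integral_norm_bound]) (simp add: norm_mult)
  have D0: "D \<ge> 0" using D[of 0] norm_ge_zero order_trans by blast
  define K where "K = C * 2 powr (?n + \<sigma>) + D * (1 + 2 * ?n) powr (?n + \<sigma>)"
  have K: "K > 0" using C D0 by (simp add: K_def add_pos_nonneg)
  have "norm (frac_kernel \<sigma> x) \<le> K * jap (?n + \<sigma>) x" for x :: 'a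
  proof (cases "norm x \<ge> 2 * ?n")
    case True
    have x1: "1 \<le> norm x" using True n by linarith
    have "\<exists>b\<in>Basis. norm x \<le> ?n * \<bar>x \<bullet> b\<bar>"
    proof (rule ccontr)
      assume "\<not> ?thesis"
      then have "(\<Sum>b\<in>Basis. ?n * \<bar>x \<bullet> b\<bar>) < (\<Sum>b\<in>(Basis::'a set). norm x)"
        by (intro sum_strict_mono) auto
      then have "?n * (\<Sum>b\<in>Basis. \<bar>x \<bullet> b\<bar>) < ?n * norm x"
        by (simp add: sum_distrib_left)
      then show False using norm_le_l1[of x] by simp
    qed
    then obtain b where b: "b \<in> Basis" "norm x \<le> ?n * \<bar>x \<bullet> b\<bar>" by blast
    have "?n * 2 \<le> ?n * \<bar>x \<bullet> b\<bar>" using True b by linarith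
    then have "\<bar>x \<bullet> b\<bar> \<ge> 2" by simp
    then have "norm (frac_kernel \<sigma> x) \<le> C * norm x powr (- (?n + \<sigma>))" using C b by blast
    also have "norm x powr (- (?n + \<sigma>)) = 2 powr (?n + \<sigma>) * (2 * norm x) powr (- (?n + \<sigma>))"
      by (simp only: powr_mult powr_minus) simp
    also have "(2 * norm x) powr (- (?n + \<sigma>)) \<le> jap (?n + \<sigma>) x"
      unfolding jap_def using x1 \<sigma> by (intro powr_mono2') (auto simp: add_pos_nonneg)
    finally have "norm (frac_kernel \<sigma> x) \<le> (C * 2 powr (?n + \<sigma>)) * jap (?n + \<sigma>) x"
      using C by (simp add: mult.assoc)
    also have "\<dots> \<le> K * jap (?n + \<sigma>) x"
      using D0 by (intro mult_right_mono) (auto simp: K_def less_imp_le[OF jap_pos])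
    finally show ?thesis .
  next
    case False
    have "norm (frac_kernel \<sigma> x) \<le> D * ((1 + 2 * ?n) powr (?n + \<sigma>) * (1 + 2 * ?n) powr (- (?n + \<sigma>)))"
    proof -
      have "(1 + 2 * ?n) powr (?n + \<sigma>) * (1 + 2 * ?n) powr (- (?n + \<sigma>)) = 1"
        by (simp only: powr_add[symmetric]) (simp add: add_pos_nonneg)
      then show ?thesis using D[of x] by (simp only: mult_1_right)
    qed
    also have "\<dots> \<le> D * ((1 + 2 * ?n) powr (?n + \<sigma>) * jap (?n + \<sigma>) x)"
      unfolding jap_def using False \<sigma> D0 by (intro mult_left_mono powr_mono2') (auto simp: add_pos_nonneg)
    also have "\<dots> = (D * (1 + 2 * ?n) powr (?n + \<sigma>)) * jap (?n + \<sigma>) x" by simp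
    also have "\<dots> \<le> K * jap (?n + \<sigma>) x"
      using C by (intro mult_right_mono) (auto simp: K_def less_imp_le[OF jap_pos])
    finally show ?thesis .
  qed
  then show ?thesis using K by blast
qed

lemma norm_cis_diff_le: "norm (cis a - cis b) \<le> \<bar>a - b\<bar>"
proof -
  have "cis a - cis b = cis b * (cis (a - b) - 1)"
    by (simp add: right_diff_distrib cis_mult)
  then have "norm (cis a - cis b) = norm (iexp (a - b) - 1)"
    by (simp add: norm_mult cis_conv_exp)
  then show ?thesis
    using iexp_approx1[of "a - b" 0] by simp
qed

text \<open>A difference of exponentials costs one more power of \<open>|\<xi>|\<close>, which the
  rapid decay of the transform affords. The bound is needed for the differences between consecutive
  dyadic scales.\<close>

lemma frac_kernel_lipschitz:
  assumes \<sigma>: "\<sigma> > 0"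
  shows "\<exists>L>0. \<forall>x y::'a::euclidean_space. norm (frac_kernel \<sigma> x - frac_kernel \<sigma> y) \<le> L * norm (x - y)"
proof -
  let ?w = "\<lambda>\<xi>::'a. (1 + norm \<xi>) powr (2 * \<sigma> + 1) * norm (fourier_tr bump_n \<xi>)"
  have w: "integrable lborel ?w"
    using \<sigma> by (intro integrable_powr_fourier_tr_bump_n) simp
  have "norm (frac_kernel \<sigma> x - frac_kernel \<sigma> y) \<le> ((LINT \<xi>|lborel. ?w \<xi>) + 1) * norm (x - y)" for x y :: 'a
  proof -
    have "frac_kernel \<sigma> x - frac_kernel \<sigma> y = (LINT \<xi>|lborel. (cis (x \<bullet> \<xi>) - cis (y \<bullet> \<xi>)) *
        complex_of_real (norm \<xi> powr (2 * \<sigma>)) * fourier_tr bump_n \<xi>)"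
      unfolding frac_kernel_def left_diff_distrib
      by (rule Bochner_Integration.integral_diff[symmetric]; rule integrable_frac_kernel[OF \<sigma>])
    also have "norm \<dots> \<le> (LINT \<xi>|lborel. norm (x - y) * ?w \<xi>)"
    proof (rule order_trans[OF integral_norm_bound integral_mono'])
      show "integrable lborel (\<lambda>\<xi>. norm (x - y) * ?w \<xi>)"
        using w by (rule integrable_mult_right)
      fix \<xi> :: 'a
      have "norm (cis (x \<bullet> \<xi>) - cis (y \<bullet> \<xi>)) \<le> norm (x - y) * norm \<xi>"
        using norm_cis_diff_le[of "x \<bullet> \<xi>" "y \<bullet> \<xi>"] Cauchy_Schwarz_ineq2[of "x - y" \<xi>]
        by (simp add: inner_diff_left)
      also have "\<dots> \<le> norm (x - y) * (1 + norm \<xi>)" by (simp add: mult_left_mono)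
      finally have "norm (cis (x \<bullet> \<xi>) - cis (y \<bullet> \<xi>)) * norm \<xi> powr (2 * \<sigma>)
          \<le> (norm (x - y) * (1 + norm \<xi>)) * (1 + norm \<xi>) powr (2 * \<sigma>)"
        using \<sigma> by (intro mult_mono norm_powr_le) auto
      also have "\<dots> = norm (x - y) * (1 + norm \<xi>) powr (2 * \<sigma> + 1)"
        by (simp add: powr_add add_pos_nonneg)
      finally have "norm (cis (x \<bullet> \<xi>) - cis (y \<bullet> \<xi>)) * norm \<xi> powr (2 * \<sigma>) * norm (fourier_tr bump_n \<xi>)
          \<le> norm (x - y) * (1 + norm \<xi>) powr (2 * \<sigma> + 1) * norm (fourier_tr bump_n \<xi>)"
        by (rule mult_right_mono) simp
      then show "norm ((cis (x \<bullet> \<xi>) - cis (y \<bullet> \<xi>)) * complex_of_real (norm \<xi> powr (2 * \<sigma>)) * fourier_tr bump_n \<xi>)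
          \<le> norm (x - y) * ?w \<xi>"
        by (simp add: norm_mult mult.assoc)
    qed auto
    also have "\<dots> = (LINT \<xi>|lborel. ?w \<xi>) * norm (x - y)" by simp
    also have "\<dots> \<le> ((LINT \<xi>|lborel. ?w \<xi>) + 1) * norm (x - y)" by (intro mult_right_mono) auto
    finally show ?thesis .
  qed
  moreover have "(LINT \<xi>|lborel. ?w \<xi>) + 1 > 0"
    by (intro add_nonneg_pos integral_nonneg_AE) auto
  ultimately show ?thesis by blast
qed

section \<open>Action of the fractional Laplacian on combinations of dilations\<close>

lemma frac_lap_bump_n: "frac_lap \<sigma> bump_n x = Re (frac_kernel \<sigma> x) / (2 * pi) ^ DIM('a)"
  for x :: "'a::euclidean_space"
  by (simp add: frac_lap_def frac_kernel_def)

lemma fourier_tr_bump_n_scale: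
  fixes \<xi> :: "'a::euclidean_space"
  assumes "k > 0"
  shows "fourier_tr (\<lambda>y. bump_n (y /\<^sub>R k)) \<xi> = complex_of_real (k ^ DIM('a)) * fourier_tr bump_n (k *\<^sub>R \<xi>)"
proof -
  let ?f = "\<lambda>y. cis (- (y \<bullet> (k *\<^sub>R \<xi>))) * complex_of_real (bump_n y)"
  have "fourier_tr (\<lambda>y. bump_n (y /\<^sub>R k)) \<xi> = (LINT y|lborel. ?f (y /\<^sub>R k))"
    unfolding fourier_tr_def using assms by (simp add: mult.assoc[symmetric])
  also have "\<dots> = k ^ DIM('a) *\<^sub>R (LINT y|lborel. ?f y)"
    by (rule lborel_integral_scale[OF assms])
  finally show ?thesis
    by (simp add: fourier_tr_def scaleR_conv_of_real)
qed

text \<open>A dilation by \<open>k\<close> multiplies the transform by \<open>k^n\<close> and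
  rescales its argument. The change of variables in the inverse integral gives \<open>k^(-n)\<close>
  back and leaves \<open>k^(-2\<sigma>)\<close> from the homogeneous symbol. Finite sums pass
  through since every piece is integrable on the Fourier side.\<close>

lemma frac_lap_bump_n_comb:
  fixes x :: "'a::euclidean_space"
  assumes \<sigma>: "\<sigma> > 0" and I: "finite I" and k: "\<And>i. i \<in> I \<Longrightarrow> k i > 0"
  shows "frac_lap \<sigma> (\<lambda>y. \<Sum>i\<in>I. c i * bump_n (y /\<^sub>R k i)) x =
    (\<Sum>i\<in>I. c i * (k i powr (- 2 * \<sigma>) * frac_lap \<sigma> bump_n (x /\<^sub>R k i)))"
proof -
  have ft: "fourier_tr (\<lambda>y. \<Sum>i\<in>I. c i * bump_n (y /\<^sub>R k i)) \<xi> =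
      (\<Sum>i\<in>I. complex_of_real (c i) * (complex_of_real (k i ^ DIM('a)) * fourier_tr bump_n (k i *\<^sub>R \<xi>)))" for \<xi> :: 'a
  proof -
    have "fourier_tr (\<lambda>y. \<Sum>i\<in>I. c i * bump_n (y /\<^sub>R k i)) \<xi> =
        (LINT y|lborel. (\<Sum>i\<in>I. complex_of_real (c i) * (cis (- (y \<bullet> \<xi>)) * complex_of_real (bump_n (y /\<^sub>R k i)))))"
      unfolding fourier_tr_def by (simp add: sum_distrib_left mult_ac)
    also have "\<dots> = (\<Sum>i\<in>I. (LINT y|lborel. complex_of_real (c i) * (cis (- (y \<bullet> \<xi>)) * complex_of_real (bump_n (y /\<^sub>R k i)))))"
      by (intro Bochner_Integration.integral_sum integrable_mult_right integrable_cis_mult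
          lborel_integrable_scale integrable_bump_n k) auto
    also have "\<dots> = (\<Sum>i\<in>I. complex_of_real (c i) * fourier_tr (\<lambda>y. bump_n (y /\<^sub>R k i)) \<xi>)"
      by (simp add: fourier_tr_def)
    finally show ?thesis
      by (simp add: fourier_tr_bump_n_scale[OF k] cong: sum.cong)
  qed
  let ?h = "\<lambda>i \<xi>. cis (x \<bullet> \<xi>) * complex_of_real (norm \<xi> powr (2 * \<sigma>)) *
      (complex_of_real (k i ^ DIM('a)) * fourier_tr bump_n (k i *\<^sub>R \<xi>))"
  have h: "integrable lborel (?h i)" "(LINT \<xi>|lborel. ?h i \<xi>) = complex_of_real (k i powr (- 2 * \<sigma>)) * frac_kernel \<sigma> (x /\<^sub>R k i)"
    if i: "i \<in> I" for i
  proof -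
    note ki = k[OF i]
    let ?g = "\<lambda>\<eta>. complex_of_real (k i ^ DIM('a) * k i powr (- 2 * \<sigma>)) *
      (cis ((x /\<^sub>R k i) \<bullet> \<eta>) * complex_of_real (norm \<eta> powr (2 * \<sigma>)) * fourier_tr bump_n \<eta>)"
    have inv: "1 / k i > 0" using ki by simp
    have eq: "?h i \<xi> = ?g (\<xi> /\<^sub>R (1 / k i))" for \<xi>
    proof -
      have "(k i * norm \<xi>) powr (2 * \<sigma>) = k i powr (2 * \<sigma>) * norm \<xi> powr (2 * \<sigma>)"
        using ki by (simp add: powr_mult)
      then have "complex_of_real (k i powr (- 2 * \<sigma>)) * complex_of_real (norm (k i *\<^sub>R \<xi>) powr (2 * \<sigma>)) = complex_of_real (norm \<xi> powr (2 * \<sigma>))"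
        using ki by (simp only: of_real_mult[symmetric] norm_scaleR abs_of_pos) (simp add: powr_minus)
      then show ?thesis using ki by (simp add: mult_ac) (simp add: mult.assoc[symmetric])
    qed
    have g: "integrable lborel ?g"
      by (intro integrable_mult_right integrable_frac_kernel \<sigma>)
    show "integrable lborel (?h i)"
      unfolding eq by (rule lborel_integrable_scale[OF inv g])
    have "(LINT \<xi>|lborel. ?h i \<xi>) = (1 / k i) ^ DIM('a) *\<^sub>R (LINT \<xi>|lborel. ?g \<xi>)"
      unfolding eq by (rule lborel_integral_scale[OF inv])
    also have "(LINT \<xi>|lborel. ?g \<xi>) = complex_of_real (k i ^ DIM('a) * k i powr (- 2 * \<sigma>)) * frac_kernel \<sigma> (x /\<^sub>R k i)"
      unfolding frac_kernel_def by (rule integral_mult_right_zero)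
    also have "(1 / k i) ^ DIM('a) *\<^sub>R \<dots> = complex_of_real (k i powr (- 2 * \<sigma>)) * frac_kernel \<sigma> (x /\<^sub>R k i)"
      using ki by (simp add: scaleR_conv_of_real power_divide)
    finally show "(LINT \<xi>|lborel. ?h i \<xi>) = complex_of_real (k i powr (- 2 * \<sigma>)) * frac_kernel \<sigma> (x /\<^sub>R k i)" .
  qed
  have "(LINT \<xi>|lborel. cis (x \<bullet> \<xi>) * complex_of_real (norm \<xi> powr (2 * \<sigma>)) *
      fourier_tr (\<lambda>y. \<Sum>i\<in>I. c i * bump_n (y /\<^sub>R k i)) \<xi>)
     = (LINT \<xi>|lborel. (\<Sum>i\<in>I. complex_of_real (c i) * ?h i \<xi>))"
    unfolding ft by (simp add: sum_distrib_left mult_ac)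
  also have "\<dots> = (\<Sum>i\<in>I. (LINT \<xi>|lborel. complex_of_real (c i) * ?h i \<xi>))"
    by (intro Bochner_Integration.integral_sum integrable_mult_right h) auto
  also have "\<dots> = (\<Sum>i\<in>I. complex_of_real (c i) * (complex_of_real (k i powr (- 2 * \<sigma>)) * frac_kernel \<sigma> (x /\<^sub>R k i)))"
    by (intro sum.cong refl) (simp only: integral_mult_right_zero h(2))
  finally show ?thesis
    unfolding frac_lap_def[of \<sigma> "\<lambda>y. \<Sum>i\<in>I. c i * bump_n (y /\<^sub>R k i)"] frac_lap_bump_n
    by (simp add: sum_divide_distrib sum_distrib_left mult_ac)
qed

section \<open>Weighted sums of dilations\<close>

lemma jap_le_1: "q \<ge> 0 \<Longrightarrow> jap q x \<le> 1"
  using powr_mono2'[of "- q" 1 "1 + norm x"] by (simp add: jap_def)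

text \<open>The left side equals \<open>(2^k + |y|)^(-q)\<close>. The weight \<open>2^(-q k)\<close>
  is thus chosen so that dilates of a function below \<open>jap q\<close> stay below
  \<open>jap q\<close>.\<close>

lemma jap_dilate:
  assumes "q \<ge> 0"
  shows "2 powr (- q * real k) * jap q (y /\<^sub>R 2 ^ k) \<le> jap q y"
proof -
  have "2 powr (- q * real k) = (2 ^ k) powr (- q)"
    by (simp add: powr_powr powr_realpow[symmetric] mult.commute)
  then have "2 powr (- q * real k) * jap q (y /\<^sub>R 2 ^ k) = (2 ^ k * (1 + norm y / 2 ^ k)) powr (- q)"
    unfolding jap_def by (subst powr_mult) (auto simp: divide_inverse mult.commute)
  also have "2 ^ k * (1 + norm y / 2 ^ k) = 2 ^ k + norm y"
    by (simp add: distrib_left)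
  also have "(2 ^ k + norm y) powr (- q) \<le> jap q y"
    unfolding jap_def using assms by (intro powr_mono2') (auto simp: add_pos_nonneg)
  finally show ?thesis .
qed

lemma jap_half:
  assumes "q \<ge> 0"
  shows "jap q (y /\<^sub>R 2) \<le> 2 powr q * jap q y"
proof -
  have "2 powr (- q) * jap q (y /\<^sub>R 2) \<le> jap q y"
    using jap_dilate[OF assms, of 1 y] by simp
  then show ?thesis
    by (simp add: powr_minus field_simps)
qed

lemma compact_support_le_jap:
  fixes g :: "'a::real_normed_vector \<Rightarrow> real"
  assumes "\<And>x. \<bar>g x\<bar> \<le> M" "\<And>x. norm x \<ge> R \<Longrightarrow> g x = 0" "q \<ge> 0" "R \<ge> 0"
  shows "\<bar>g x\<bar> \<le> M * (1 + R) powr q * jap q x"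
proof -
  have M: "M \<ge> 0" using assms(1)[of 0] by linarith
  show ?thesis
  proof (cases "norm x \<ge> R")
    case False
    have "M * 1 \<le> M * ((1 + R) powr q * (1 + norm x) powr (- q))"
    proof (intro mult_left_mono M)
      have "(1 + norm x) powr q \<le> (1 + R) powr q"
        using False assms by (intro powr_mono2) auto
      then show "1 \<le> (1 + R) powr q * (1 + norm x) powr (- q)"
        by (simp add: powr_minus_divide le_divide_eq add_nonneg_eq_0_iff)
    qed
    then show ?thesis using assms(1)[of x] by (simp add: jap_def mult.assoc)
  qed (use assms M less_imp_le[OF jap_pos[of q x]] in simp)
qed

text \<open>The weights \<open>2\<^bsup>2s\<^esup> g(y/2) - g(y)\<close> are chosen so that an operator of order \<open>2s\<close> maps the sum to a
  function vanishing at the origin.\<close>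

definition dyadic_comb :: "real \<Rightarrow> real \<Rightarrow> real \<Rightarrow> ('a::real_normed_vector \<Rightarrow> real) \<Rightarrow> nat \<Rightarrow> 'a \<Rightarrow> real" where
  "dyadic_comb q s \<tau> g N y = (\<Sum>k<N. 2 powr (- q * real k) *
     (2 powr (2 * s) * ((2 ^ Suc k) powr (- 2 * \<tau>) * g (y /\<^sub>R 2 ^ Suc k))
       - (2 ^ k) powr (- 2 * \<tau>) * g (y /\<^sub>R 2 ^ k)))"

lemma sum_geometric_le:
  fixes \<rho> :: real
  assumes "0 \<le> \<rho>" "\<rho> < 1"
  shows "(\<Sum>k<N. \<rho> ^ k) \<le> 1 / (1 - \<rho>)"
  using sum_le_suminf[OF summable_geometric[of \<rho>], of "{..<N}"] assms by (simp add: suminf_geometric)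

lemma two_power_powr: "(2 ^ k) powr x = (2 powr x) ^ k" for x :: real
  by (simp add: powr_powr powr_realpow[symmetric] mult.commute)

text \<open>Each weighted dilate stays below a multiple of \<open>jap q\<close>, and the positive
  order \<open>2\<tau>\<close> adds the geometric factor \<open>2^(-2\<tau>k)\<close>, so the bound
  is uniform in \<open>N\<close>.\<close>

lemma dyadic_comb_bound:
  fixes g :: "'a::real_normed_vector \<Rightarrow> real"
  assumes g: "\<And>x. \<bar>g x\<bar> \<le> C * jap q x" and "C \<ge> 0" "q \<ge> 0" "\<tau> > 0"
  shows "\<exists>C'>0. \<forall>N y. \<bar>dyadic_comb q s \<tau> g N y\<bar> \<le> C' * jap q y"
proof -
  define \<rho> where "\<rho> = 2 powr (- 2 * \<tau>)"
  have \<rho>: "0 < \<rho>" "\<rho> < 1" using assms by (auto simp: \<rho>_def powr_less_one)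
  define B where "B = 2 powr (2 * s) * 2 powr q + 1"
  have B: "B \<ge> 1" by (simp add: B_def)
  have "\<bar>dyadic_comb q s \<tau> g N y\<bar> \<le> (C * B / (1 - \<rho>) + 1) * jap q y" for N y
  proof -
    have J0: "0 \<le> jap q y" using jap_pos[of q y] by simp
    have gk: "2 powr (- q * real k) * \<bar>g (y /\<^sub>R 2 ^ k)\<bar> \<le> C * jap q y" for k
    proof -
      have "2 powr (- q * real k) * \<bar>g (y /\<^sub>R 2 ^ k)\<bar> \<le> C * (2 powr (- q * real k) * jap q (y /\<^sub>R 2 ^ k))"
        using g[of "y /\<^sub>R 2 ^ k"] by (simp add: mult.left_commute)
      also have "\<dots> \<le> C * jap q y" using assms by (intro mult_left_mono jap_dilate) auto
      finally show ?thesis .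
    qed
    have gk': "2 powr (- q * real k) * \<bar>g (y /\<^sub>R 2 ^ Suc k)\<bar> \<le> 2 powr q * (C * jap q y)" for k
    proof -
      have "2 powr (- q * real k) = 2 powr q * 2 powr (- q * real (Suc k))"
        by (simp add: powr_add[symmetric] algebra_simps)
      then have "2 powr (- q * real k) * \<bar>g (y /\<^sub>R 2 ^ Suc k)\<bar> =
          2 powr q * (2 powr (- q * real (Suc k)) * \<bar>g (y /\<^sub>R 2 ^ Suc k)\<bar>)" by simp
      also have "\<dots> \<le> 2 powr q * (C * jap q y)" by (intro mult_left_mono gk) auto
      finally show ?thesis .
    qed
    have "\<bar>dyadic_comb q s \<tau> g N y\<bar> \<le> (\<Sum>k<N. \<rho> ^ k * (B * (C * jap q y)))"
      unfolding dyadic_comb_def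
    proof (rule order_trans[OF sum_abs sum_mono])
      fix k
      let ?w = "2 powr (- q * real k)"
      have "\<bar>?w * (2 powr (2 * s) * ((2 ^ Suc k) powr (- 2 * \<tau>) * g (y /\<^sub>R 2 ^ Suc k))
         - (2 ^ k) powr (- 2 * \<tau>) * g (y /\<^sub>R 2 ^ k))\<bar>
        = \<bar>2 powr (2 * s) * \<rho> ^ Suc k * (?w * g (y /\<^sub>R 2 ^ Suc k)) - \<rho> ^ k * (?w * g (y /\<^sub>R 2 ^ k))\<bar>"
        unfolding two_power_powr \<rho>_def by (simp only: right_diff_distrib mult_ac)
      also have "\<dots> \<le> \<bar>2 powr (2 * s) * \<rho> ^ Suc k * (?w * g (y /\<^sub>R 2 ^ Suc k))\<bar> + \<bar>\<rho> ^ k * (?w * g (y /\<^sub>R 2 ^ k))\<bar>"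
        by (rule abs_triangle_ineq4)
      also have "\<dots> = 2 powr (2 * s) * \<rho> ^ Suc k * (?w * \<bar>g (y /\<^sub>R 2 ^ Suc k)\<bar>) + \<rho> ^ k * (?w * \<bar>g (y /\<^sub>R 2 ^ k)\<bar>)"
        using \<rho> by (simp add: abs_mult)
      also have "\<dots> \<le> 2 powr (2 * s) * \<rho> ^ k * (2 powr q * (C * jap q y)) + \<rho> ^ k * (C * jap q y)"
        using \<rho> by (intro add_mono mult_mono gk gk' mult_left_mono power_decreasing) auto
      also have "\<dots> = \<rho> ^ k * (B * (C * jap q y))"
        by (simp add: B_def algebra_simps)
      finally show "\<bar>?w * (2 powr (2 * s) * ((2 ^ Suc k) powr (- 2 * \<tau>) * g (y /\<^sub>R 2 ^ Suc k))
         - (2 ^ k) powr (- 2 * \<tau>) * g (y /\<^sub>R 2 ^ k))\<bar> \<le> \<rho> ^ k * (B * (C * jap q y))" .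
    qed
    also have "\<dots> = (\<Sum>k<N. \<rho> ^ k) * (B * (C * jap q y))"
      by (simp add: sum_distrib_right)
    also have "\<dots> \<le> 1 / (1 - \<rho>) * (B * (C * jap q y))"
      using \<rho> B J0 assms by (intro mult_right_mono sum_geometric_le) auto
    also have "\<dots> = C * B / (1 - \<rho>) * jap q y" by simp
    also have "\<dots> \<le> (C * B / (1 - \<rho>) + 1) * jap q y"
      using J0 by (intro mult_right_mono) auto
    finally show ?thesis .
  qed
  moreover have "C * B / (1 - \<rho>) + 1 > 0"
    using \<rho> B assms by (intro add_nonneg_pos) auto
  ultimately show ?thesis by blast
qed

text \<open>Near the origin the Lipschitz bound supplies the factor \<open>|z|\<close>. Away from it
  \<open>|z|/(1+|z|)\<close> is at least 1/2, and decay alone suffices.\<close>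

lemma dilation_difference_bound:
  fixes g :: "'a::real_normed_vector \<Rightarrow> real"
  assumes g: "\<And>x. \<bar>g x\<bar> \<le> C * jap q x" and L: "\<And>x y. \<bar>g x - g y\<bar> \<le> L * norm (x - y)"
    and "C \<ge> 0" "L \<ge> 0" "q \<ge> 0"
  shows "\<bar>g (z /\<^sub>R 2) - g z\<bar> \<le> (2 powr q * L + 2 * C * (2 powr q + 1)) * (norm z / (1 + norm z) * jap q z)"
proof -
  have J0: "0 \<le> jap q z" using jap_pos[of q z] by simp
  let ?m = "norm z / (1 + norm z) * jap q z"
  have m0: "?m \<ge> 0" using J0 by simp
  show ?thesis
  proof (cases "norm z \<le> 1")
    case True
    have "\<bar>g (z /\<^sub>R 2) - g z\<bar> \<le> L * norm (z /\<^sub>R 2 - z)" by (rule L)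
    also have "z /\<^sub>R 2 - z = (- 1 / 2) *\<^sub>R z" by (simp add: scaleR_left_diff_distrib[of _ 1, simplified, symmetric])
    also have "L * norm ((- 1 / 2) *\<^sub>R z) = L * (norm z * (1 / 2) * (2 powr q * 2 powr (- q)))"
      by (simp add: powr_minus)
    also have "\<dots> \<le> L * ((norm z * (1 / (1 + norm z))) * (2 powr q * jap q z))"
      unfolding jap_def using True assms
      by (intro mult_left_mono mult_mono powr_mono2' divide_left_mono) (auto simp: add_pos_nonneg)
    also have "\<dots> = (2 powr q * L) * ?m" by simp
    also have "\<dots> \<le> (2 powr q * L + 2 * C * (2 powr q + 1)) * ?m"
      using m0 assms by (intro mult_right_mono) auto
    finally show ?thesis .
  next
    case False
    have "\<bar>g (z /\<^sub>R 2) - g z\<bar> \<le> \<bar>g (z /\<^sub>R 2)\<bar> + \<bar>g z\<bar>" by (rule abs_triangle_ineq4)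
    also have "\<dots> \<le> C * (2 powr q * jap q z) + C * jap q z"
      using assms by (intro add_mono order_trans[OF g] mult_left_mono jap_half) auto
    also have "\<dots> = 2 * C * (2 powr q + 1) * ((1 / 2) * jap q z)"
      by (simp add: algebra_simps)
    also have "\<dots> \<le> 2 * C * (2 powr q + 1) * ?m"
      using False assms J0 by (intro mult_left_mono mult_right_mono) (auto simp: field_simps add_pos_nonneg)
    also have "\<dots> \<le> (2 powr q * L + 2 * C * (2 powr q + 1)) * ?m"
      using m0 assms by (intro mult_right_mono) auto
    finally show ?thesis .
  qed
qed

text \<open>For \<open>\<tau> = s\<close> both weights in a summand reduce to
  \<open>2^(-2sk)\<close>, which leaves the difference \<open>g(z/2) - g(z)\<close> at
  \<open>z = y/2^k\<close>. It vanishes at the origin, hence the additional factor.\<close>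

lemma dyadic_comb_principal_bound:
  fixes g :: "'a::real_normed_vector \<Rightarrow> real"
  assumes g: "\<And>x. \<bar>g x\<bar> \<le> C * jap q x" and L: "\<And>x y. \<bar>g x - g y\<bar> \<le> L * norm (x - y)"
    and "C \<ge> 0" "L \<ge> 0" "q \<ge> 0" "s > 0"
  shows "\<exists>C'>0. \<forall>N y. \<bar>dyadic_comb q s s g N y\<bar> \<le> C' * (norm y / (1 + norm y) * jap q y)"
proof -
  define \<rho> where "\<rho> = 2 powr (- 2 * s)"
  have \<rho>: "0 < \<rho>" "\<rho> < 1" using assms by (auto simp: \<rho>_def powr_less_one)
  define B where "B = 2 powr q * L + 2 * C * (2 powr q + 1)"
  have B: "B \<ge> 0" using assms by (simp add: B_def)
  have "\<bar>dyadic_comb q s s g N y\<bar> \<le> (B / (1 - \<rho>) + 1) * (norm y / (1 + norm y) * jap q y)" for N y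
  proof -
    let ?m = "norm y / (1 + norm y) * jap q y"
    have m0: "?m \<ge> 0" using less_imp_le[OF jap_pos[of q y]] by simp
    have "\<bar>dyadic_comb q s s g N y\<bar> \<le> (\<Sum>k<N. \<rho> ^ k * (B * ?m))"
      unfolding dyadic_comb_def
    proof (rule order_trans[OF sum_abs sum_mono])
      fix k
      let ?w = "2 powr (- q * real k)" and ?z = "y /\<^sub>R 2 ^ k"
      have e: "2 powr (2 * s) * \<rho> ^ Suc k = \<rho> ^ k"
        by (simp add: \<rho>_def powr_minus)
      have z2: "y /\<^sub>R 2 ^ Suc k = ?z /\<^sub>R 2" by simp
      have "\<bar>?w * (2 powr (2 * s) * ((2 ^ Suc k) powr (- 2 * s) * g (y /\<^sub>R 2 ^ Suc k))
         - (2 ^ k) powr (- 2 * s) * g ?z)\<bar> = \<bar>\<rho> ^ k * (?w * (g (?z /\<^sub>R 2) - g ?z))\<bar>"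
        unfolding two_power_powr \<rho>_def[symmetric] z2 mult.assoc[symmetric] e
        by (simp add: algebra_simps)
      also have "\<dots> = \<rho> ^ k * (?w * \<bar>g (?z /\<^sub>R 2) - g ?z\<bar>)"
        using \<rho> by (simp add: abs_mult)
      also have "\<dots> \<le> \<rho> ^ k * (?w * (B * (norm ?z / (1 + norm ?z) * jap q ?z)))"
        unfolding B_def using \<rho> assms by (intro mult_left_mono dilation_difference_bound g L) auto
      also have "\<dots> = \<rho> ^ k * (B * (norm ?z / (1 + norm ?z) * (?w * jap q ?z)))"
        by (simp only: mult_ac)
      also have "\<dots> \<le> \<rho> ^ k * (B * ?m)"
      proof (intro mult_left_mono mult_mono jap_dilate)
        have "norm ?z \<le> norm y"
          by (simp add: divide_inverse[symmetric] divide_le_eq mult_le_cancel_left1 inverse_le_1_iff)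
            (simp add: mult.commute mult_left_le inverse_le_1_iff)
        then show "norm ?z / (1 + norm ?z) \<le> norm y / (1 + norm y)"
          by (subst frac_le_eq) (auto simp: add_nonneg_eq_0_iff algebra_simps divide_le_0_iff add_pos_nonneg)
      qed (use \<rho> B assms less_imp_le[OF jap_pos[of q ?z]] in auto)
      finally show "\<bar>?w * (2 powr (2 * s) * ((2 ^ Suc k) powr (- 2 * s) * g (y /\<^sub>R 2 ^ Suc k))
         - (2 ^ k) powr (- 2 * s) * g ?z)\<bar> \<le> \<rho> ^ k * (B * ?m)" .
    qed
    also have "\<dots> = (\<Sum>k<N. \<rho> ^ k) * (B * ?m)"
      by (rule sum_distrib_right[symmetric])
    also have "\<dots> \<le> 1 / (1 - \<rho>) * (B * ?m)"
      using \<rho> B m0 by (intro mult_right_mono sum_geometric_le mult_nonneg_nonneg[OF B m0]) auto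
    also have "\<dots> = B / (1 - \<rho>) * ?m" by simp
    also have "\<dots> \<le> (B / (1 - \<rho>) + 1) * ?m"
      using m0 by (intro mult_right_mono) auto
    finally show ?thesis .
  qed
  moreover have "B / (1 - \<rho>) + 1 > 0"
    using \<rho> B by (intro add_nonneg_pos) auto
  ultimately show ?thesis by blast
qed

section \<open>The spatial profile\<close>

lemma bump_n_nonneg: "bump_n x \<ge> 0"
  unfolding bump_n_def by (intro prod_nonneg) (auto simp: bump_0_nonneg)

lemma bump_n_le_1: "bump_n x \<le> 1"
  unfolding bump_n_def by (intro prod_le_1) (auto simp: bump_0_nonneg bump_0_le_1)

lemma bump_n_scale_mono:
  assumes "0 < k" "k \<le> l"
  shows "bump_n (y /\<^sub>R k) \<le> bump_n (y /\<^sub>R l)"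
  unfolding bump_n_def
proof (intro prod_mono conjI bump_0_nonneg bump_0_antimono)
  fix b :: 'a
  have "\<bar>y \<bullet> b\<bar> * inverse l \<le> \<bar>y \<bullet> b\<bar> * inverse k"
    using assms by (intro mult_left_mono le_imp_inverse_le) auto
  then show "\<bar>(y /\<^sub>R l) \<bullet> b\<bar> \<le> \<bar>(y /\<^sub>R k) \<bullet> b\<bar>"
    using assms by (simp add: abs_mult mult.commute)
qed

section \<open>Mixed partial derivatives of the tensor bump\<close>

definition bump_multi :: "('a::euclidean_space \<Rightarrow> nat) \<Rightarrow> 'a \<Rightarrow> real" where
  "bump_multi m x = (\<Prod>b\<in>Basis. bump (m b) (x \<bullet> b))"

lemma bump_multi_0: "bump_multi (\<lambda>_. 0) = bump_n"
  by (simp add: bump_multi_def bump_n_def fun_eq_iff)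

lemma bump_multi_eq_0:
  assumes "norm (x::'a::euclidean_space) \<ge> real DIM('a)"
  shows "bump_multi m x = 0"
proof -
  have "\<exists>b\<in>Basis. \<bar>x \<bullet> b\<bar> \<ge> 1"
  proof (rule ccontr)
    assume "\<not> ?thesis"
    then have "(\<Sum>b\<in>Basis. \<bar>x \<bullet> b\<bar>) < (\<Sum>b\<in>(Basis::'a set). 1)"
      by (intro sum_strict_mono) auto
    then show False using norm_le_l1[of x] assms by simp
  qed
  then have "\<exists>b\<in>Basis. bump (m b) (x \<bullet> b) = 0" by (metis bump_eq_0)
  then show ?thesis
    unfolding bump_multi_def by (intro prod_zero) auto
qed

lemma bump_lipschitz: "\<exists>L>0. \<forall>x y. \<bar>bump k x - bump k y\<bar> \<le> L * \<bar>x - y\<bar>"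
proof -
  obtain L where L: "L > 0" "\<And>x. \<bar>bump (Suc k) x\<bar> \<le> L"
    using bump_bounded by blast
  have "norm (bump k x - bump k y) \<le> L * norm (x - y)" for x y
    by (rule field_differentiable_bound[of UNIV "bump k" "bump (Suc k)"])
      (use L DERIV_bump in auto)
  then show ?thesis using L by (auto intro!: exI[of _ L])
qed

text \<open>The two bounds are carried through the induction together, because the product rule for
  differences uses both.\<close>

lemma prod_bounded_lipschitz:
  fixes g :: "'a::euclidean_space \<Rightarrow> real \<Rightarrow> real"
  assumes "finite A" "A \<subseteq> Basis"
    and "\<And>b. b \<in> A \<Longrightarrow> \<exists>C>0. \<forall>x. \<bar>g b x\<bar> \<le> C"
    and "\<And>b. b \<in> A \<Longrightarrow> \<exists>L>0. \<forall>x y. \<bar>g b x - g b y\<bar> \<le> L * \<bar>x - y\<bar>"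
  shows "\<exists>C>0. \<forall>x y::'a. \<bar>\<Prod>b\<in>A. g b (x \<bullet> b)\<bar> \<le> C \<and>
    \<bar>(\<Prod>b\<in>A. g b (x \<bullet> b)) - (\<Prod>b\<in>A. g b (y \<bullet> b))\<bar> \<le> C * norm (x - y)"
  using assms
proof (induction A rule: finite_induct)
  case empty
  then show ?case by (auto intro!: exI[of _ 1])
next
  case (insert b A)
  then obtain C where C: "C > 0" "\<And>x y::'a. \<bar>\<Prod>b\<in>A. g b (x \<bullet> b)\<bar> \<le> C"
    "\<And>x y::'a. \<bar>(\<Prod>b\<in>A. g b (x \<bullet> b)) - (\<Prod>b\<in>A. g b (y \<bullet> b))\<bar> \<le> C * norm (x - y)"
    by auto
  obtain M where M: "M > 0" "\<And>x. \<bar>g b x\<bar> \<le> M" using insert.prems(2)[of b] by auto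
  obtain L where L: "L > 0" "\<And>x y. \<bar>g b x - g b y\<bar> \<le> L * \<bar>x - y\<bar>" using insert.prems(3)[of b] by auto
  define K where "K = M * C + L * C"
  have K: "K > 0" "M * C \<le> K" using M C L by (auto simp: K_def intro: add_pos_pos)
  let ?P = "\<lambda>x::'a. \<Prod>b\<in>A. g b (x \<bullet> b)"
  have "\<bar>g b (x \<bullet> b) * ?P x\<bar> \<le> K" for x :: 'a
  proof -
    have "\<bar>g b (x \<bullet> b) * ?P x\<bar> \<le> M * C"
      unfolding abs_mult using M C by (intro mult_mono) auto
    then show ?thesis using K by linarith
  qed
  moreover have "\<bar>g b (x \<bullet> b) * ?P x - g b (y \<bullet> b) * ?P y\<bar> \<le> K * norm (x - y)" for x y :: 'a
  proof -
    have b: "\<bar>x \<bullet> b - y \<bullet> b\<bar> \<le> norm (x - y)"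
      using Basis_le_norm[of b "x - y"] insert.prems(1) by (simp add: inner_diff_left)
    have "g b (x \<bullet> b) * ?P x - g b (y \<bullet> b) * ?P y =
        g b (x \<bullet> b) * (?P x - ?P y) + (g b (x \<bullet> b) - g b (y \<bullet> b)) * ?P y"
      by (simp add: algebra_simps)
    then have "\<bar>g b (x \<bullet> b) * ?P x - g b (y \<bullet> b) * ?P y\<bar> \<le>
        \<bar>g b (x \<bullet> b)\<bar> * \<bar>?P x - ?P y\<bar> + \<bar>g b (x \<bullet> b) - g b (y \<bullet> b)\<bar> * \<bar>?P y\<bar>"
      using abs_triangle_ineq by (simp add: abs_mult[symmetric])
    also have "\<dots> \<le> M * (C * norm (x - y)) + (L * norm (x - y)) * C"
      using M C L by (intro add_mono mult_mono order_trans[OF L(2)] mult_left_mono b) auto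
    also have "\<dots> = K * norm (x - y)" by (simp add: K_def algebra_simps)
    finally show ?thesis .
  qed
  ultimately show ?case
    using K insert.hyps by (intro exI[of _ K]) auto
qed

lemma bump_multi_bounded_lipschitz:
  "\<exists>C>0. \<forall>x y::'a::euclidean_space. \<bar>bump_multi m x\<bar> \<le> C \<and> \<bar>bump_multi m x - bump_multi m y\<bar> \<le> C * norm (x - y)"
  unfolding bump_multi_def
  by (rule prod_bounded_lipschitz) (auto intro: bump_bounded bump_lipschitz)

definition lap_bump_n :: "'a::euclidean_space \<Rightarrow> real" where
  "lap_bump_n x = (\<Sum>b\<in>Basis. bump_multi ((\<lambda>_. 0)(b := 2)) x)"

lemma sum_bounded_lipschitz:
  fixes f :: "'b \<Rightarrow> 'a::real_normed_vector \<Rightarrow> real"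
  assumes "finite A" "\<And>i. i \<in> A \<Longrightarrow> \<exists>C>0. \<forall>x y. \<bar>f i x\<bar> \<le> C \<and> \<bar>f i x - f i y\<bar> \<le> C * norm (x - y)"
  shows "\<exists>C>0. \<forall>x y. \<bar>\<Sum>i\<in>A. f i x\<bar> \<le> C \<and> \<bar>(\<Sum>i\<in>A. f i x) - (\<Sum>i\<in>A. f i y)\<bar> \<le> C * norm (x - y)"
proof -
  obtain C where C: "\<And>i x. i \<in> A \<Longrightarrow> \<bar>f i x\<bar> \<le> C i" "\<And>i. i \<in> A \<Longrightarrow> C i > 0"
    "\<And>i x y. i \<in> A \<Longrightarrow> \<bar>f i x - f i y\<bar> \<le> C i * norm (x - y)"
    using assms(2) by metis
  have s0: "sum C A \<ge> 0" using C(2) by (intro sum_nonneg) (auto intro: less_imp_le)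
  have "\<bar>\<Sum>i\<in>A. f i x\<bar> \<le> sum C A + 1" for x
  proof -
    have "\<bar>\<Sum>i\<in>A. f i x\<bar> \<le> sum C A"
      by (rule order_trans[OF sum_abs sum_mono]) (rule C(1))
    then show ?thesis by simp
  qed
  moreover have "\<bar>(\<Sum>i\<in>A. f i x) - (\<Sum>i\<in>A. f i y)\<bar> \<le> (sum C A + 1) * norm (x - y)" for x y
  proof -
    have "\<bar>\<Sum>i\<in>A. f i x - f i y\<bar> \<le> (\<Sum>i\<in>A. C i * norm (x - y))"
      by (rule order_trans[OF sum_abs sum_mono]) (rule C(3))
    then show ?thesis by (simp add: sum_subtractf sum_distrib_right[symmetric] distrib_right)
        (smt (verit) norm_ge_zero)
  qed
  ultimately show ?thesis using s0 by (intro exI[of _ "sum C A + 1"]) auto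
qed

lemma lap_bump_n_lipschitz:
  "\<exists>C>0. \<forall>x y::'a::euclidean_space. \<bar>lap_bump_n x\<bar> \<le> C \<and> \<bar>lap_bump_n x - lap_bump_n y\<bar> \<le> C * norm (x - y)"
  unfolding lap_bump_n_def
  by (rule sum_bounded_lipschitz, simp, rule bump_multi_bounded_lipschitz)

lemma lap_bump_n_decay:
  assumes "q \<ge> 0"
  shows "\<exists>C>0. \<forall>x::'a::euclidean_space. \<bar>lap_bump_n x\<bar> \<le> C * jap q x"
proof -
  obtain C where C: "C > 0" "\<And>x::'a. \<bar>lap_bump_n x\<bar> \<le> C"
    using lap_bump_n_lipschitz by blast
  have "lap_bump_n x = 0" if "norm x \<ge> real DIM('a)" for x :: 'a
    unfolding lap_bump_n_def by (simp add: bump_multi_eq_0[OF that])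
  from compact_support_le_jap[of lap_bump_n, OF C(2) this assms]
  show ?thesis using C(1) by (intro exI[of _ "C * (1 + real DIM('a)) powr q"]) (auto simp: add_pos_nonneg)
qed

lemma bump_n_lipschitz:
  "\<exists>L>0. \<forall>x y::'a::euclidean_space. \<bar>bump_n x - bump_n y\<bar> \<le> L * norm (x - y)"
  using bump_multi_bounded_lipschitz[of "\<lambda>_. 0"] unfolding bump_multi_0 by blast

section \<open>The profile and its bounds, uniform in the number of dilations\<close>

definition profile :: "real \<Rightarrow> real \<Rightarrow> nat \<Rightarrow> 'a::euclidean_space \<Rightarrow> real" where
  "profile q s N = dyadic_comb q s 0 bump_n N"

lemma profile_eq: "profile q s N y = (\<Sum>k<N. 2 powr (- q * real k) *
     (2 powr (2 * s) * bump_n (y /\<^sub>R 2 ^ Suc k) - bump_n (y /\<^sub>R 2 ^ k)))"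
  by (simp add: profile_def dyadic_comb_def)

text \<open>The bump increases under dilation, so the subtracted dilate is controlled by its larger
  neighbour and the subtraction costs only the factor \<open>2^(2s) - 1\<close>.\<close>

lemma profile_ge:
  assumes "s \<ge> 0"
  shows "(2 powr (2 * s) - 1) * (\<Sum>k<N. 2 powr (- q * real k) * bump_n (y /\<^sub>R 2 ^ k)) \<le> profile q s N y"
  unfolding profile_eq sum_distrib_left
proof (rule sum_mono)
  fix k
  have "2 powr (2 * s) * bump_n (y /\<^sub>R 2 ^ k) \<le> 2 powr (2 * s) * bump_n (y /\<^sub>R 2 ^ Suc k)"
    by (intro mult_left_mono bump_n_scale_mono) auto
  then have "2 powr (- q * real k) * ((2 powr (2 * s) - 1) * bump_n (y /\<^sub>R 2 ^ k)) \<le> 2 powr (- q * real k) *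
     (2 powr (2 * s) * bump_n (y /\<^sub>R 2 ^ Suc k) - bump_n (y /\<^sub>R 2 ^ k))"
    by (intro mult_left_mono) (auto simp: algebra_simps)
  then show "(2 powr (2 * s) - 1) * (2 powr (- q * real k) * bump_n (y /\<^sub>R 2 ^ k)) \<le> 2 powr (- q * real k) *
     (2 powr (2 * s) * bump_n (y /\<^sub>R 2 ^ Suc k) - bump_n (y /\<^sub>R 2 ^ k))"
    by (simp only: mult.left_commute)
qed

lemma profile_nonneg:
  assumes "s \<ge> 0"
  shows "profile q s N y \<ge> 0"
  by (rule order_trans[OF mult_nonneg_nonneg profile_ge[OF assms]])
    (use assms in \<open>auto intro!: sum_nonneg mult_nonneg_nonneg bump_n_nonneg ge_one_powr_ge_zero\<close>)

text \<open>A single summand is enough, the one whose scale is comparable with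
  \<open>1 + |y|\<close>. The restriction on \<open>y\<close> guarantees that this scale is among
  the \<open>N\<close> available ones.\<close>

lemma profile_lower_bound:
  assumes "s > 0" "q \<ge> 0"
  shows "\<exists>c>0. \<forall>N. \<forall>y::'a::euclidean_space. norm y \<le> 2 ^ N / 4 \<longrightarrow> N \<ge> 1 \<longrightarrow> c * jap q y \<le> profile q s N y"
proof -
  define c0 where "c0 = 2 powr (2 * s) - 1"
  define c1 where "c1 = bump 0 (1 / 2) ^ DIM('a)"
  have c0: "c0 > 0" unfolding c0_def using assms by (simp add: gr_one_powr)
  have c1: "c1 > 0" unfolding c1_def by (simp add: bump_0_pos)
  have "(c0 * c1 * 4 powr (- q)) * jap q y \<le> profile q s N y"
    if N: "norm y \<le> 2 ^ N / 4" "N \<ge> 1" for N and y :: 'a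
  proof -
    \<comment> \<open>The first scale at which every coordinate of \<open>y/2^k\<close> is at most
      1/2, so that the bump is bounded below. Minimality gives
      \<open>2^k \<le> 4 (1 + |y|)\<close>.\<close>
    define k where "k = (LEAST k. norm y \<le> 2 ^ k / 2)"
    \<comment> \<open>The restriction \<open>|y| \<le> 2^N / 4\<close> is the defining condition of
      \<open>k\<close> at \<open>N - 1\<close>, whence \<open>k < N\<close>.\<close>
    have ex: "norm y \<le> 2 ^ (N - 1) / 2"
      using N by (cases N) auto
    have k: "norm y \<le> 2 ^ k / 2" unfolding k_def by (rule LeastI[of "\<lambda>k. norm y \<le> 2 ^ k / 2", OF ex])
    have kN: "k < N" using Least_le[of "\<lambda>k. norm y \<le> 2 ^ k / 2", OF ex] N unfolding k_def by linarith
    have k4: "2 ^ k \<le> 4 * (1 + norm y)"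
    proof (cases k)
      case (Suc j)
      have "\<not> norm y \<le> 2 ^ j / 2"
        using not_less_Least[of j "\<lambda>k. norm y \<le> 2 ^ k / 2"] Suc unfolding k_def by simp
      then show ?thesis using Suc by simp
    qed (simp add: algebra_simps add_increasing2)
    have "4 powr (- q) * jap q y = (4 * (1 + norm y)) powr (- q)"
      unfolding jap_def by (subst powr_mult) auto
    also have "\<dots> \<le> (2 ^ k) powr (- q)"
      using k4 assms by (intro powr_mono2') auto
    also have "\<dots> = 2 powr (- q * real k)"
      by (simp add: powr_powr powr_realpow[symmetric] mult.commute)
    finally have w: "4 powr (- q) * jap q y \<le> 2 powr (- q * real k)" .
    have g: "c1 \<le> bump_n (y /\<^sub>R 2 ^ k)"
    proof -
      have "c1 = (\<Prod>b\<in>(Basis::'a set). bump 0 (1 / 2))" by (simp add: c1_def)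
      also have "\<dots> \<le> (\<Prod>b\<in>Basis. bump 0 ((y /\<^sub>R 2 ^ k) \<bullet> b))"
      proof (intro prod_mono conjI bump_0_nonneg bump_0_antimono)
        fix b :: 'a assume "b \<in> Basis"
        then have "\<bar>y \<bullet> b\<bar> \<le> 2 ^ k / 2" using Basis_le_norm k by (meson order_trans)
        then show "\<bar>(y /\<^sub>R 2 ^ k) \<bullet> b\<bar> \<le> \<bar>1 / 2\<bar>" by (simp add: abs_mult field_simps)
      qed
      finally show ?thesis by (simp add: bump_n_def)
    qed
    have "(c0 * c1 * 4 powr (- q)) * jap q y = c0 * ((4 powr (- q) * jap q y) * c1)" by simp
    also have "\<dots> \<le> c0 * (2 powr (- q * real k) * bump_n (y /\<^sub>R 2 ^ k))"
      using c0 c1 by (intro mult_left_mono mult_mono w g) auto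
    also have "\<dots> \<le> c0 * (\<Sum>k<N. 2 powr (- q * real k) * bump_n (y /\<^sub>R 2 ^ k))"
      using c0 kN by (intro mult_left_mono member_le_sum) (auto intro!: mult_nonneg_nonneg bump_n_nonneg)
    also have "\<dots> \<le> profile q s N y"
      unfolding c0_def using assms by (intro profile_ge) simp
    finally show ?thesis .
  qed
  moreover have "c0 * c1 * 4 powr (- q) > 0" using c0 c1 by simp
  ultimately show ?thesis by blast
qed

text \<open>An operator of order zero provides no geometric factor. With
  \<open>A_k = 2^k + |y|\<close> the summand is \<open>2^k A_k^(-q-1)\<close>, and
  \<open>2^k\<close> is the increment of \<open>A\<close>: this is a Riemann sum for the integral of
  \<open>a^(-q-1)\<close>. It is compared with the increments of \<open>A^(-q)\<close>, which
  telescope.\<close>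

lemma sum_jap_dilate_le:
  assumes "q \<ge> 1"
  shows "(\<Sum>k<N. 2 powr (- q * real k) * jap (q + 1) (y /\<^sub>R 2 ^ k)) \<le> 2 * jap q y"
proof -
  define A where "A k = 2 ^ k + norm y" for k :: nat
  have A: "A k > 0" for k by (simp add: A_def add_pos_nonneg)
  have "2 powr (- q * real k) * jap (q + 1) (y /\<^sub>R 2 ^ k) \<le> 2 * (A k powr (- q) - A (Suc k) powr (- q))" for k
  proof -
    have "1 + norm (y /\<^sub>R 2 ^ k) = A k / 2 ^ k"
      by (simp add: A_def field_simps)
    then have "jap (q + 1) (y /\<^sub>R 2 ^ k) = A k powr (- q - 1) / (2 ^ k) powr (- q - 1)"
      unfolding jap_def using less_imp_le[OF A[of k]] by (simp add: powr_divide)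
    also have "\<dots> = A k powr (- q - 1) * (2 ^ k) powr (q + 1)"
      by (simp add: powr_minus[of _ "q + 1", simplified] divide_inverse)
    also have "(2 ^ k) powr (q + 1) = 2 powr (q * real k) * 2 ^ k"
      by (simp add: powr_add powr_powr powr_realpow[symmetric] mult.commute)
    finally have "2 powr (- q * real k) * jap (q + 1) (y /\<^sub>R 2 ^ k) = 2 ^ k * A k powr (- q - 1)"
      by (simp add: powr_minus)
    also have "\<dots> = 2 * (A k powr (- q) * (2 ^ k / (2 * A k)))"
      using A[of k] by (simp add: powr_diff)
    also have "\<dots> \<le> 2 * (A k powr (- q) * (1 - (A k / A (Suc k)) powr q))"
    proof (intro mult_left_mono)
      have le: "A k \<le> A (Suc k)" "A (Suc k) \<le> 2 * A k" by (auto simp: A_def)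
      have "(A k / A (Suc k)) powr q \<le> (A k / A (Suc k)) powr 1"
        using A[of k] A[of "Suc k"] le assms by (intro powr_mono') auto
      also have "\<dots> = A k / A (Suc k)"
        using A[of k] A[of "Suc k"] by simp
      finally have "1 - A k / A (Suc k) \<le> 1 - (A k / A (Suc k)) powr q" by simp
      moreover have "1 - A k / A (Suc k) = 2 ^ k / A (Suc k)"
        using A[of "Suc k"] by (simp add: A_def field_simps)
      moreover have "2 ^ k / (2 * A k) \<le> 2 ^ k / A (Suc k)"
        using le A[of "Suc k"] by (intro divide_left_mono) (auto intro!: mult_pos_pos A)
      ultimately show "2 ^ k / (2 * A k) \<le> 1 - (A k / A (Suc k)) powr q" by linarith
    qed auto
    also have "A k powr (- q) * (1 - (A k / A (Suc k)) powr q) = A k powr (- q) - A (Suc k) powr (- q)"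
      using A[of k] A[of "Suc k"] by (simp add: powr_divide powr_minus field_simps)
    finally show ?thesis .
  qed
  then have "(\<Sum>k<N. 2 powr (- q * real k) * jap (q + 1) (y /\<^sub>R 2 ^ k)) \<le>
      (\<Sum>k<N. 2 * (A k powr (- q) - A (Suc k) powr (- q)))"
    by (rule sum_mono)
  also have "\<dots> = 2 * (A 0 powr (- q) - A N powr (- q))"
    unfolding sum_distrib_left[symmetric] sum_lessThan_telescope'[of "\<lambda>k. A k powr (- q)"] ..
  also have "\<dots> \<le> 2 * jap q y"
    by (simp add: A_def jap_def)
  finally show ?thesis .
qed

text \<open>The bump has compact support and so also lies below a multiple of
  \<open>jap (q + 1)\<close>; the spare power feeds the telescoping sum. Pairing the scale
  \<open>2^(k+1)\<close> with the weight of index \<open>k\<close> costs the factor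
  \<open>2^q\<close>.\<close>

lemma profile_upper_bound:
  assumes "q \<ge> 1"
  shows "\<exists>C>0. \<forall>N. \<forall>y::'a::euclidean_space. profile q s N y \<le> C * jap q y"
proof -
  define M where "M = (1 + real DIM('a)) powr (q + 1)"
  have M: "M > 0" by (simp add: M_def add_pos_nonneg)
  have g: "bump_n x \<le> M * jap (q + 1) x" for x :: 'a
    using compact_support_le_jap[of bump_n 1 "real DIM('a)" "q + 1" x] assms
      bump_multi_eq_0[of _ "\<lambda>_. 0", unfolded bump_multi_0]
    by (auto simp: M_def bump_n_nonneg bump_n_le_1)
  have "profile q s N y \<le> (2 powr (2 * s) * 2 powr q * M * 2) * jap q y" for N and y :: 'a
  proof -
    have "profile q s N y \<le> (\<Sum>k<N. 2 powr (- q * real k) * (2 powr (2 * s) * bump_n (y /\<^sub>R 2 ^ Suc k)))"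
      unfolding profile_eq by (intro sum_mono mult_left_mono) (auto simp: bump_n_nonneg)
    also have "\<dots> \<le> (\<Sum>k<N. 2 powr (- q * real k) * (2 powr (2 * s) * (M * jap (q + 1) (y /\<^sub>R 2 ^ Suc k))))"
      by (intro sum_mono mult_left_mono g) auto
    also have "\<dots> = (\<Sum>k<N. 2 powr (2 * s) * 2 powr q * M * (2 powr (- q * real (Suc k)) * jap (q + 1) (y /\<^sub>R 2 ^ Suc k)))"
    proof (intro sum.cong refl)
      fix k
      have "2 powr (- q * real k) = 2 powr q * 2 powr (- q * real (Suc k))"
        by (simp add: powr_add[symmetric] algebra_simps)
      then show "2 powr (- q * real k) * (2 powr (2 * s) * (M * jap (q + 1) (y /\<^sub>R 2 ^ Suc k))) =
        2 powr (2 * s) * 2 powr q * M * (2 powr (- q * real (Suc k)) * jap (q + 1) (y /\<^sub>R 2 ^ Suc k))"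
        by (simp only: mult_ac)
    qed
    also have "\<dots> = 2 powr (2 * s) * 2 powr q * M *
        (\<Sum>k<N. 2 powr (- q * real (Suc k)) * jap (q + 1) (y /\<^sub>R 2 ^ Suc k))"
      by (rule sum_distrib_left[symmetric])
    also have "\<dots> \<le> 2 powr (2 * s) * 2 powr q * M *
        (\<Sum>k<Suc N. 2 powr (- q * real k) * jap (q + 1) (y /\<^sub>R 2 ^ k))"
      unfolding sum.lessThan_Suc_shift using M less_imp_le[OF jap_pos[of "q + 1" y]]
      by (intro mult_left_mono) auto
    also have "\<dots> \<le> 2 powr (2 * s) * 2 powr q * M * (2 * jap q y)"
      using M by (intro mult_left_mono sum_jap_dilate_le assms) auto
    finally show ?thesis by simp
  qed
  moreover have "2 powr (2 * s) * 2 powr q * M * 2 > 0" using M by simp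
  ultimately show ?thesis by blast
qed

lemma profile_0_ge:
  assumes "s > 0" "N \<ge> 1"
  shows "(2 powr (2 * s) - 1) * bump 0 0 ^ DIM('a) \<le> profile q s N (0::'a::euclidean_space)"
proof -
  have "(2 powr (2 * s) - 1) * bump 0 0 ^ DIM('a) \<le> (2 powr (2 * s) - 1) * (\<Sum>k<N. 2 powr (- q * real k) * bump_n ((0::'a) /\<^sub>R 2 ^ k))"
  proof (intro mult_left_mono)
    have "(\<Sum>k\<in>{0}. 2 powr (- q * real k) * bump_n ((0::'a) /\<^sub>R 2 ^ k)) \<le> (\<Sum>k<N. 2 powr (- q * real k) * bump_n ((0::'a) /\<^sub>R 2 ^ k))"
      using assms by (intro sum_mono2) (auto simp: bump_n_nonneg)
    then show "bump 0 0 ^ DIM('a) \<le> (\<Sum>k<N. 2 powr (- q * real k) * bump_n ((0::'a) /\<^sub>R 2 ^ k))"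
      by (simp add: bump_n_def)
  qed (use assms in \<open>auto intro: ge_one_powr_ge_zero\<close>)
  also have "\<dots> \<le> profile q s N (0::'a)" using assms by (intro profile_ge) simp
  finally show ?thesis .
qed

text \<open>Dilations by \<open>2^k\<close> do not increase the Lipschitz constant, and the weights
  are at most \<open>2^(-k)\<close>, so the bound is uniform in \<open>N\<close>.\<close>

lemma profile_lipschitz:
  assumes "q \<ge> 1"
  shows "\<exists>L>0. \<forall>N. \<forall>x y::'a::euclidean_space. \<bar>profile q s N x - profile q s N y\<bar> \<le> L * norm (x - y)"
proof -
  obtain L where L: "L > 0" "\<And>x y::'a. \<bar>bump_n x - bump_n y\<bar> \<le> L * norm (x - y)"
    using bump_n_lipschitz by blast
  have Lk: "\<bar>bump_n (x /\<^sub>R 2 ^ k) - bump_n (y /\<^sub>R 2 ^ k)\<bar> \<le> L * norm (x - y)" for x y :: 'a and k :: nat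
  proof -
    have "norm (x /\<^sub>R 2 ^ k - y /\<^sub>R 2 ^ k) = inverse (2 ^ k) * norm (x - y)"
      by (simp add: scaleR_diff_right[symmetric])
    also have "\<dots> \<le> 1 * norm (x - y)" by (intro mult_right_mono) (auto simp: inverse_le_1_iff)
    finally show ?thesis
      using L by (intro order_trans[OF L(2)] mult_left_mono) auto
  qed
  define B where "B = 2 powr (2 * s) * L + L"
  have B: "B > 0" using L by (simp add: B_def add_pos_pos)
  have "\<bar>profile q s N x - profile q s N y\<bar> \<le> (2 * B) * norm (x - y)" for N and x y :: 'a
  proof -
    have "\<bar>profile q s N x - profile q s N y\<bar> \<le> (\<Sum>k<N. (1 / 2) ^ k * (B * norm (x - y)))"
      unfolding profile_eq sum_subtractf[symmetric]
    proof (rule order_trans[OF sum_abs sum_mono])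
      fix k
      let ?w = "2 powr (- q * real k)"
      let ?a = "bump_n (x /\<^sub>R 2 ^ Suc k) - bump_n (y /\<^sub>R 2 ^ Suc k)" and ?b = "bump_n (x /\<^sub>R 2 ^ k) - bump_n (y /\<^sub>R 2 ^ k)"
      have w: "?w \<le> (1 / 2) ^ k"
      proof -
        have "?w = (2 powr (- q)) ^ k" by (simp add: powr_powr powr_realpow[symmetric])
        also have "\<dots> \<le> (2 powr (- 1)) ^ k" using assms by (intro power_mono powr_mono) auto
        finally show ?thesis by (simp add: powr_minus)
      qed
      have "\<bar>?w * (2 powr (2 * s) * bump_n (x /\<^sub>R 2 ^ Suc k) - bump_n (x /\<^sub>R 2 ^ k)) -
         ?w * (2 powr (2 * s) * bump_n (y /\<^sub>R 2 ^ Suc k) - bump_n (y /\<^sub>R 2 ^ k))\<bar> =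
         ?w * \<bar>2 powr (2 * s) * ?a - ?b\<bar>"
        by (simp only: right_diff_distrib[symmetric] abs_mult) (simp add: algebra_simps)
      also have "\<dots> \<le> (1 / 2) ^ k * (\<bar>2 powr (2 * s) * ?a\<bar> + \<bar>?b\<bar>)"
        by (intro mult_mono w abs_triangle_ineq4) auto
      also have "\<dots> \<le> (1 / 2) ^ k * (2 powr (2 * s) * (L * norm (x - y)) + L * norm (x - y))"
        unfolding abs_mult using Lk[where k = "Suc k"] Lk[where k = k]
        by (intro mult_left_mono add_mono) auto
      also have "\<dots> = (1 / 2) ^ k * (B * norm (x - y))" by (simp add: B_def algebra_simps)
      finally show "\<bar>?w * (2 powr (2 * s) * bump_n (x /\<^sub>R 2 ^ Suc k) - bump_n (x /\<^sub>R 2 ^ k)) -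
         ?w * (2 powr (2 * s) * bump_n (y /\<^sub>R 2 ^ Suc k) - bump_n (y /\<^sub>R 2 ^ k))\<bar> \<le> (1 / 2) ^ k * (B * norm (x - y))" .
    qed
    also have "\<dots> = (\<Sum>k<N. (1 / 2) ^ k) * (B * norm (x - y))" by (simp add: sum_distrib_right)
    also have "\<dots> \<le> 1 / (1 - 1 / 2) * (B * norm (x - y))"
      using B by (intro mult_right_mono sum_geometric_le) auto
    finally show ?thesis by simp
  qed
  then show ?thesis using B by (intro exI[of _ "2 * B"]) auto
qed

section \<open>The test functions\<close>

text \<open>A family closed under differentiation in time and space: \<open>j\<close> counts time
  derivatives, \<open>m\<close> is a spatial multi-index, and the coefficients \<open>c\<close>
  absorb the factors from the chain rule.\<close>

definition test_prod :: "real \<Rightarrow> nat \<Rightarrow> 'i set \<Rightarrow> ('i \<Rightarrow> real) \<Rightarrow> ('i \<Rightarrow> real) \<Rightarrow> ('a::euclidean_space \<Rightarrow> nat)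
    \<Rightarrow> real \<times> 'a \<Rightarrow> real" where
  "test_prod r j I c k m z = bump j (fst z / r) * (\<Sum>i\<in>I. c i * bump_multi m (snd z /\<^sub>R k i))"

lemma has_derivative_bump_multi:
  fixes x :: "'a::euclidean_space"
  shows "(bump_multi m has_derivative (\<lambda>h. \<Sum>b\<in>Basis. (h \<bullet> b) * bump_multi (m(b := Suc (m b))) x)) (at x)"
proof -
  have "((\<lambda>x. \<Prod>b\<in>Basis. bump (m b) (x \<bullet> b)) has_derivative
      (\<lambda>h. \<Sum>b\<in>Basis. (bump (Suc (m b)) (x \<bullet> b) * (h \<bullet> b)) * (\<Prod>j\<in>Basis - {b}. bump (m j) (x \<bullet> j)))) (at x)"
    by (intro has_derivative_prod has_derivative_bump_inner)
  also have "(\<lambda>h. \<Sum>b\<in>Basis. (bump (Suc (m b)) (x \<bullet> b) * (h \<bullet> b)) * (\<Prod>j\<in>Basis - {b}. bump (m j) (x \<bullet> j)))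
      = (\<lambda>h. \<Sum>b\<in>Basis. (h \<bullet> b) * bump_multi (m(b := Suc (m b))) x)"
  proof (intro ext sum.cong refl)
    fix h b :: 'a assume b: "b \<in> Basis"
    have "bump_multi (m(b := Suc (m b))) x = bump (Suc (m b)) (x \<bullet> b) * (\<Prod>j\<in>Basis - {b}. bump (m j) (x \<bullet> j))"
      unfolding bump_multi_def by (subst prod.remove[OF _ b]) auto
    then show "(bump (Suc (m b)) (x \<bullet> b) * (h \<bullet> b)) * (\<Prod>j\<in>Basis - {b}. bump (m j) (x \<bullet> j))
        = (h \<bullet> b) * bump_multi (m(b := Suc (m b))) x" by simp
  qed
  finally show ?thesis unfolding bump_multi_def[abs_def] .
qed

lemma has_derivative_test_prod:
  fixes z :: "real \<times> 'a::euclidean_space"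
  shows "(test_prod r j I c k m has_derivative (\<lambda>h.
      bump j (fst z / r) * (\<Sum>i\<in>I. c i * (\<Sum>b\<in>Basis. ((snd h /\<^sub>R k i) \<bullet> b) * bump_multi (m(b := Suc (m b))) (snd z /\<^sub>R k i)))
      + bump (Suc j) (fst z / r) * (fst h / r) * (\<Sum>i\<in>I. c i * bump_multi m (snd z /\<^sub>R k i)))) (at z)"
proof -
  have 1: "((\<lambda>z::real \<times> 'a. bump j (fst z / r)) has_derivative (\<lambda>h. bump (Suc j) (fst z / r) * (fst h / r))) (at z)"
  proof -
    have "((\<lambda>z::real \<times> 'a. fst z / r) has_derivative (\<lambda>h. fst h / r)) (at z)"
      unfolding divide_inverse by (intro derivative_intros)
    from has_derivative_compose[OF this DERIV_bump[unfolded has_field_derivative_def]]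
    show ?thesis .
  qed
  have 2: "((\<lambda>z::real \<times> 'a. bump_multi m (snd z /\<^sub>R l)) has_derivative
      (\<lambda>h. \<Sum>b\<in>Basis. ((snd h /\<^sub>R l) \<bullet> b) * bump_multi (m(b := Suc (m b))) (snd z /\<^sub>R l))) (at z)" for l
  proof -
    have "((\<lambda>z::real \<times> 'a. snd z /\<^sub>R l) has_derivative (\<lambda>h. snd h /\<^sub>R l)) (at z)"
      by (intro derivative_intros)
    from has_derivative_compose[OF this has_derivative_bump_multi] show ?thesis .
  qed
  show ?thesis
    unfolding test_prod_def[abs_def]
    by (rule has_derivative_mult[OF 1]) (intro has_derivative_sum has_derivative_mult_right 2)
qed

lemma frechet_test_prod_t:
  "(\<lambda>z. frechet_derivative (test_prod r j I c k m) (at z) (1, 0)) = test_prod r (Suc j) I (\<lambda>i. c i / r) k m"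
  unfolding frechet_derivative_at[OF has_derivative_test_prod, symmetric]
  by (simp add: test_prod_def fun_eq_iff sum_distrib_left)

lemma frechet_test_prod_x:
  assumes "b \<in> Basis"
  shows "(\<lambda>z. frechet_derivative (test_prod r j I c k m) (at z) (0, b)) =
    test_prod r j I (\<lambda>i. c i / k i) k (m(b := Suc (m b)))"
proof -
  have "(\<Sum>b'\<in>Basis. ((b /\<^sub>R l) \<bullet> b') * f b') = f b / l" for l and f :: "'a \<Rightarrow> real"
  proof -
    have "(\<Sum>b'\<in>Basis. ((b /\<^sub>R l) \<bullet> b') * f b') = (\<Sum>b'\<in>Basis. if b' = b then f b / l else 0)"
      using assms by (intro sum.cong refl) (auto simp: inner_Basis divide_inverse)
    then show ?thesis using assms by simp
  qed
  then show ?thesis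
    unfolding frechet_derivative_at[OF has_derivative_test_prod, symmetric]
    by (simp add: test_prod_def fun_eq_iff)
qed

lemma dt_test_prod: "dt (test_prod r j I c k m) = test_prod r (Suc j) I (\<lambda>i. c i / r) k m"
  by (simp add: dt_def frechet_test_prod_t)

lemma dtt_test_prod: "dtt (test_prod r j I c k m) = test_prod r (Suc (Suc j)) I (\<lambda>i. c i / r / r) k m"
  by (simp add: dtt_def frechet_test_prod_t)

lemma lap_x_test_prod:
  fixes z :: "real \<times> 'b::euclidean_space"
  shows "lap_x (test_prod r j I c k (\<lambda>_. 0)) z = bump j (fst z / r) * (\<Sum>i\<in>I. c i / k i / k i * lap_bump_n (snd z /\<^sub>R k i))"
proof -
  have "iter_dderiv [(0, b), (0, b)] (test_prod r j I c k (\<lambda>_. 0)) z =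
      test_prod r j I (\<lambda>i. c i / k i / k i) k ((\<lambda>_. 0)(b := 2)) z" if "b \<in> Basis" for b :: 'b
    using that by (simp add: frechet_test_prod_x numeral_2_eq_2)
  then have "lap_x (test_prod r j I c k (\<lambda>_. 0)) z =
      (\<Sum>b\<in>Basis. test_prod r j I (\<lambda>i. c i / k i / k i) k ((\<lambda>_. 0)(b := 2)) z)"
    unfolding lap_x_def by (intro sum.cong refl)
  also have "\<dots> = bump j (fst z / r) * (\<Sum>i\<in>I. c i / k i / k i * lap_bump_n (snd z /\<^sub>R k i))"
    unfolding test_prod_def sum_distrib_left lap_bump_n_def by (rule sum.swap)
  finally show ?thesis .
qed

lemma bump_alg_test_prod: "bump_alg (test_prod r j I c k (m :: 'b::euclidean_space \<Rightarrow> nat))"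
proof -
  have 1: "bump_alg (\<lambda>z::real \<times> 'b. bump j (fst z / r))" for j r
    using bump_alg.bump[of j "(1 / r, 0) :: real \<times> 'b"] by (simp add: inner_prod_def)
  have 2: "bump_alg (\<lambda>z::real \<times> 'b. bump j ((snd z /\<^sub>R l) \<bullet> b))" for j l b
    using bump_alg.bump[of j "(0, b /\<^sub>R l) :: real \<times> 'b"] by (simp add: inner_prod_def)
  show ?thesis
    unfolding test_prod_def[abs_def] bump_multi_def
    by (intro bump_alg.mult bump_alg_sum bump_alg_prod bump_alg.const 1 2)
qed

lemma test_fun_test_prod:
  assumes "r > 0" "finite I" "\<And>i. i \<in> I \<Longrightarrow> k i > 0" "ereal r < T"
  shows "test_fun T (test_prod r j I c k (m :: 'a::euclidean_space \<Rightarrow> nat))"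
    and "\<exists>R. \<forall>z. test_prod r j I c k m z \<noteq> 0 \<longrightarrow> z \<in> {-r..r} \<times> cball 0 R"
proof -
  \<comment> \<open>The sum of the radii stands in for their maximum and also makes sense for an
    empty index set.\<close>
  define R where "R = (\<Sum>i\<in>I. real DIM('a) * k i)"
  let ?S = "{-r..r} \<times> cball (0::'a) R"
  have sub: "z \<in> ?S" if "test_prod r j I c k m z \<noteq> 0" for z
  proof -
    have "bump j (fst z / r) \<noteq> 0" and "(\<Sum>i\<in>I. c i * bump_multi m (snd z /\<^sub>R k i)) \<noteq> 0"
      using that by (auto simp: test_prod_def)
    then obtain i where i: "i \<in> I" "bump_multi m (snd z /\<^sub>R k i) \<noteq> 0"
      by (metis (no_types, lifting) mult_zero_right sum.neutral)
    have "\<bar>fst z / r\<bar> < 1" using \<open>bump j (fst z / r) \<noteq> 0\<close> bump_eq_0 by (metis not_le)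
    then have "\<bar>fst z\<bar> < r" using assms by (simp add: abs_divide)
    moreover have "norm (snd z /\<^sub>R k i) < real DIM('a)"
      using i bump_multi_eq_0 by (metis not_le)
    then have "norm (snd z) \<le> real DIM('a) * k i"
      using assms(3)[OF i(1)] by (simp add: field_simps)
    moreover have "real DIM('a) * k i \<le> R"
      unfolding R_def using assms i by (intro member_le_sum) (auto intro: less_imp_le)
    ultimately show ?thesis by (cases z) auto
  qed
  then show "\<exists>R. \<forall>z. test_prod r j I c k m z \<noteq> 0 \<longrightarrow> z \<in> {-r..r} \<times> cball 0 R" by blast
  have comp: "compact ?S" by (intro compact_Times compact_Icc compact_cball)
  have cl: "closure {z. test_prod r j I c k m z \<noteq> 0} \<subseteq> ?S"
    by (rule closure_minimal) (use sub compact_imp_closed[OF comp] in auto)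
  have "compact (closure {z. test_prod r j I c k m z \<noteq> 0})"
    using closed_Int_compact[OF closed_closure comp, of "{z. test_prod r j I c k m z \<noteq> 0}"] cl
    by (simp add: Int_absorb2)
  moreover have "?S \<subseteq> {z. ereal (fst z) < T}"
    using assms(4) by (auto intro: le_less_trans[of _ "ereal r"])
  ultimately show "test_fun T (test_prod r j I c k m)"
    unfolding test_fun_def using cl bump_alg_smooth[OF bump_alg_test_prod] by blast
qed

section \<open>The dyadic test function and its derivatives\<close>

definition dy_I :: "nat \<Rightarrow> (nat + nat) set" where
  "dy_I N = {..<N} <+> {..<N}"

definition dy_c :: "real \<Rightarrow> real \<Rightarrow> nat + nat \<Rightarrow> real" where
  "dy_c q s i = (case i of Inl k \<Rightarrow> 2 powr (- q * real k) * 2 powr (2 * s) | Inr k \<Rightarrow> - (2 powr (- q * real k)))"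

definition dy_k :: "real \<Rightarrow> nat + nat \<Rightarrow> real" where
  "dy_k K i = (case i of Inl k \<Rightarrow> K * 2 ^ Suc k | Inr k \<Rightarrow> K * 2 ^ k)"

lemma dy_k_pos: "K > 0 \<Longrightarrow> dy_k K i > 0"
  by (auto simp: dy_k_def split: sum.split)

text \<open>The disjoint sum as index set flattens \<open>dyadic_comb\<close> into one finite
  combination of dilations, as the scaling rule for \<open>frac_lap\<close> demands:
  \<open>Inl k\<close> carries the dilate by \<open>K 2^(k+1)\<close>, \<open>Inr k\<close> the
  subtracted one by \<open>K 2^k\<close>. The values 0, 1 and \<open>\<sigma>\<close> of
  \<open>\<tau>\<close> yield the profile, the Laplacian and the fractional Laplacian.\<close>

lemma sum_dy:
  assumes "K > 0"
  shows "(\<Sum>i\<in>dy_I N. dy_c q s i * (dy_k K i powr (- 2 * \<tau>) * g (x /\<^sub>R dy_k K i)))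
    = K powr (- 2 * \<tau>) * dyadic_comb q s \<tau> g N (x /\<^sub>R K)"
proof -
  have "(\<Sum>i\<in>dy_I N. dy_c q s i * (dy_k K i powr (- 2 * \<tau>) * g (x /\<^sub>R dy_k K i))) =
    (\<Sum>k<N. 2 powr (- q * real k) * 2 powr (2 * s) * ((K * 2 ^ Suc k) powr (- 2 * \<tau>) * g (x /\<^sub>R (K * 2 ^ Suc k))))
    + (\<Sum>k<N. - (2 powr (- q * real k)) * ((K * 2 ^ k) powr (- 2 * \<tau>) * g (x /\<^sub>R (K * 2 ^ k))))"
    unfolding dy_I_def by (subst sum.Plus) (simp_all add: dy_c_def dy_k_def)
  also have "\<dots> = K powr (- 2 * \<tau>) * dyadic_comb q s \<tau> g N (x /\<^sub>R K)"
    unfolding dyadic_comb_def sum_distrib_left sum.distrib[symmetric]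
  proof (intro sum.cong refl)
    fix k
    have *: "(K * 2 ^ j) powr (- 2 * \<tau>) = K powr (- 2 * \<tau>) * (2 ^ j) powr (- 2 * \<tau>)" for j :: nat
      by (rule powr_mult)
    have **: "x /\<^sub>R (K * 2 ^ j) = (x /\<^sub>R K) /\<^sub>R 2 ^ j" for j :: nat
      by (simp add: mult.commute)
    show "2 powr (- q * real k) * 2 powr (2 * s) * ((K * 2 ^ Suc k) powr (- 2 * \<tau>) * g (x /\<^sub>R (K * 2 ^ Suc k)))
      + - (2 powr (- q * real k)) * ((K * 2 ^ k) powr (- 2 * \<tau>) * g (x /\<^sub>R (K * 2 ^ k))) =
      K powr (- 2 * \<tau>) * (2 powr (- q * real k) * (2 powr (2 * s) * ((2 ^ Suc k) powr (- 2 * \<tau>) * g ((x /\<^sub>R K) /\<^sub>R 2 ^ Suc k))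
       - (2 ^ k) powr (- 2 * \<tau>) * g ((x /\<^sub>R K) /\<^sub>R 2 ^ k)))"
      unfolding * ** by (simp only: algebra_simps)
  qed
  finally show ?thesis .
qed

definition test_phi :: "real \<Rightarrow> real \<Rightarrow> real \<Rightarrow> real \<Rightarrow> nat \<Rightarrow> real \<times> 'a::euclidean_space \<Rightarrow> real" where
  "test_phi r K q s N = test_prod r 0 (dy_I N) (dy_c q s) (dy_k K) (\<lambda>_. 0)"

lemma finite_dy_I: "finite (dy_I N)"
  by (simp add: dy_I_def)

lemma sum_dy_profile:
  assumes "K > 0"
  shows "(\<Sum>i\<in>dy_I N. dy_c q s i * bump_n (x /\<^sub>R dy_k K i)) = profile q s N (x /\<^sub>R K)"
  using sum_dy[OF assms, where \<tau> = 0 and g = bump_n] dy_k_pos[OF assms] assms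
  by (simp add: profile_def less_imp_neq[symmetric])

lemma test_phi_eq:
  assumes "K > 0"
  shows "test_phi r K q s N z = bump 0 (fst z / r) * profile q s N (snd z /\<^sub>R K)"
  by (simp add: test_phi_def test_prod_def bump_multi_0 sum_dy_profile[OF assms])

lemma dt_test_phi:
  assumes "K > 0"
  shows "dt (test_phi r K q s N) z = bump 1 (fst z / r) / r * profile q s N (snd z /\<^sub>R K)"
  unfolding test_phi_def dt_test_prod test_prod_def bump_multi_0 sum_dy_profile[OF assms, symmetric]
  by (simp add: sum_distrib_left)

lemma dtt_test_phi:
  assumes "K > 0"
  shows "dtt (test_phi r K q s N) z = bump 2 (fst z / r) / r\<^sup>2 * profile q s N (snd z /\<^sub>R K)"
  unfolding test_phi_def dtt_test_prod test_prod_def bump_multi_0 sum_dy_profile[OF assms, symmetric]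
  by (simp add: sum_distrib_left power2_eq_square numeral_2_eq_2)

lemma lap_x_test_phi:
  assumes "K > 0"
  shows "lap_x (test_phi r K q s N) z =
    bump 0 (fst z / r) * (K powr (- 2 * 1) * dyadic_comb q s 1 lap_bump_n N (snd z /\<^sub>R K))"
proof -
  have "dy_k K i powr (- 2 * 1) = 1 / dy_k K i / dy_k K i" for i
    using dy_k_pos[OF assms, of i] by (simp add: powr_minus_divide power2_eq_square)
  then show ?thesis
    unfolding test_phi_def lap_x_test_prod sum_dy[OF assms, symmetric] by simp
qed

lemma frac_lap_test_phi:
  fixes x :: "'a::euclidean_space"
  assumes "K > 0" "\<sigma> > 0"
  shows "frac_lap \<sigma> (\<lambda>y. test_phi r K q s N (t, y)) x =
    bump 0 (t / r) * (K powr (- 2 * \<sigma>) * dyadic_comb q s \<sigma> (frac_lap \<sigma> bump_n) N (x /\<^sub>R K))"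
proof -
  have "(\<lambda>y::'a. test_phi r K q s N (t, y)) = (\<lambda>y. \<Sum>i\<in>dy_I N. (bump 0 (t / r) * dy_c q s i) * bump_n (y /\<^sub>R dy_k K i))"
    by (simp add: test_phi_def test_prod_def bump_multi_0 sum_distrib_left fun_eq_iff mult.assoc)
  then have "frac_lap \<sigma> (\<lambda>y. test_phi r K q s N (t, y)) x =
    frac_lap \<sigma> (\<lambda>y. \<Sum>i\<in>dy_I N. (bump 0 (t / r) * dy_c q s i) * bump_n (y /\<^sub>R dy_k K i)) x"
    by simp
  also have "\<dots> = (\<Sum>i\<in>dy_I N. (bump 0 (t / r) * dy_c q s i) * (dy_k K i powr (- 2 * \<sigma>) * frac_lap \<sigma> bump_n (x /\<^sub>R dy_k K i)))"
    by (rule frac_lap_bump_n_comb[OF assms(2) finite_dy_I dy_k_pos[OF assms(1)]])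
  also have "\<dots> = bump 0 (t / r) * (\<Sum>i\<in>dy_I N. dy_c q s i * (dy_k K i powr (- 2 * \<sigma>) * frac_lap \<sigma> bump_n (x /\<^sub>R dy_k K i)))"
    by (simp only: sum_distrib_left mult.assoc)
  finally show ?thesis unfolding sum_dy[OF assms(1)] .
qed

section \<open>Size of the residual\<close>

definition weight :: "real \<Rightarrow> real \<Rightarrow> real \<Rightarrow> real \<times> 'a::real_normed_vector \<Rightarrow> real" where
  "weight \<delta> r K z = (fst z / r) / (1 + fst z / r) + (norm (snd z) / K) / (1 + norm (snd z) / K) + r powr (- \<delta>)"

text \<open>At the spatial scale \<open>r^(1/(2s))\<close> an operator of order
  \<open>2\<tau>\<close> scales like \<open>r^(-\<tau>/s)\<close>. For \<open>\<tau> = s\<close>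
  this is exactly \<open>1/r\<close>, and the gain comes from vanishing at \<open>x = 0\<close>; in
  the other case it comes from the surplus \<open>r^(-\<delta>)\<close>.\<close>

lemma operator_term_bound:
  fixes g :: "'a::real_normed_vector \<Rightarrow> real"
  assumes g: "\<And>x. \<bar>g x\<bar> \<le> C * jap q x" and L: "\<And>x y. \<bar>g x - g y\<bar> \<le> L * norm (x - y)"
    and "C \<ge> 0" "L \<ge> 0" "q \<ge> 0" "s > 0" and \<tau>: "\<tau> = s \<or> \<tau> > 0 \<and> \<tau> / s \<ge> 1 + \<delta>"
  shows "\<exists>C'>0. \<forall>N r t x. r \<ge> 1 \<longrightarrow> t \<ge> 0 \<longrightarrow>
    \<bar>(r powr (1 / (2 * s))) powr (- 2 * \<tau>) * dyadic_comb q s \<tau> g N (x /\<^sub>R r powr (1 / (2 * s)))\<bar>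
      \<le> C' / r * (weight \<delta> r (r powr (1 / (2 * s))) (t, x) * jap q (x /\<^sub>R r powr (1 / (2 * s))))"
proof -
  have Kp: "(r powr (1 / (2 * s))) powr (- 2 * \<tau>) = r powr (- (\<tau> / s))" for r
    by (simp add: powr_powr)
  have w1: "norm (x /\<^sub>R K) / (1 + norm (x /\<^sub>R K)) \<le> weight \<delta> r K (t, x)" and w2: "r powr (- \<delta>) \<le> weight \<delta> r K (t, x)"
    if "r \<ge> 1" "t \<ge> 0" "K > 0" for r t K and x :: 'a
    using that by (auto simp: weight_def divide_inverse mult.commute intro!: add_nonneg_nonneg mult_nonneg_nonneg)
  from \<tau> show ?thesis
  proof
    assume eq: "\<tau> = s"
    obtain C' where C': "C' > 0" "\<And>N y. \<bar>dyadic_comb q s s g N y\<bar> \<le> C' * (norm y / (1 + norm y) * jap q y)"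
      using dyadic_comb_principal_bound[OF g L assms(3-6)] by blast
    show ?thesis
    proof (intro exI[of _ C'] conjI allI impI C'(1))
      fix N and r t :: real and x :: 'a assume r: "r \<ge> 1" "t \<ge> 0"
      let ?K = "r powr (1 / (2 * s))"
      have K: "?K > 0" using r by simp
      have "\<bar>?K powr (- 2 * \<tau>) * dyadic_comb q s \<tau> g N (x /\<^sub>R ?K)\<bar> = 1 / r * \<bar>dyadic_comb q s s g N (x /\<^sub>R ?K)\<bar>"
        unfolding abs_mult Kp using r assms by (simp add: eq powr_minus_divide)
      also have "\<dots> \<le> 1 / r * (C' * (weight \<delta> r ?K (t, x) * jap q (x /\<^sub>R ?K)))"
        using r C' less_imp_le[OF jap_pos[of q "x /\<^sub>R ?K"]]
        by (intro mult_left_mono order_trans[OF C'(2)] mult_right_mono w1[OF r K]) auto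
      finally show "\<bar>?K powr (- 2 * \<tau>) * dyadic_comb q s \<tau> g N (x /\<^sub>R ?K)\<bar> \<le> C' / r * (weight \<delta> r ?K (t, x) * jap q (x /\<^sub>R ?K))"
        by simp
    qed
  next
    assume \<tau>: "\<tau> > 0 \<and> \<tau> / s \<ge> 1 + \<delta>"
    obtain C' where C': "C' > 0" "\<And>N y. \<bar>dyadic_comb q s \<tau> g N y\<bar> \<le> C' * jap q y"
      using dyadic_comb_bound[OF g assms(3,5)] \<tau> by blast
    show ?thesis
    proof (intro exI[of _ C'] conjI allI impI C'(1))
      fix N and r t :: real and x :: 'a assume r: "r \<ge> 1" "t \<ge> 0"
      let ?K = "r powr (1 / (2 * s))"
      have K: "?K > 0" using r by simp
      have "r powr (- (\<tau> / s)) \<le> r powr (- 1 + - \<delta>)"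
        using r \<tau> by (intro powr_mono) auto
      also have "\<dots> = 1 / r * r powr (- \<delta>)"
        unfolding powr_add using r by (simp add: powr_minus_divide)
      also have "\<dots> \<le> 1 / r * weight \<delta> r ?K (t, x)"
        using r by (intro mult_left_mono w2[OF r K]) auto
      finally have "\<bar>?K powr (- 2 * \<tau>) * dyadic_comb q s \<tau> g N (x /\<^sub>R ?K)\<bar>
          \<le> (1 / r * weight \<delta> r ?K (t, x)) * (C' * jap q (x /\<^sub>R ?K))"
        unfolding abs_mult Kp using r C' order_trans[OF powr_ge_zero w2[OF r K]] by (intro mult_mono) auto
      then show "\<bar>?K powr (- 2 * \<tau>) * dyadic_comb q s \<tau> g N (x /\<^sub>R ?K)\<bar> \<le> C' / r * (weight \<delta> r ?K (t, x) * jap q (x /\<^sub>R ?K))"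
        by (simp add: mult_ac)
    qed
  qed
qed

lemma frac_lap_bump_n_bounds:
  assumes "\<sigma> > 0"
  shows "\<exists>C>0. \<forall>x::'a::euclidean_space. \<bar>frac_lap \<sigma> bump_n x\<bar> \<le> C * jap (real DIM('a) + \<sigma>) x"
    and "\<exists>L>0. \<forall>x y::'a. \<bar>frac_lap \<sigma> bump_n x - frac_lap \<sigma> bump_n y\<bar> \<le> L * norm (x - y)"
proof -
  let ?P = "(2 * pi) ^ DIM('a)"
  have P: "?P > 0" by simp
  obtain C where C: "C > 0" "\<And>x::'a. norm (frac_kernel \<sigma> x) \<le> C * jap (real DIM('a) + \<sigma>) x"
    using frac_kernel_decay[OF assms] by blast
  have "\<bar>frac_lap \<sigma> bump_n x\<bar> \<le> C / ?P * jap (real DIM('a) + \<sigma>) x" for x :: 'a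
    using order_trans[OF abs_Re_le_cmod C(2)[of x]] P
    by (simp add: frac_lap_bump_n abs_divide divide_right_mono)
  then show "\<exists>C>0. \<forall>x::'a. \<bar>frac_lap \<sigma> bump_n x\<bar> \<le> C * jap (real DIM('a) + \<sigma>) x"
    using C P by (intro exI[of _ "C / ?P"]) auto
  obtain L where L: "L > 0" "\<And>x y::'a. norm (frac_kernel \<sigma> x - frac_kernel \<sigma> y) \<le> L * norm (x - y)"
    using frac_kernel_lipschitz[OF assms] by blast
  have "\<bar>frac_lap \<sigma> bump_n x - frac_lap \<sigma> bump_n y\<bar> \<le> L / ?P * norm (x - y)" for x y :: 'a
  proof -
    have "frac_lap \<sigma> bump_n x - frac_lap \<sigma> bump_n y = Re (frac_kernel \<sigma> x - frac_kernel \<sigma> y) / ?P"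
      by (simp add: frac_lap_bump_n diff_divide_distrib)
    then show ?thesis
      using order_trans[OF abs_Re_le_cmod L(2)[of x y]] P
      by (simp add: abs_divide divide_right_mono)
  qed
  then show "\<exists>L>0. \<forall>x y::'a. \<bar>frac_lap \<sigma> bump_n x - frac_lap \<sigma> bump_n y\<bar> \<le> L * norm (x - y)"
    using L P by (intro exI[of _ "L / ?P"]) auto
qed

definition residual :: "real \<Rightarrow> real \<Rightarrow> real \<Rightarrow> (real \<times> 'a::euclidean_space \<Rightarrow> real) \<Rightarrow> real \<times> 'a \<Rightarrow> real" where
  "residual a b \<sigma> \<phi> z = dtt \<phi> z - dt \<phi> z - a * lap_x \<phi> z + b * frac_lap \<sigma> (\<lambda>y. \<phi> (fst z, y)) (snd z)"

text \<open>\<open>\<delta>\<close> measures the surplus order of the non-principal operator and is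
  capped at 1 because the second time derivative has size \<open>r^(-2)\<close>. The power
  \<open>1/p\<close> of the cutoff comes from \<open>bump_derivative_bounds\<close>; the
  undifferentiated cutoff, being at most 1, lies below it.\<close>

lemma residual_bound:
  fixes a b \<sigma> p :: real
  assumes "a > 0" "b > 0" "\<sigma> > 0" "\<sigma> \<noteq> 1" "p > 1"
  defines "s \<equiv> min 1 \<sigma>"
  defines "q \<equiv> real DIM('a) + \<sigma>"
  defines "\<delta> \<equiv> min 1 (max 1 \<sigma> / s - 1)"
  shows "\<exists>C>0. \<forall>N r t. \<forall>x::'a::euclidean_space. r \<ge> 1 \<longrightarrow> t \<ge> 0 \<longrightarrow>
    \<bar>residual a b \<sigma> (test_phi r (r powr (1 / (2 * s))) q s N) (t, x)\<bar> \<le>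
      C / r * (bump 0 (t / r) powr (1 / p) * (weight \<delta> r (r powr (1 / (2 * s))) (t, x) * jap q (x /\<^sub>R r powr (1 / (2 * s)))))"
proof -
  have n: "real DIM('a) \<ge> 1" by (simp add: Suc_le_eq)
  have s: "s > 0" "s \<le> 1" "s \<le> \<sigma>" using assms by (auto simp: s_def)
  have q: "q \<ge> 1" "q \<ge> 0" unfolding q_def using n assms(3) by linarith+
  have \<delta>: "\<delta> \<le> 1" by (simp add: \<delta>_def)
  have \<tau>1: "1 = s \<or> 1 > (0::real) \<and> 1 / s \<ge> 1 + \<delta>" and \<tau>2: "\<sigma> = s \<or> \<sigma> > 0 \<and> \<sigma> / s \<ge> 1 + \<delta>"
    using assms by (auto simp: s_def \<delta>_def min_def max_def)
  obtain Cl where Cl: "Cl > 0" "\<And>x::'a. \<bar>lap_bump_n x\<bar> \<le> Cl * jap q x"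
    using lap_bump_n_decay[OF q(2)] by blast
  obtain Ll where Ll: "Ll > 0" "\<And>x y::'a. \<bar>lap_bump_n x - lap_bump_n y\<bar> \<le> Ll * norm (x - y)"
    using lap_bump_n_lipschitz by blast
  obtain Cf where Cf: "Cf > 0" "\<And>x::'a. \<bar>frac_lap \<sigma> bump_n x\<bar> \<le> Cf * jap q x"
    using frac_lap_bump_n_bounds(1)[OF assms(3), where 'a = 'a] unfolding q_def by blast
  obtain Lf where Lf: "Lf > 0" "\<And>x y::'a. \<bar>frac_lap \<sigma> bump_n x - frac_lap \<sigma> bump_n y\<bar> \<le> Lf * norm (x - y)"
    using frac_lap_bump_n_bounds(2)[OF assms(3)] by blast
  let ?K = "\<lambda>r. r powr (1 / (2 * s))"
  let ?w = "\<lambda>r t x. weight \<delta> r (?K r) (t, x) * jap q ((x::'a) /\<^sub>R ?K r)"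
  obtain C1 where C1: "C1 > 0" "\<And>N r t x. r \<ge> 1 \<Longrightarrow> t \<ge> 0 \<Longrightarrow>
      \<bar>?K r powr (- 2 * 1) * dyadic_comb q s 1 lap_bump_n N ((x::'a) /\<^sub>R ?K r)\<bar> \<le> C1 / r * ?w r t x"
    using operator_term_bound[OF Cl(2) Ll(2) less_imp_le[OF Cl(1)] less_imp_le[OF Ll(1)] q(2) s(1) \<tau>1] by blast
  obtain C2 where C2: "C2 > 0" "\<And>N r t x. r \<ge> 1 \<Longrightarrow> t \<ge> 0 \<Longrightarrow>
      \<bar>?K r powr (- 2 * \<sigma>) * dyadic_comb q s \<sigma> (frac_lap \<sigma> bump_n) N ((x::'a) /\<^sub>R ?K r)\<bar> \<le> C2 / r * ?w r t x"
    using operator_term_bound[OF Cf(2) Lf(2) less_imp_le[OF Cf(1)] less_imp_le[OF Lf(1)] q(2) s(1) \<tau>2] by blast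
  obtain C3 where C3: "C3 > 0" "\<And>N. \<And>y::'a. profile q s N y \<le> C3 * jap q y"
    using profile_upper_bound[OF q(1)] by blast
  have "1 / p < 1" using assms by simp
  then obtain C4 where C4: "C4 > 0" "\<And>x. \<bar>bump 1 x\<bar> \<le> C4 * \<bar>x\<bar> * bump 0 x powr (1 / p)"
    "\<And>x. \<bar>bump 2 x\<bar> \<le> C4 * bump 0 x powr (1 / p)"
    using bump_derivative_bounds by metis
  define C where "C = C4 * C3 + 2 * C4 * C3 + a * C1 + b * C2"
  have C: "C > 0" using assms C1 C2 C3 C4 by (simp add: C_def add_pos_pos)
  have "\<bar>residual a b \<sigma> (test_phi r (?K r) q s N) (t, x)\<bar> \<le> C / r * (bump 0 (t / r) powr (1 / p) * ?w r t x)"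
    if r: "r \<ge> 1" "t \<ge> 0" for N r t and x :: 'a
  proof -
    let ?J = "jap q (x /\<^sub>R ?K r)" and ?W = "weight \<delta> r (?K r) (t, x)" and ?B = "bump 0 (t / r) powr (1 / p)"
    have K: "?K r > 0" using r by simp
    have J0: "?J \<ge> 0" using jap_pos[of q "x /\<^sub>R ?K r"] by simp
    have Wt: "(t / r) / (1 + t / r) \<le> ?W" using r K by (simp add: weight_def)
    have Wr: "r powr (- \<delta>) \<le> ?W" using r K by (simp add: weight_def)
    have W0: "?W \<ge> 0" using Wr powr_ge_zero order_trans by blast
    have B0: "?B \<ge> 0" by simp
    have P: "\<bar>profile q s N (x /\<^sub>R ?K r)\<bar> \<le> C3 * ?J"
      using C3(2) profile_nonneg[of s q N "x /\<^sub>R ?K r"] s by simp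
    have 1: "\<bar>bump 2 (t / r) / r\<^sup>2 * profile q s N (x /\<^sub>R ?K r)\<bar> \<le> (C4 * C3) * (1 / r * (?B * (?W * ?J)))"
    proof -
      have "1 / r = r powr (- 1)" using r by (simp add: powr_minus_divide)
      also have "\<dots> \<le> r powr (- \<delta>)" using r \<delta> by (intro powr_mono) auto
      also note Wr
      finally have "1 / r \<le> ?W" .
      then have "1 / r * (1 / r) \<le> 1 / r * ?W"
        by (rule mult_left_mono) (use r in simp)
      moreover have "1 / r * (1 / r) = 1 / r\<^sup>2"
        by (simp add: power2_eq_square)
      ultimately have rr: "1 / r\<^sup>2 \<le> 1 / r * ?W" by (simp only:)
      have "\<bar>bump 2 (t / r) / r\<^sup>2 * profile q s N (x /\<^sub>R ?K r)\<bar> =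
          1 / r\<^sup>2 * \<bar>bump 2 (t / r)\<bar> * \<bar>profile q s N (x /\<^sub>R ?K r)\<bar>"
        by (simp add: abs_mult)
      also have "\<dots> \<le> (1 / r * ?W) * (C4 * ?B) * (C3 * ?J)"
        using C4 C3 B0 W0 J0 r by (intro mult_mono rr P) auto
      finally show ?thesis by (simp add: mult_ac)
    qed
    have 2: "\<bar>bump 1 (t / r) / r * profile q s N (x /\<^sub>R ?K r)\<bar> \<le> (2 * C4 * C3) * (1 / r * (?B * (?W * ?J)))"
    proof -
      have "\<bar>bump 1 (t / r)\<bar> \<le> 2 * C4 * ?W * ?B"
      proof (cases "t / r \<ge> 1")
        case True
        then have "bump 1 (t / r) = 0" by (intro bump_eq_0) (rule order_trans[OF _ abs_ge_self])
        then show ?thesis using C4(1) W0 by simp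
      next
        case False
        \<comment> \<open>The derivative of the cutoff vanishes linearly at 0, and for
          \<open>t < r\<close> the factor \<open>t/r\<close> is at most twice the time part of
          \<open>weight\<close>.\<close>
        have "\<bar>t / r\<bar> \<le> 2 * ((t / r) / (1 + t / r))"
        proof -
          have "y \<le> 2 * (y / (1 + y))" if "0 \<le> y" "y < 1" for y :: real
            using that mult_left_mono[of y 1 y] by (simp add: field_simps)
          from this[of "t / r"] show ?thesis using False r by simp
        qed
        also have "\<dots> \<le> 2 * ?W" using Wt by simp
        finally have "C4 * \<bar>t / r\<bar> * ?B \<le> C4 * (2 * ?W) * ?B"
          using C4 by (intro mult_right_mono mult_left_mono) auto
        with C4(2)[of "t / r"] show ?thesis by simp
      qed
      then have "1 / r * \<bar>bump 1 (t / r)\<bar> * \<bar>profile q s N (x /\<^sub>R ?K r)\<bar> \<le> 1 / r * (2 * C4 * ?W * ?B) * (C3 * ?J)"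
        using C4 C3 B0 W0 J0 r by (intro mult_mono P) auto
      then show ?thesis using r by (simp add: abs_mult mult_ac)
    qed
    have B: "\<bar>bump 0 (t / r)\<bar> \<le> ?B"
    proof (cases "bump 0 (t / r) = 0")
      case False
      then have "0 < bump 0 (t / r)" using bump_0_nonneg[of "t / r"] by simp
      then show ?thesis
        using powr_mono'[of "1 / p" 1 "bump 0 (t / r)"] bump_0_le_1[of "t / r"] assms(5) by simp
    qed simp
    have 3: "\<bar>a * (bump 0 (t / r) * (?K r powr (- 2 * 1) * dyadic_comb q s 1 lap_bump_n N (x /\<^sub>R ?K r)))\<bar>
        \<le> (a * C1) * (1 / r * (?B * (?W * ?J)))"
    proof -
      have "\<bar>a * (bump 0 (t / r) * (?K r powr (- 2 * 1) * dyadic_comb q s 1 lap_bump_n N (x /\<^sub>R ?K r)))\<bar> =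
        a * (\<bar>bump 0 (t / r)\<bar> * \<bar>?K r powr (- 2 * 1) * dyadic_comb q s 1 lap_bump_n N (x /\<^sub>R ?K r)\<bar>)"
        using assms(1) by (simp only: abs_mult abs_of_pos)
      also have "\<dots> \<le> a * (?B * (C1 / r * (?W * ?J)))"
        using assms(1) B0 by (intro mult_left_mono mult_mono B C1(2)[OF r]) auto
      finally show ?thesis by (simp add: mult_ac)
    qed
    have 4: "\<bar>b * (bump 0 (t / r) * (?K r powr (- 2 * \<sigma>) * dyadic_comb q s \<sigma> (frac_lap \<sigma> bump_n) N (x /\<^sub>R ?K r)))\<bar>
        \<le> (b * C2) * (1 / r * (?B * (?W * ?J)))"
    proof -
      have "\<bar>b * (bump 0 (t / r) * (?K r powr (- 2 * \<sigma>) * dyadic_comb q s \<sigma> (frac_lap \<sigma> bump_n) N (x /\<^sub>R ?K r)))\<bar> =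
        b * (\<bar>bump 0 (t / r)\<bar> * \<bar>?K r powr (- 2 * \<sigma>) * dyadic_comb q s \<sigma> (frac_lap \<sigma> bump_n) N (x /\<^sub>R ?K r)\<bar>)"
        using assms(2) by (simp only: abs_mult abs_of_pos)
      also have "\<dots> \<le> b * (?B * (C2 / r * (?W * ?J)))"
        using assms(2) B0 by (intro mult_left_mono mult_mono B C2(2)[OF r]) auto
      finally show ?thesis by (simp add: mult_ac)
    qed
    have tri: "\<bar>A - B - D + E\<bar> \<le> A' + B' + D' + E'"
      if "\<bar>A\<bar> \<le> A'" "\<bar>B\<bar> \<le> B'" "\<bar>D\<bar> \<le> D'" "\<bar>E\<bar> \<le> E'" for A B D E A' B' D' E' :: real
      using that by linarith
    have "\<bar>residual a b \<sigma> (test_phi r (?K r) q s N) (t, x)\<bar> \<le>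
      (C4 * C3) * (1 / r * (?B * (?W * ?J))) + (2 * C4 * C3) * (1 / r * (?B * (?W * ?J)))
      + (a * C1) * (1 / r * (?B * (?W * ?J))) + (b * C2) * (1 / r * (?B * (?W * ?J)))"
      unfolding residual_def dtt_test_phi[OF K] dt_test_phi[OF K] lap_x_test_phi[OF K] frac_lap_test_phi[OF K assms(3)] fst_conv snd_conv
      by (rule tri[OF 1 2 3 4])
    also have "\<dots> = C * (1 / r * (?B * (?W * ?J)))"
      unfolding C_def by (simp only: distrib_right)
    finally show ?thesis by simp
  qed
  then show ?thesis using C by blast
qed

section \<open>Integral estimates for weak solutions\<close>

text \<open>Continuity into L2 bounds the norm near each time by the norm at that time; finitely
  many such neighbourhoods cover \<open>[0, r]\<close>. A sum over the cover replaces a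
  maximum.\<close>

lemma weak_sol_L2_bounded:
  fixes u :: "real \<Rightarrow> 'a::euclidean_space \<Rightarrow> real"
  assumes ws: "weak_sol a b \<sigma> p \<epsilon> u0 u1 T u" and r: "ereal r < T"
  shows "\<exists>M\<ge>0. \<forall>t\<in>{0..r}. (LINT x|lborel. (u t x)\<^sup>2) \<le> M"
proof -
  let ?N = "\<lambda>t. LINT x|lborel. (u t x)\<^sup>2"
  have m: "u t \<in> borel_measurable lborel" and i: "integrable lborel (\<lambda>x. (u t x)\<^sup>2)" if "t \<in> time_int T" for t
    using ws that by (auto simp: weak_sol_def)
  have lim: "((\<lambda>s. LINT x|lborel. (u s x - u t x)\<^sup>2) \<longlongrightarrow> 0) (at t within time_int T)" if "t \<in> time_int T" for t
    using ws that by (auto simp: weak_sol_def)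
  have sub: "{0..r} \<subseteq> time_int T"
    using r by (auto simp: time_int_def intro: le_less_trans[of _ "ereal r"])
  have tri: "?N s \<le> 2 * (LINT x|lborel. (u s x - u t x)\<^sup>2) + 2 * ?N t" if s: "s \<in> time_int T" and t: "t \<in> time_int T" for s t
  proof -
    have pt: "(x::real)\<^sup>2 \<le> 2 * (x - y)\<^sup>2 + 2 * y\<^sup>2" and pt2: "(x - y)\<^sup>2 \<le> 2 * x\<^sup>2 + 2 * y\<^sup>2" for x y
      using zero_le_power2[of "x - 2 * y"] zero_le_power2[of "x + y"] by (simp_all add: power2_eq_square algebra_simps)
    have d: "integrable lborel (\<lambda>x. (u s x - u t x)\<^sup>2)"
    proof (rule Bochner_Integration.integrable_bound)
      show "integrable lborel (\<lambda>x. 2 * (u s x)\<^sup>2 + 2 * (u t x)\<^sup>2)"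
        using i[OF s] i[OF t] by auto
      show "(\<lambda>x. (u s x - u t x)\<^sup>2) \<in> borel_measurable lborel"
        using m[OF s] m[OF t] by measurable
    qed (use pt2 in auto)
    have "?N s \<le> (LINT x|lborel. 2 * (u s x - u t x)\<^sup>2 + 2 * (u t x)\<^sup>2)"
      using i[OF s] i[OF t] d pt by (intro integral_mono) auto
    then show ?thesis using i[OF t] d by simp
  qed
  have "\<exists>e>0. \<forall>s\<in>time_int T. dist s t < e \<longrightarrow> ?N s \<le> 2 + 2 * ?N t" if t: "t \<in> {0..r}" for t
  proof -
    have tT: "t \<in> time_int T" using t sub by blast
    from tendstoD[OF lim[OF tT], of 1] obtain e where e: "e > 0"
      "\<And>s. s \<in> time_int T \<Longrightarrow> s \<noteq> t \<Longrightarrow> dist s t < e \<Longrightarrow> dist (LINT x|lborel. (u s x - u t x)\<^sup>2) 0 < 1"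
      unfolding eventually_at by auto
    have "?N s \<le> 2 + 2 * ?N t" if "s \<in> time_int T" "dist s t < e" for s
    proof (cases "s = t")
      case False
      then have "(LINT x|lborel. (u s x - u t x)\<^sup>2) < 1" using e(2)[OF that(1) False that(2)] by (simp add: abs_less_iff)
      then show ?thesis using tri[OF that(1) tT] by linarith
    next
      case True
      have "?N t \<ge> 0" by (intro integral_nonneg_AE) auto
      then show ?thesis using True by simp
    qed
    then show ?thesis using e(1) by blast
  qed
  then obtain e where e: "\<And>t. t \<in> {0..r} \<Longrightarrow> e t > 0"
    "\<And>t s. t \<in> {0..r} \<Longrightarrow> s \<in> time_int T \<Longrightarrow> dist s t < e t \<Longrightarrow> ?N s \<le> 2 + 2 * ?N t" by metis
  have cover: "{0..r} \<subseteq> (\<Union>t\<in>{0..r}. ball t (e t))" using e(1) by force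
  obtain F where F: "F \<subseteq> {0..r}" "finite F" "{0..r} \<subseteq> (\<Union>t\<in>F. ball t (e t))"
    using compactE_image[OF compact_Icc _ cover] by blast
  have Np: "?N t \<ge> 0" for t by (intro integral_nonneg_AE) auto
  have "?N s \<le> (\<Sum>t\<in>F. 2 + 2 * ?N t)" if s: "s \<in> {0..r}" for s
  proof -
    obtain t where t: "t \<in> F" "dist t s < e t" using F(3) s by auto
    have "?N s \<le> 2 + 2 * ?N t" by (rule e(2)) (use t F s sub in \<open>auto simp: dist_commute\<close>)
    also have "\<dots> \<le> (\<Sum>t\<in>F. 2 + 2 * ?N t)" using F t Np by (intro member_le_sum) auto
    finally show ?thesis .
  qed
  moreover have "(\<Sum>t\<in>F. 2 + 2 * ?N t) \<ge> 0" using Np by (intro sum_nonneg) auto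
  ultimately show ?thesis by blast
qed

lemma nn_integral_jap_scale:
  assumes "q > real DIM('a)" "K > 0"
  shows "(\<integral>\<^sup>+x. ennreal (jap q ((x::'a::euclidean_space) /\<^sub>R K)) \<partial>lborel) = ennreal (K ^ DIM('a) * (LINT x|lborel. jap q (x::'a)))"
proof -
  have "(\<integral>\<^sup>+x. ennreal (jap q ((x::'a) /\<^sub>R K)) \<partial>lborel) = ennreal (LINT x|lborel. jap q ((x::'a) /\<^sub>R K))"
    by (intro nn_integral_eq_integral lborel_integrable_scale integrable_jap assms AE_I2 less_imp_le jap_pos)
  also have "(LINT x|lborel. jap q ((x::'a) /\<^sub>R K)) = K ^ DIM('a) * (LINT x|lborel. jap q (x::'a))"
    using lborel_integral_scale[OF assms(2), of "jap q :: 'a \<Rightarrow> real"] by simp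
  finally show ?thesis .
qed

lemma weight_bounds:
  assumes "r \<ge> 1" "K > 0" "\<delta> \<ge> 0" "fst z \<ge> 0"
  shows "0 \<le> weight \<delta> r K z" "weight \<delta> r K z \<le> 3"
proof -
  have y: "0 \<le> y / (1 + y)" "y / (1 + y) \<le> 1" if "y \<ge> 0" for y :: real
    using that by (auto simp: divide_le_eq)
  have "r powr (- \<delta>) \<le> 1" using powr_mono[of "- \<delta>" 0 r] assms by simp
  then show "0 \<le> weight \<delta> r K z" "weight \<delta> r K z \<le> 3"
    using y[of "fst z / r"] y[of "norm (snd z) / K"] assms unfolding weight_def by (auto intro!: add_nonneg_nonneg)
qed

text \<open>Taking values in \<open>ennreal\<close> presupposes no integrability; finiteness is
  deduced later from that of \<open>W_int\<close>. The weight is \<open>jap\<close> and not the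
  profile, so the quantity does not depend on the truncation.\<close>

definition X_int :: "ereal \<Rightarrow> (real \<Rightarrow> 'a::euclidean_space \<Rightarrow> real) \<Rightarrow> real \<Rightarrow> real \<Rightarrow> real \<Rightarrow> real \<Rightarrow> ennreal" where
  "X_int T u p q r K = (\<integral>\<^sup>+z. ennreal (indicator (time_int T \<times> UNIV) z *
     (\<bar>u (fst z) (snd z)\<bar> powr p * (bump 0 (fst z / r) * jap q (snd z /\<^sub>R K)))) \<partial>lborel)"

definition Z_int :: "ereal \<Rightarrow> (real \<Rightarrow> 'a::euclidean_space \<Rightarrow> real) \<Rightarrow> real \<Rightarrow> real \<Rightarrow> real \<Rightarrow> real \<Rightarrow> real \<Rightarrow> ennreal" where
  "Z_int T u p q \<delta> r K = (\<integral>\<^sup>+z. ennreal (indicator (time_int T \<times> UNIV) z *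
     (\<bar>u (fst z) (snd z)\<bar> powr p * (bump 0 (fst z / r) * (weight \<delta> r K z * jap q (snd z /\<^sub>R K))))) \<partial>lborel)"

text \<open>Controls the right-hand side of the tested equation. The first power of
  \<open>|u|\<close> is paired with the \<open>1/p\<close>-th power of the cutoff so that Young's
  inequality leads back to the integrand of \<open>Z_int\<close>.\<close>

definition W_int :: "ereal \<Rightarrow> (real \<Rightarrow> 'a::euclidean_space \<Rightarrow> real) \<Rightarrow> real \<Rightarrow> real \<Rightarrow> real \<Rightarrow> real \<Rightarrow> real \<Rightarrow> ennreal" where
  "W_int T u p q \<delta> r K = (\<integral>\<^sup>+z. ennreal (indicator (time_int T \<times> UNIV) z *
     (\<bar>u (fst z) (snd z)\<bar> * (bump 0 (fst z / r) powr (1 / p) * (weight \<delta> r K z * jap q (snd z /\<^sub>R K))))) \<partial>lborel)"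

lemma weak_sol_measurable:
  fixes u :: "real \<Rightarrow> 'a::euclidean_space \<Rightarrow> real"
  assumes ws: "weak_sol a b \<sigma> p \<epsilon> u0 u1 T u"
  shows "(\<lambda>z. indicator (time_int T \<times> UNIV) z * u (fst z) (snd z)) \<in> borel_measurable borel"
proof -
  have "set_borel_measurable lborel (time_int T \<times> UNIV) (\<lambda>(t, x). u t x)"
    using ws by (auto simp: weak_sol_def)
  then show ?thesis by (simp add: set_borel_measurable_def case_prod_beta)
qed

text \<open>Measurability of the solution is known only after restriction to the time interval, so
  the indicator is moved inside the absolute value and the power.\<close>

lemma measurable_indicator_mult_abs:
  fixes v :: "'b::euclidean_space \<Rightarrow> real"
  assumes [measurable]: "(\<lambda>z. indicator A z * v z) \<in> borel_measurable borel" "f \<in> borel_measurable borel"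
    and "p > 0"
  shows "(\<lambda>z. indicator A z * (\<bar>v z\<bar> powr p * f z)) \<in> borel_measurable borel"
    and "(\<lambda>z. indicator A z * (\<bar>v z\<bar> * f z)) \<in> borel_measurable borel"
proof -
  have "(\<lambda>z. \<bar>indicator A z * v z\<bar> powr p * f z) \<in> borel_measurable borel" by measurable
  also have "(\<lambda>z. \<bar>indicator A z * v z\<bar> powr p * f z) = (\<lambda>z. indicator A z * (\<bar>v z\<bar> powr p * f z))"
    using assms(3) by (auto simp: fun_eq_iff split: split_indicator)
  finally show "(\<lambda>z. indicator A z * (\<bar>v z\<bar> powr p * f z)) \<in> borel_measurable borel" .
  have "(\<lambda>z. \<bar>indicator A z * v z\<bar> * f z) \<in> borel_measurable borel" by measurable
  also have "(\<lambda>z. \<bar>indicator A z * v z\<bar> * f z) = (\<lambda>z. indicator A z * (\<bar>v z\<bar> * f z))"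
    by (auto simp: fun_eq_iff split: split_indicator)
  finally show "(\<lambda>z. indicator A z * (\<bar>v z\<bar> * f z)) \<in> borel_measurable borel" .
qed

lemma nn_integral_strip:
  fixes f :: "real \<times> 'a::euclidean_space \<Rightarrow> ennreal"
  assumes [measurable]: "f \<in> borel_measurable borel"
  shows "(\<integral>\<^sup>+z. f z \<partial>lborel) = (\<integral>\<^sup>+t. (\<integral>\<^sup>+x. f (t, x) \<partial>lborel) \<partial>lborel)"
proof -
  have "f \<in> borel_measurable (lborel \<Otimes>\<^sub>M lborel)" by (simp add: lborel_prod)
  from lborel.nn_integral_fst[OF this] show ?thesis by (simp add: lborel_prod)
qed

text \<open>\<open>|u| J \<le> u^2 + J^2\<close> and \<open>J^2 \<le> J\<close>: the first term is
  controlled by the L2 bound on \<open>[0, r]\<close>, the second is integrable because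
  \<open>q > n\<close>. This allows the passage from \<open>ennreal\<close> to real numbers.\<close>

lemma W_int_finite:
  fixes u :: "real \<Rightarrow> 'a::euclidean_space \<Rightarrow> real"
  assumes ws: "weak_sol a b \<sigma> p \<epsilon> u0 u1 T u" and r: "ereal r < T" "r \<ge> 1" "K > 0"
    and q: "q > real DIM('a)" "\<delta> \<ge> 0" "p > 1"
  shows "W_int T u p q \<delta> r K < \<infinity>"
proof -
  let ?A = "time_int T \<times> (UNIV :: 'a set)"
  obtain M where M: "M \<ge> 0" "\<And>t. t \<in> {0..r} \<Longrightarrow> (LINT x|lborel. (u t x)\<^sup>2) \<le> M"
    using weak_sol_L2_bounded[OF ws r(1)] by blast
  define D where "D = K ^ DIM('a) * (LINT x|lborel. jap q (x::'a))"
  have sub: "{0..r} \<subseteq> time_int T"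
    using r by (auto simp: time_int_def intro: le_less_trans[of _ "ereal r"])
  let ?h = "\<lambda>z::real \<times> 'a. indicator {0..r} (fst z) * (3 * ((indicator ?A z * u (fst z) (snd z))\<^sup>2 + jap q (snd z /\<^sub>R K)))"
  have "W_int T u p q \<delta> r K \<le> (\<integral>\<^sup>+z. ennreal (?h z) \<partial>lborel)"
    unfolding W_int_def
  proof (intro nn_integral_mono ennreal_leI)
    fix z :: "real \<times> 'a"
    let ?u = "\<bar>u (fst z) (snd z)\<bar>" and ?J = "jap q (snd z /\<^sub>R K)" and ?B = "bump 0 (fst z / r) powr (1 / p)"
    have J: "0 \<le> ?J" "?J \<le> 1" using jap_pos[of q] jap_le_1[of q] q by (auto intro: less_imp_le)
    show "indicator ?A z * (?u * (?B * (weight \<delta> r K z * ?J))) \<le> ?h z"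
    proof (cases "z \<in> ?A \<and> fst z \<le> r")
      case True
      then have t: "fst z \<ge> 0" by (auto simp: time_int_def)
      have B: "0 \<le> ?B" "?B \<le> 1" using bump_0_nonneg bump_0_le_1 q by (auto intro: powr_le1)
      have w: "0 \<le> weight \<delta> r K z" "weight \<delta> r K z \<le> 3" using weight_bounds[OF r(2,3) q(2) t] by auto
      have "?u * (?B * (weight \<delta> r K z * ?J)) \<le> ?u * (1 * (3 * ?J))"
        using B w J by (intro mult_left_mono mult_mono) auto
      also have "\<dots> = 3 * (?u * ?J)" by simp
      also have "?u * ?J \<le> ?u\<^sup>2 + ?J\<^sup>2"
        using sum_squares_bound[of ?u ?J] mult_nonneg_nonneg[of ?u ?J] J by linarith
      also have "?J\<^sup>2 \<le> ?J" using J by (simp add: power2_eq_square mult_left_le)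
      finally show ?thesis using True t by simp
    next
      case False
      have "indicator ?A z * (?u * (?B * (weight \<delta> r K z * ?J))) = 0"
      proof (cases "z \<in> ?A")
        case True
        then have "\<bar>fst z / r\<bar> \<ge> 1" using False r by auto
        then show ?thesis by (simp add: bump_eq_0)
      qed simp
      moreover have "?h z \<ge> 0" using J by simp
      ultimately show ?thesis by linarith
    qed
  qed
  also have "\<dots> = (\<integral>\<^sup>+t. (\<integral>\<^sup>+x. ennreal (?h (t, x)) \<partial>lborel) \<partial>lborel)"
  proof (rule nn_integral_strip)
    note [measurable] = weak_sol_measurable[OF ws, unfolded borel_prod[symmetric]]
    show "(\<lambda>z. ennreal (?h z)) \<in> borel_measurable borel"
      unfolding borel_prod[symmetric] by measurable
  qed
  also have "\<dots> \<le> (\<integral>\<^sup>+t. ennreal (3 * (M + D)) * indicator {0..r} t \<partial>lborel)"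
  proof (rule nn_integral_mono)
    fix t :: real
    show "(\<integral>\<^sup>+x. ennreal (?h (t, x)) \<partial>lborel) \<le> ennreal (3 * (M + D)) * indicator {0..r} t"
    proof (cases "t \<in> {0..r}")
      case True
      then have tT: "t \<in> time_int T" using sub by blast
      have m: "u t \<in> borel_measurable lborel" and i: "integrable lborel (\<lambda>x. (u t x)\<^sup>2)"
        using ws tT by (auto simp: weak_sol_def)
      have iJ: "integrable lborel (\<lambda>x::'a. jap q (x /\<^sub>R K))"
        by (intro lborel_integrable_scale integrable_jap q r)
      have "(\<integral>\<^sup>+x. ennreal (?h (t, x)) \<partial>lborel) = (\<integral>\<^sup>+x. ennreal (3 * ((u t x)\<^sup>2 + jap q (x /\<^sub>R K))) \<partial>lborel)"
        using True tT by (intro nn_integral_cong) simp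
      also have "\<dots> = ennreal (LINT x|lborel. 3 * ((u t x)\<^sup>2 + jap q (x /\<^sub>R K)))"
        using i iJ by (intro nn_integral_eq_integral AE_I2 mult_nonneg_nonneg add_nonneg_nonneg
            less_imp_le[OF jap_pos]) auto
      also have "(LINT x|lborel. 3 * ((u t x)\<^sup>2 + jap q (x /\<^sub>R K))) = 3 * ((LINT x|lborel. (u t x)\<^sup>2) + D)"
        using i iJ lborel_integral_scale[OF r(3), of "jap q :: 'a \<Rightarrow> real"] by (simp add: D_def)
      also have "ennreal \<dots> \<le> ennreal (3 * (M + D))"
        using M(2)[OF True] by (intro ennreal_leI) auto
      finally show ?thesis using True by simp
    qed simp
  qed
  also have "\<dots> < \<infinity>"
    using r by (simp add: nn_integral_cmult_indicator ennreal_mult_less_top)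
  finally show ?thesis .
qed

lemma bump_1_at_0: "bump (Suc 0) 0 = 0"
  by (simp add: bump_def)

lemma profile_measurable [measurable]: "profile q s N \<in> borel_measurable borel"
  unfolding profile_eq[abs_def] by measurable

text \<open>The initial term with the time derivative of the test function drops out because the
  cutoff has zero slope at \<open>t = 0\<close>. The other one is bounded below through
  \<open>c1\<close>, and the residual is replaced by its bound.\<close>

lemma weak_sol_tested:
  fixes u :: "real \<Rightarrow> 'a::euclidean_space \<Rightarrow> real"
  assumes ws: "weak_sol a b \<sigma> p \<epsilon> u0 u1 T u" and r: "ereal r < T" "r \<ge> 1" "K > 0"
    and p: "p > 1" and s: "s > 0" and \<epsilon>: "\<epsilon> > 0"
    and C: "C > 0" "\<And>t. \<And>x::'a. t \<ge> 0 \<Longrightarrow> \<bar>residual a b \<sigma> (test_phi r K q s N) (t, x)\<bar> \<le>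
      C / r * (bump 0 (t / r) powr (1 / p) * (weight \<delta> r K (t, x) * jap q (x /\<^sub>R K)))"
    and c1: "c1 > 0" "c1 \<le> bump 0 0 * (LINT x|lborel. (u0 x + u1 x) * profile q s N (x /\<^sub>R K))"
    and \<delta>: "\<delta> \<ge> 0"
  shows "(\<integral>\<^sup>+z. ennreal (indicator (time_int T \<times> UNIV) z *
     (\<bar>u (fst z) (snd z)\<bar> powr p * (bump 0 (fst z / r) * profile q s N (snd z /\<^sub>R K)))) \<partial>lborel) + ennreal (\<epsilon> * c1)
    \<le> ennreal (C / r) * W_int T u p q \<delta> r K"
proof -
  let ?A = "time_int T \<times> (UNIV :: 'a set)"
  let ?\<phi> = "test_phi r K q s N :: real \<times> 'a \<Rightarrow> real"
  have r0: "r > 0" using r by simp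
  have tf: "test_fun T ?\<phi>"
    unfolding test_phi_def by (intro test_fun_test_prod r r0 finite_dy_I dy_k_pos)
  have "\<exists>R. \<forall>z. ?\<phi> z \<noteq> 0 \<longrightarrow> z \<in> {-r..r} \<times> cball 0 R"
    unfolding test_phi_def by (rule test_fun_test_prod(2)[OF r0 finite_dy_I dy_k_pos[OF r(3)] r(1)])
  then obtain R where R: "\<And>z. ?\<phi> z \<noteq> 0 \<Longrightarrow> z \<in> {-r..r} \<times> cball 0 R" by blast
  have "(\<forall>\<phi>. test_fun T \<phi> \<longrightarrow>
        (LINT z:?A|lborel. \<bar>u (fst z) (snd z)\<bar> powr p * \<phi> z)
        = - \<epsilon> * (LINT x|lborel. (u0 x + u1 x) * \<phi> (0, x))
          + \<epsilon> * (LINT x|lborel. u0 x * dt \<phi> (0, x))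
          + (LINT z:?A|lborel. u (fst z) (snd z) *
               (dtt \<phi> z - dt \<phi> z - a * lap_x \<phi> z
                + b * frac_lap \<sigma> (\<lambda>y. \<phi> (fst z, y)) (snd z))))"
    using ws unfolding weak_sol_def by blast
  then have "(LINT z:?A|lborel. \<bar>u (fst z) (snd z)\<bar> powr p * ?\<phi> z)
        = - \<epsilon> * (LINT x|lborel. (u0 x + u1 x) * ?\<phi> (0, x)) + \<epsilon> * (LINT x|lborel. u0 x * dt ?\<phi> (0, x))
          + (LINT z:?A|lborel. u (fst z) (snd z) * residual a b \<sigma> ?\<phi> z)"
    unfolding residual_def using tf by blast
  moreover have "(LINT x|lborel. u0 x * dt ?\<phi> (0, x)) = 0"
    by (simp add: dt_test_phi[OF r(3)] bump_1_at_0)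
  moreover have "(LINT x|lborel. (u0 x + u1 x) * ?\<phi> (0, x)) = bump 0 0 * (LINT x|lborel. (u0 x + u1 x) * profile q s N (x /\<^sub>R K))"
  proof -
    have "(u0 x + u1 x) * ?\<phi> (0, x) = bump 0 0 * ((u0 x + u1 x) * profile q s N (x /\<^sub>R K))" for x
      by (simp add: test_phi_eq[OF r(3)])
    then show ?thesis by (simp only: integral_mult_right_zero)
  qed
  ultimately have eq: "(LINT z:?A|lborel. \<bar>u (fst z) (snd z)\<bar> powr p * ?\<phi> z)
      + \<epsilon> * (bump 0 0 * (LINT x|lborel. (u0 x + u1 x) * profile q s N (x /\<^sub>R K)))
      = (LINT z:?A|lborel. u (fst z) (snd z) * residual a b \<sigma> ?\<phi> z)" by simp
  let ?f = "\<lambda>z. indicator ?A z * (\<bar>u (fst z) (snd z)\<bar> powr p * ?\<phi> z)"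
  have \<phi>0: "?\<phi> z \<ge> 0" for z
    unfolding test_phi_eq[OF r(3)] using s by (intro mult_nonneg_nonneg bump_0_nonneg profile_nonneg) simp
  have \<phi>m [measurable]: "?\<phi> \<in> borel_measurable borel"
    unfolding test_phi_eq[OF r(3), abs_def] borel_prod[symmetric] by measurable
  have contphi: "continuous_on UNIV ?\<phi>"
    using bump_alg_derivative[OF bump_alg_test_prod, of r 0 "dy_I N" "dy_c q s" "dy_k K" "\<lambda>_::'a. 0"]
    unfolding test_phi_def by (metis continuous_at_imp_continuous_on has_derivative_continuous)
  have "compact ({-r..r} \<times> cball (0::'a) R)"
    by (intro compact_Times compact_Icc compact_cball)
  then obtain B where B: "\<And>z. z \<in> {-r..r} \<times> cball 0 R \<Longrightarrow> norm (?\<phi> z) \<le> B"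
    using compact_continuous_image[OF continuous_on_subset[OF contphi subset_UNIV]]
    by (meson compact_imp_bounded bounded_iff imageI)
  have B': "?\<phi> z \<le> max B 0" for z
    using B[of z] R[of z] \<phi>0[of z] by (cases "?\<phi> z = 0") auto
  have int: "integrable lborel ?f"
  proof -
    \<comment> \<open>For \<open>t \<ge> 0\<close> the test function lives in this compact set, and
      \<open>r < T\<close> keeps it inside the time interval, where \<open>|u|^p\<close> is locally
      integrable.\<close>
    let ?Kc = "{0..r} \<times> cball (0::'a) R"
    have "compact ?Kc" by (intro compact_Times compact_Icc compact_cball)
    moreover have "?Kc \<subseteq> ?A"
      using r by (auto simp: time_int_def intro: le_less_trans[of _ "ereal r"])
    ultimately have "set_integrable lborel ?Kc (\<lambda>(t, x). \<bar>u t x\<bar> powr p)"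
      using ws unfolding weak_sol_def by blast
    then have "integrable lborel (\<lambda>z. max B 0 * (indicator ?Kc z * \<bar>u (fst z) (snd z)\<bar> powr p))"
      unfolding set_integrable_def by (intro integrable_mult_right) (simp add: case_prod_beta)
    then show ?thesis
    proof (rule Bochner_Integration.integrable_bound)
      show "?f \<in> borel_measurable lborel"
        using measurable_indicator_mult_abs(1)[OF weak_sol_measurable[OF ws] \<phi>m] p by simp
      show "AE z in lborel. norm (?f z) \<le> norm (max B 0 * (indicator ?Kc z * \<bar>u (fst z) (snd z)\<bar> powr p))"
      proof (rule AE_I2)
        fix z :: "real \<times> 'a"
        show "norm (?f z) \<le> norm (max B 0 * (indicator ?Kc z * \<bar>u (fst z) (snd z)\<bar> powr p))"
        proof (cases "z \<in> ?A \<and> ?\<phi> z \<noteq> 0")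
          case True
          then have "fst z \<ge> 0" by (auto simp: time_int_def)
          moreover have "z \<in> {-r..r} \<times> cball 0 R" using R True by blast
          ultimately have "z \<in> ?Kc" by (cases z) auto
          then show ?thesis using True B'[of z] \<phi>0[of z]
            by (simp add: abs_mult mult.commute mult_right_mono)
        qed auto
      qed
    qed
  qed
  have "(\<integral>\<^sup>+z. ennreal (indicator ?A z *
     (\<bar>u (fst z) (snd z)\<bar> powr p * (bump 0 (fst z / r) * profile q s N (snd z /\<^sub>R K)))) \<partial>lborel)
     = (\<integral>\<^sup>+z. ennreal (?f z) \<partial>lborel)"
    by (simp add: test_phi_eq[OF r(3)])
  also have "\<dots> = ennreal (LINT z|lborel. ?f z)"
    using \<phi>0 by (intro nn_integral_eq_integral int AE_I2) auto
  finally have X: "(\<integral>\<^sup>+z. ennreal (indicator ?A z *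
     (\<bar>u (fst z) (snd z)\<bar> powr p * (bump 0 (fst z / r) * profile q s N (snd z /\<^sub>R K)))) \<partial>lborel)
     = ennreal (LINT z|lborel. ?f z)" .
  have X0: "(LINT z|lborel. ?f z) \<ge> 0" using \<phi>0 by (intro integral_nonneg_AE AE_I2) auto
  have feq: "(LINT z:?A|lborel. \<bar>u (fst z) (snd z)\<bar> powr p * ?\<phi> z) = (LINT z|lborel. ?f z)"
    by (simp add: set_lebesgue_integral_def)
  have "ennreal (LINT z|lborel. ?f z) + ennreal (\<epsilon> * c1) = ennreal ((LINT z|lborel. ?f z) + \<epsilon> * c1)"
    using X0 \<epsilon> c1 by (intro ennreal_plus[symmetric]) auto
  also have "\<dots> \<le> ennreal (LINT z:?A|lborel. u (fst z) (snd z) * residual a b \<sigma> ?\<phi> z)"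
    unfolding eq[symmetric] feq using c1 \<epsilon> by (intro ennreal_leI add_left_mono mult_left_mono) auto
  also have "\<dots> \<le> (\<integral>\<^sup>+z. ennreal (norm (indicator ?A z *\<^sub>R (u (fst z) (snd z) * residual a b \<sigma> ?\<phi> z))) \<partial>lborel)"
    unfolding set_lebesgue_integral_def
  proof (cases "integrable lborel (\<lambda>z. indicator ?A z *\<^sub>R (u (fst z) (snd z) * residual a b \<sigma> ?\<phi> z))")
    case True
    show "ennreal (LINT z|lborel. indicator ?A z *\<^sub>R (u (fst z) (snd z) * residual a b \<sigma> ?\<phi> z)) \<le>
      (\<integral>\<^sup>+z. ennreal (norm (indicator ?A z *\<^sub>R (u (fst z) (snd z) * residual a b \<sigma> ?\<phi> z))) \<partial>lborel)"
      by (rule order_trans[OF ennreal_leI integral_norm_bound_ennreal[OF True]]) simp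
  next
    \<comment> \<open>Without integrability the integral on the left is 0 by convention and the
      bound is trivial.\<close>
    case False
    show "ennreal (LINT z|lborel. indicator ?A z *\<^sub>R (u (fst z) (snd z) * residual a b \<sigma> ?\<phi> z)) \<le>
      (\<integral>\<^sup>+z. ennreal (norm (indicator ?A z *\<^sub>R (u (fst z) (snd z) * residual a b \<sigma> ?\<phi> z))) \<partial>lborel)"
      unfolding not_integrable_integral_eq[OF False] by simp
  qed
  also have "\<dots> \<le> (\<integral>\<^sup>+z. ennreal (C / r) * ennreal (indicator ?A z *
     (\<bar>u (fst z) (snd z)\<bar> * (bump 0 (fst z / r) powr (1 / p) * (weight \<delta> r K z * jap q (snd z /\<^sub>R K))))) \<partial>lborel)"
  proof (rule nn_integral_mono)
    fix z :: "real \<times> 'a"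
    let ?g = "bump 0 (fst z / r) powr (1 / p) * (weight \<delta> r K z * jap q (snd z /\<^sub>R K))"
    show "ennreal (norm (indicator ?A z *\<^sub>R (u (fst z) (snd z) * residual a b \<sigma> ?\<phi> z))) \<le>
      ennreal (C / r) * ennreal (indicator ?A z * (\<bar>u (fst z) (snd z)\<bar> * ?g))"
    proof (cases "z \<in> ?A")
      case True
      then have t: "fst z \<ge> 0" by (auto simp: time_int_def)
      have "\<bar>residual a b \<sigma> ?\<phi> z\<bar> \<le> C / r * ?g" using C(2)[OF t, of "snd z"] by simp
      then have "\<bar>u (fst z) (snd z)\<bar> * \<bar>residual a b \<sigma> ?\<phi> z\<bar> \<le> \<bar>u (fst z) (snd z)\<bar> * (C / r * ?g)"
        by (rule mult_left_mono) simp
      then have "norm (indicator ?A z *\<^sub>R (u (fst z) (snd z) * residual a b \<sigma> ?\<phi> z)) \<le> C / r * (\<bar>u (fst z) (snd z)\<bar> * ?g)"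
        using True by (simp add: abs_mult mult_ac)
      then have "ennreal (norm (indicator ?A z *\<^sub>R (u (fst z) (snd z) * residual a b \<sigma> ?\<phi> z))) \<le> ennreal (C / r * (\<bar>u (fst z) (snd z)\<bar> * ?g))"
        by (rule ennreal_leI)
      also have "\<dots> = ennreal (C / r) * ennreal (\<bar>u (fst z) (snd z)\<bar> * ?g)"
        using C(1) r0 by (intro ennreal_mult') simp
      finally show ?thesis using True by simp
    qed simp
  qed
  also have "\<dots> = ennreal (C / r) * W_int T u p q \<delta> r K"
    unfolding W_int_def
  proof (rule nn_integral_cmult)
    have "(\<lambda>z::real \<times> 'a. bump 0 (fst z / r) powr (1 / p) * (weight \<delta> r K z * jap q (snd z /\<^sub>R K))) \<in> borel_measurable borel"
      unfolding weight_def[abs_def] borel_prod[symmetric] by measurable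
    from measurable_indicator_mult_abs(2)[OF weak_sol_measurable[OF ws] this, of p] p
    show "(\<lambda>z. ennreal (indicator ?A z * (\<bar>u (fst z) (snd z)\<bar> *
      (bump 0 (fst z / r) powr (1 / p) * (weight \<delta> r K z * jap q (snd z /\<^sub>R K)))))) \<in> borel_measurable lborel"
      by simp
  qed
  finally show ?thesis unfolding X .
qed

text \<open>As \<open>K\<close> grows, the dilated profile tends to its value at the origin, which
  has a positive lower bound independent of \<open>N\<close>. The error is at most the integral of
  \<open>|w| min (2C) (L |x|/K)\<close>; it does not involve \<open>N\<close> and tends to 0 by
  dominated convergence.\<close>

lemma data_lower_bound:
  fixes w :: "'a::euclidean_space \<Rightarrow> real"
  assumes w: "integrable lborel w" "(LINT x|lborel. w x) > 0" and q: "q \<ge> 1" and s: "s > 0"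
  shows "\<exists>c>0. \<exists>K0>0. \<forall>K\<ge>K0. \<forall>N\<ge>1. c \<le> bump 0 0 * (LINT x|lborel. w x * profile q s N (x /\<^sub>R K))"
proof -
  obtain L where L: "L > 0" "\<And>N. \<And>x y::'a. \<bar>profile q s N x - profile q s N y\<bar> \<le> L * norm (x - y)"
    using profile_lipschitz[OF q] by blast
  obtain C where C: "C > 0" "\<And>N. \<And>y::'a. profile q s N y \<le> C * jap q y"
    using profile_upper_bound[OF q] by blast
  have pC: "\<bar>profile q s N y\<bar> \<le> C" for N and y :: 'a
  proof -
    have "C * jap q y \<le> C * 1" using C q by (intro mult_left_mono jap_le_1) auto
    then show ?thesis using C(2)[of N y] profile_nonneg[of s q N y] s by simp
  qed
  define c0 where "c0 = (2 powr (2 * s) - 1) * bump 0 0 ^ DIM('a)"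
  have b0: "bump 0 0 > 0" by (rule bump_0_pos) simp
  have c0: "c0 > 0" unfolding c0_def using s b0 by (simp add: gr_one_powr)
  define m where "m = (LINT x|lborel. w x)"
  have m: "m > 0" using w by (simp add: m_def)
  note [measurable] = borel_measurable_integrable[OF w(1)]
  let ?e = "\<lambda>K. LINT x|lborel. \<bar>w x\<bar> * min (2 * C) (L * (norm x / K))"
  have "(?e \<longlongrightarrow> (LINT x::'a|lborel. 0)) at_top"
  proof (rule integral_dominated_convergence_at_top)
    show "integrable lborel (\<lambda>x. \<bar>w x\<bar> * (2 * C))" using w by auto
    show "AE x in lborel. ((\<lambda>K. \<bar>w x\<bar> * min (2 * C) (L * (norm x / K))) \<longlongrightarrow> 0) at_top"
    proof (rule AE_I2)
      fix x :: 'a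
      have "((\<lambda>K::real. norm x / K) \<longlongrightarrow> 0) at_top"
        by (rule tendsto_divide_0[OF tendsto_const]) (simp add: filterlim_at_top_imp_at_infinity filterlim_ident)
      then have "((\<lambda>K. \<bar>w x\<bar> * min (2 * C) (L * (norm x / K))) \<longlongrightarrow> \<bar>w x\<bar> * min (2 * C) (L * 0)) at_top"
        by (intro tendsto_intros tendsto_min)
      then show "((\<lambda>K. \<bar>w x\<bar> * min (2 * C) (L * (norm x / K))) \<longlongrightarrow> 0) at_top" using C by simp
    qed
    show "\<forall>\<^sub>F K in at_top. AE x in lborel. norm (\<bar>w x\<bar> * min (2 * C) (L * (norm x / K))) \<le> \<bar>w x\<bar> * (2 * C)"
      using eventually_gt_at_top[of 0]
    proof eventually_elim
      case (elim K)
      show ?case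
      proof (rule AE_I2)
        fix x :: 'a
        have "L * (norm x / K) \<ge> 0" using L elim by simp
        then have "\<bar>min (2 * C) (L * (norm x / K))\<bar> \<le> 2 * C" using C by (simp add: min_def)
        then show "norm (\<bar>w x\<bar> * min (2 * C) (L * (norm x / K))) \<le> \<bar>w x\<bar> * (2 * C)"
          by (simp only: real_norm_def abs_mult abs_idempotent) (rule mult_left_mono, auto)
      qed
    qed
  qed measurable
  then have "(?e \<longlongrightarrow> 0) at_top" by simp
  from order_tendstoD(2)[OF this, of "c0 * m / 2"] c0 m
  have "\<forall>\<^sub>F K in at_top. ?e K < c0 * m / 2" by simp
  then obtain K1 where K1: "\<And>K. K \<ge> K1 \<Longrightarrow> ?e K < c0 * m / 2" unfolding eventually_at_top_linorder by blast
  define K0 where "K0 = max K1 1"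
  have "bump 0 0 * (c0 * m / 2) \<le> bump 0 0 * (LINT x|lborel. w x * profile q s N (x /\<^sub>R K))" if K: "K \<ge> K0" and N: "N \<ge> 1" for K N
  proof -
    have K': "K > 0" "K \<ge> K1" using K by (auto simp: K0_def)
    have i1: "integrable lborel (\<lambda>x. w x * profile q s N (x /\<^sub>R K))"
    proof (rule Bochner_Integration.integrable_bound)
      show "integrable lborel (\<lambda>x. C * \<bar>w x\<bar>)" using w by auto
      show "AE x in lborel. norm (w x * profile q s N (x /\<^sub>R K)) \<le> norm (C * \<bar>w x\<bar>)"
      proof (rule AE_I2)
        fix x
        have "\<bar>w x\<bar> * \<bar>profile q s N (x /\<^sub>R K)\<bar> \<le> \<bar>w x\<bar> * C"
          by (intro mult_left_mono pC) simp
        then show "norm (w x * profile q s N (x /\<^sub>R K)) \<le> norm (C * \<bar>w x\<bar>)"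
          using C(1) by (simp add: abs_mult mult.commute)
      qed
    qed measurable
    have i2: "integrable lborel (\<lambda>x. \<bar>w x\<bar> * min (2 * C) (L * (norm x / K)))"
    proof (rule Bochner_Integration.integrable_bound)
      show "integrable lborel (\<lambda>x. (2 * C) * \<bar>w x\<bar>)" using w by auto
      show "AE x in lborel. norm (\<bar>w x\<bar> * min (2 * C) (L * (norm x / K))) \<le> norm ((2 * C) * \<bar>w x\<bar>)"
      proof (rule AE_I2)
        fix x :: 'a
        have "L * (norm x / K) \<ge> 0" using L K' by simp
        then have "\<bar>min (2 * C) (L * (norm x / K))\<bar> \<le> 2 * C" using C by (simp add: min_def)
        then show "norm (\<bar>w x\<bar> * min (2 * C) (L * (norm x / K))) \<le> norm ((2 * C) * \<bar>w x\<bar>)"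
          using C by (simp only: real_norm_def abs_mult abs_idempotent) (simp add: mult.commute mult_left_mono)
      qed
    qed measurable
    have "c0 * m \<le> profile q s N (0::'a) * m"
      unfolding c0_def using m by (intro mult_right_mono profile_0_ge s N) auto
    also have "\<dots> = (LINT x|lborel. w x * profile q s N (0::'a))"
      by (simp add: m_def mult.commute)
    also have "\<dots> \<le> (LINT x|lborel. w x * profile q s N (x /\<^sub>R K) + \<bar>w x\<bar> * min (2 * C) (L * (norm x / K)))"
    proof (rule integral_mono)
      show "integrable lborel (\<lambda>x. w x * profile q s N (0::'a))" using w by auto
      show "integrable lborel (\<lambda>x. w x * profile q s N (x /\<^sub>R K) + \<bar>w x\<bar> * min (2 * C) (L * (norm x / K)))"
        using i1 i2 by auto
      fix x :: 'a
      have "\<bar>profile q s N (0::'a) - profile q s N (x /\<^sub>R K)\<bar> \<le> min (2 * C) (L * (norm x / K))"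
        using L(2)[of N 0 "x /\<^sub>R K"] pC[of N 0] pC[of N "x /\<^sub>R K"] K'
        by (simp add: divide_inverse mult.commute)
      then have "\<bar>w x\<bar> * \<bar>profile q s N (0::'a) - profile q s N (x /\<^sub>R K)\<bar> \<le> \<bar>w x\<bar> * min (2 * C) (L * (norm x / K))"
        by (rule mult_left_mono) simp
      moreover have "w x * (profile q s N (0::'a) - profile q s N (x /\<^sub>R K)) \<le> \<bar>w x\<bar> * \<bar>profile q s N (0::'a) - profile q s N (x /\<^sub>R K)\<bar>"
        unfolding abs_mult[symmetric] by (rule abs_ge_self)
      ultimately show "w x * profile q s N (0::'a) \<le> w x * profile q s N (x /\<^sub>R K) + \<bar>w x\<bar> * min (2 * C) (L * (norm x / K))"
        unfolding right_diff_distrib by linarith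
    qed
    also have "\<dots> = (LINT x|lborel. w x * profile q s N (x /\<^sub>R K)) + ?e K"
      using i1 i2 by simp
    finally have "c0 * m / 2 \<le> (LINT x|lborel. w x * profile q s N (x /\<^sub>R K))"
      using K1[OF K'(2)] by linarith
    then show ?thesis using b0 by (intro mult_left_mono) auto
  qed
  moreover have "bump 0 0 * (c0 * m / 2) > 0" using b0 c0 m by simp
  moreover have "K0 > 0" by (simp add: K0_def)
  ultimately show ?thesis by blast
qed

text \<open>The tested inequality has the same right-hand side for every truncation. The profile
  dominates \<open>c\<close> times \<open>jap\<close> on regions that exhaust the space as
  \<open>N\<close> grows, so monotone convergence installs the full weight.\<close>

lemma X_int_le_W_int:
  fixes u :: "real \<Rightarrow> 'a::euclidean_space \<Rightarrow> real"
  assumes ws: "weak_sol a b \<sigma> p \<epsilon> u0 u1 T u" and r: "r \<ge> 1" "K > 0" and p: "p > 1" and c: "c > 0"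
    and low: "\<And>N. \<And>y::'a. norm y \<le> 2 ^ N / 4 \<Longrightarrow> N \<ge> 1 \<Longrightarrow> c * jap q y \<le> profile q s N y"
    and tested: "\<And>N. N \<ge> 1 \<Longrightarrow> (\<integral>\<^sup>+z. ennreal (indicator (time_int T \<times> UNIV) z *
     (\<bar>u (fst z) (snd z)\<bar> powr p * (bump 0 (fst z / r) * profile q s N (snd z /\<^sub>R K)))) \<partial>lborel) + D \<le> R"
  shows "ennreal c * X_int T u p q r K + D \<le> R"
proof -
  let ?A = "time_int T \<times> (UNIV :: 'a set)"
  let ?f = "\<lambda>z. indicator ?A z * (\<bar>u (fst z) (snd z)\<bar> powr p * (bump 0 (fst z / r) * jap q (snd z /\<^sub>R K)))"
  let ?S = "\<lambda>N::nat. {z::real \<times> 'a. norm (snd z /\<^sub>R K) \<le> 2 ^ N / 4}"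
  have f0: "?f z \<ge> 0" for z
    by (intro mult_nonneg_nonneg bump_0_nonneg less_imp_le[OF jap_pos]) auto
  have fm: "?f \<in> borel_measurable borel"
  proof (rule measurable_indicator_mult_abs(1)[OF weak_sol_measurable[OF ws]])
    show "(\<lambda>z::real \<times> 'a. bump 0 (fst z / r) * jap q (snd z /\<^sub>R K)) \<in> borel_measurable borel"
      unfolding borel_prod[symmetric] by measurable
  qed (use p in simp)
  have Sm: "?S N \<in> sets borel" for N
    by (intro borel_closed closed_Collect_le continuous_intros)
  have gm: "(\<lambda>z. ennreal (?f z) * indicator (?S N) z) \<in> borel_measurable lborel" for N
    using fm Sm by measurable
  have "(\<lambda>N. \<integral>\<^sup>+z. ennreal (?f z) * indicator (?S N) z \<partial>lborel) \<longlonglongrightarrow> (\<integral>\<^sup>+z. ennreal (?f z) \<partial>lborel)"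
  proof (rule nn_integral_LIMSEQ)
    show "incseq (\<lambda>N z. ennreal (?f z) * indicator (?S N) z)"
    proof (rule incseq_SucI, rule le_funI)
      fix N and z :: "real \<times> 'a"
      have "(2::real) ^ N / 4 \<le> 2 ^ Suc N / 4" by simp
      then have "?S N \<subseteq> ?S (Suc N)" by (blast intro: order_trans)
      then show "ennreal (?f z) * indicator (?S N) z \<le> ennreal (?f z) * indicator (?S (Suc N)) z"
        by (intro mult_left_mono) (auto split: split_indicator)
    qed
    show "(\<lambda>z. ennreal (?f z) * indicator (?S N) z) \<in> borel_measurable lborel" for N
      by (rule gm)
    show "(\<lambda>N. ennreal (?f z) * indicator (?S N) z) \<longlonglongrightarrow> ennreal (?f z)" for z
    proof (rule tendsto_eventually)
      obtain N0 where N0: "4 * norm (snd z /\<^sub>R K) < 2 ^ N0"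
        using real_arch_pow[of 2] by auto
      show "\<forall>\<^sub>F N in sequentially. ennreal (?f z) * indicator (?S N) z = ennreal (?f z)"
        using eventually_ge_at_top[of N0]
      proof eventually_elim
        case (elim N)
        have "(2::real) ^ N0 \<le> 2 ^ N" using elim by (intro power_increasing) auto
        then have "norm (snd z /\<^sub>R K) \<le> 2 ^ N / 4" using N0 by linarith
        then have "z \<in> ?S N" by simp
        then show ?case by simp
      qed
    qed
  qed
  then have lim: "(\<lambda>N. ennreal c * (\<integral>\<^sup>+z. ennreal (?f z) * indicator (?S N) z \<partial>lborel) + D) \<longlonglongrightarrow> ennreal c * X_int T u p q r K + D"
    unfolding X_int_def by (intro tendsto_add tendsto_const ennreal_tendsto_cmult) auto
  show ?thesis
  proof (rule LIMSEQ_le_const2[OF lim], intro exI[of _ 1] allI impI)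
    fix N :: nat assume N: "1 \<le> N"
    have "ennreal c * (\<integral>\<^sup>+z. ennreal (?f z) * indicator (?S N) z \<partial>lborel) =
        (\<integral>\<^sup>+z. ennreal c * (ennreal (?f z) * indicator (?S N) z) \<partial>lborel)"
      by (rule nn_integral_cmult[OF gm, symmetric])
    also have "\<dots> \<le> (\<integral>\<^sup>+z. ennreal (indicator ?A z *
     (\<bar>u (fst z) (snd z)\<bar> powr p * (bump 0 (fst z / r) * profile q s N (snd z /\<^sub>R K)))) \<partial>lborel)"
    proof (rule nn_integral_mono)
      fix z :: "real \<times> 'a"
      show "ennreal c * (ennreal (?f z) * indicator (?S N) z) \<le> ennreal (indicator ?A z *
        (\<bar>u (fst z) (snd z)\<bar> powr p * (bump 0 (fst z / r) * profile q s N (snd z /\<^sub>R K))))"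
      proof (cases "z \<in> ?S N")
        case True
        have "c * ?f z = indicator ?A z * (\<bar>u (fst z) (snd z)\<bar> powr p * (bump 0 (fst z / r) * (c * jap q (snd z /\<^sub>R K))))"
          by simp
        also have "\<dots> \<le> indicator ?A z * (\<bar>u (fst z) (snd z)\<bar> powr p * (bump 0 (fst z / r) * profile q s N (snd z /\<^sub>R K)))"
          using True N by (intro mult_left_mono low bump_0_nonneg) auto
        finally have "ennreal (c * ?f z) \<le> ennreal (indicator ?A z * (\<bar>u (fst z) (snd z)\<bar> powr p * (bump 0 (fst z / r) * profile q s N (snd z /\<^sub>R K))))"
          by (rule ennreal_leI)
        then show ?thesis using True c by (simp add: ennreal_mult'[symmetric])
      qed simp
    qed
    finally show "ennreal c * (\<integral>\<^sup>+z. ennreal (?f z) * indicator (?S N) z \<partial>lborel) + D \<le> R"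
      using tested[OF N] by (meson add_right_mono order_trans)
  qed
qed

text \<open>A crude Young inequality: below the threshold \<open>l^(-1/(p-1))\<close> the second
  summand suffices, above it \<open>l v^(p-1) \<ge> 1\<close>. Keeping \<open>l\<close> free
  postpones the optimisation until after integration.\<close>

lemma le_scaled_powr:
  fixes v l p :: real
  assumes "v \<ge> 0" "l > 0" "p > 1"
  shows "v \<le> l * v powr p + l powr (- 1 / (p - 1))"
proof (cases "v \<le> l powr (- 1 / (p - 1))")
  case True
  then show ?thesis using assms by (simp add: add_increasing)
next
  case False
  then have v: "v > 0" using assms powr_ge_zero[of l "- 1 / (p - 1)"] by linarith
  have "(l powr (- 1 / (p - 1))) powr (p - 1) \<le> v powr (p - 1)"
    using False assms by (intro powr_mono2) auto
  moreover have "(l powr (- 1 / (p - 1))) powr (p - 1) = 1 / l"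
    unfolding powr_powr using assms by (simp add: powr_minus_divide)
  ultimately have "1 / l \<le> v powr (p - 1)" by (simp only:)
  then have "1 \<le> l * v powr (p - 1)" using assms by (simp add: divide_le_eq mult.commute)
  then have "v * 1 \<le> v * (l * v powr (p - 1))" using v by (intro mult_left_mono) auto
  also have "\<dots> = l * v powr p"
    using v by (simp add: powr_diff field_simps)
  finally show ?thesis using powr_ge_zero[of l "- 1 / (p - 1)"] by linarith
qed

text \<open>Young's inequality is applied pointwise to the product of \<open>|u|\<close>, the
  \<open>1/p\<close>-th power of the cutoff and the weight \<open>w\<close>, then integrated against
  \<open>jap\<close>. From \<open>w \<le> 3\<close> one gets \<open>w^p \<le> 3^(p-1) w\<close>, so
  a single power of \<open>w\<close> survives, as in \<open>Z_int\<close>. The last term is the mass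
  of the strip of length \<open>r\<close>.\<close>

lemma W_int_le:
  fixes u :: "real \<Rightarrow> 'a::euclidean_space \<Rightarrow> real"
  assumes ws: "weak_sol a b \<sigma> p \<epsilon> u0 u1 T u" and r: "r \<ge> 1" "K > 0"
    and q: "q > real DIM('a)" "\<delta> \<ge> 0" "p > 1" and l: "l > 0"
  shows "W_int T u p q \<delta> r K \<le> ennreal (l * 3 powr (p - 1)) * Z_int T u p q \<delta> r K
    + ennreal (l powr (- 1 / (p - 1)) * (r * (K ^ DIM('a) * (LINT x|lborel. jap q (x::'a)))))"
proof -
  let ?A = "time_int T \<times> (UNIV :: 'a set)"
  let ?J = "\<lambda>z::real \<times> 'a. jap q (snd z /\<^sub>R K)"
  let ?Zf = "\<lambda>z. indicator ?A z * (\<bar>u (fst z) (snd z)\<bar> powr p * (bump 0 (fst z / r) * (weight \<delta> r K z * ?J z)))"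
  let ?l = "l powr (- 1 / (p - 1))"
  have Zm: "?Zf \<in> borel_measurable borel"
  proof (rule measurable_indicator_mult_abs(1)[OF weak_sol_measurable[OF ws]])
    show "(\<lambda>z::real \<times> 'a. bump 0 (fst z / r) * (weight \<delta> r K z * ?J z)) \<in> borel_measurable borel"
      unfolding weight_def[abs_def] borel_prod[symmetric] by measurable
  qed (use q in simp)
  have Jm: "(\<lambda>z. ennreal (?J z) * indicator {0..r} (fst z)) \<in> borel_measurable borel"
    unfolding borel_prod[symmetric] by measurable
  have "W_int T u p q \<delta> r K \<le> (\<integral>\<^sup>+z. ennreal (l * 3 powr (p - 1)) * ennreal (?Zf z)
      + ennreal ?l * (ennreal (?J z) * indicator {0..r} (fst z)) \<partial>lborel)"
    unfolding W_int_def
  proof (rule nn_integral_mono)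
    fix z :: "real \<times> 'a"
    let ?B = "bump 0 (fst z / r)" and ?u = "\<bar>u (fst z) (snd z)\<bar>" and ?w = "weight \<delta> r K z"
    show "ennreal (indicator ?A z * (?u * (?B powr (1 / p) * (?w * ?J z)))) \<le>
      ennreal (l * 3 powr (p - 1)) * ennreal (?Zf z) + ennreal ?l * (ennreal (?J z) * indicator {0..r} (fst z))"
    proof (cases "z \<in> ?A \<and> fst z \<le> r")
      case True
      then have t: "fst z \<ge> 0" by (auto simp: time_int_def)
      have w: "0 \<le> ?w" "?w \<le> 3" using weight_bounds[OF r q(2) t] by auto
      have J: "?J z \<ge> 0" using jap_pos[of q] by (auto intro: less_imp_le)
      have B: "?B \<ge> 0" by (rule bump_0_nonneg)
      let ?v = "?u * ?B powr (1 / p) * ?w"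
      have v0: "?v \<ge> 0" using w by simp
      have "?v powr p = ?u powr p * ?B * ?w powr p"
        using B w q by (simp add: powr_mult powr_powr)
      also have "\<dots> \<le> ?u powr p * ?B * (3 powr (p - 1) * ?w)"
      proof (intro mult_left_mono)
        show "?w powr p \<le> 3 powr (p - 1) * ?w"
        proof (cases "?w = 0")
          case False
          then have "?w powr p = ?w powr (p - 1) * ?w" using w by (simp add: powr_diff)
          also have "\<dots> \<le> 3 powr (p - 1) * ?w" using w q by (intro mult_right_mono powr_mono2) auto
          finally show ?thesis .
        qed simp
      qed (use B in auto)
      finally have vp: "?v powr p \<le> ?u powr p * ?B * (3 powr (p - 1) * ?w)" .
      have "?v \<le> l * ?v powr p + ?l" using v0 l q by (intro le_scaled_powr) auto
      also have "\<dots> \<le> l * (?u powr p * ?B * (3 powr (p - 1) * ?w)) + ?l"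
        using vp l by (intro add_right_mono mult_left_mono) auto
      finally have "?v * ?J z \<le> (l * (?u powr p * ?B * (3 powr (p - 1) * ?w)) + ?l) * ?J z"
        using J by (rule mult_right_mono)
      also have "\<dots> = (l * 3 powr (p - 1)) * (?u powr p * (?B * (?w * ?J z))) + ?l * ?J z"
        by (simp add: algebra_simps)
      finally have "ennreal (?v * ?J z) \<le> ennreal ((l * 3 powr (p - 1)) * (?u powr p * (?B * (?w * ?J z))) + ?l * ?J z)"
        by (rule ennreal_leI)
      also have "\<dots> = ennreal (l * 3 powr (p - 1)) * ennreal (?u powr p * (?B * (?w * ?J z))) + ennreal ?l * ennreal (?J z)"
        using l B w J by (simp add: ennreal_plus ennreal_mult'[symmetric] del: ennreal_plus)
          (subst ennreal_plus[symmetric], auto intro!: mult_nonneg_nonneg)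
      finally show ?thesis using True t by (simp add: mult_ac)
    next
      case False
      have "indicator ?A z * (?u * (?B powr (1 / p) * (?w * ?J z))) = 0"
      proof (cases "z \<in> ?A")
        case True
        then have "\<bar>fst z / r\<bar> \<ge> 1" using False r by auto
        then show ?thesis by (simp add: bump_eq_0)
      qed simp
      then show ?thesis by (simp only: ennreal_0 zero_le)
    qed
  qed
  also have "\<dots> = ennreal (l * 3 powr (p - 1)) * (\<integral>\<^sup>+z. ennreal (?Zf z) \<partial>lborel)
      + ennreal ?l * (\<integral>\<^sup>+z. ennreal (?J z) * indicator {0..r} (fst z) \<partial>lborel)"
    using Zm Jm by (subst nn_integral_add) (auto simp: nn_integral_cmult)
  also have "(\<integral>\<^sup>+z. ennreal (?J z) * indicator {0..r} (fst z) \<partial>lborel) =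
      (\<integral>\<^sup>+t. (\<integral>\<^sup>+x. ennreal (jap q ((x::'a) /\<^sub>R K)) * indicator {0..r} t \<partial>lborel) \<partial>lborel)"
    using nn_integral_strip[OF Jm] by simp
  also have "\<dots> = (\<integral>\<^sup>+t. ennreal (K ^ DIM('a) * (LINT x|lborel. jap q (x::'a))) * indicator {0..r} t \<partial>lborel)"
    by (intro nn_integral_cong) (subst nn_integral_multc, auto simp: nn_integral_jap_scale[OF q(1) r(2)])
  also have "\<dots> = ennreal (K ^ DIM('a) * (LINT x|lborel. jap q (x::'a))) * ennreal r"
    using r by (subst nn_integral_cmult_indicator) auto
  also have "ennreal ?l * \<dots> = ennreal (?l * (r * (K ^ DIM('a) * (LINT x|lborel. jap q (x::'a)))))"
    using r by (simp add: ennreal_mult'[symmetric] ennreal_mult''[symmetric] mult_ac)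
  finally show ?thesis unfolding Z_int_def .
qed

lemma Z_int_le_X_int:
  fixes u :: "real \<Rightarrow> 'a::euclidean_space \<Rightarrow> real"
  assumes ws: "weak_sol a b \<sigma> p \<epsilon> u0 u1 T u" and r: "r \<ge> 1" "K > 0" and d: "\<delta> \<ge> 0" "p > 1"
  shows "Z_int T u p q \<delta> r K \<le> 3 * X_int T u p q r K"
proof -
  let ?A = "time_int T \<times> (UNIV :: 'a set)"
  let ?Xf = "\<lambda>z. indicator ?A z * (\<bar>u (fst z) (snd z)\<bar> powr p * (bump 0 (fst z / r) * jap q (snd z /\<^sub>R K)))"
  have Xm: "?Xf \<in> borel_measurable borel"
  proof (rule measurable_indicator_mult_abs(1)[OF weak_sol_measurable[OF ws]])
    show "(\<lambda>z::real \<times> 'a. bump 0 (fst z / r) * jap q (snd z /\<^sub>R K)) \<in> borel_measurable borel"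
      unfolding borel_prod[symmetric] by measurable
  qed (use d in simp)
  have "Z_int T u p q \<delta> r K \<le> (\<integral>\<^sup>+z. ennreal 3 * ennreal (?Xf z) \<partial>lborel)"
    unfolding Z_int_def
  proof (rule nn_integral_mono)
    fix z :: "real \<times> 'a"
    let ?c = "\<bar>u (fst z) (snd z)\<bar> powr p * (bump 0 (fst z / r) * jap q (snd z /\<^sub>R K))"
    have c: "?c \<ge> 0" by (intro mult_nonneg_nonneg bump_0_nonneg less_imp_le[OF jap_pos]) auto
    show "ennreal (indicator ?A z * (\<bar>u (fst z) (snd z)\<bar> powr p * (bump 0 (fst z / r) * (weight \<delta> r K z * jap q (snd z /\<^sub>R K)))))
      \<le> ennreal 3 * ennreal (?Xf z)"
    proof (cases "z \<in> ?A")
      case True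
      then have t: "fst z \<ge> 0" by (auto simp: time_int_def)
      have "weight \<delta> r K z * ?c \<le> 3 * ?c"
        using weight_bounds[OF r d(1) t] c by (intro mult_right_mono) auto
      then have "ennreal (weight \<delta> r K z * ?c) \<le> ennreal 3 * ennreal ?c"
        by (subst ennreal_mult'[symmetric]) (auto intro: ennreal_leI)
      then show ?thesis using True by (simp add: mult_ac)
    qed simp
  qed
  also have "\<dots> = 3 * X_int T u p q r K"
    unfolding X_int_def using Xm by (subst nn_integral_cmult) auto
  finally show ?thesis .
qed

text \<open>Choosing \<open>l\<close> recovers a Hoelder inequality: the choice makes the second
  summand equal to \<open>A/2\<close>, which is absorbed on the left.\<close>

lemma powr_le_of_family:
  fixes A B Z p :: real
  assumes "A > 0" "B > 0" "p > 1" "\<And>l. l > 0 \<Longrightarrow> A \<le> l * Z + l powr (- 1 / (p - 1)) * B"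
  shows "A powr p \<le> 2 powr p * B powr (p - 1) * Z"
proof -
  define l where "l = (2 * B / A) powr (p - 1)"
  have l: "l > 0" using assms by (simp add: l_def)
  have "l powr (- 1 / (p - 1)) = (2 * B / A) powr (- 1)"
    unfolding l_def powr_powr using assms by simp
  also have "\<dots> = A / (2 * B)"
    using assms by (simp add: powr_minus_divide)
  finally have "A \<le> l * Z + A / 2"
    using assms(4)[OF l] assms(2) by simp
  then have "A \<le> 2 * l * Z" by simp
  then have "A * A powr (p - 1) \<le> 2 * l * Z * A powr (p - 1)"
    by (rule mult_right_mono) simp
  also have "l * A powr (p - 1) = (2 * B) powr (p - 1)"
    unfolding l_def using assms by (simp add: powr_divide)
  then have "2 * l * Z * A powr (p - 1) = 2 * ((2 * B) powr (p - 1) * Z)"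
    by (simp add: mult_ac)
  also have "\<dots> = 2 * 2 powr (p - 1) * B powr (p - 1) * Z"
    using assms by (simp add: powr_mult)
  also have "2 * 2 powr (p - 1) = 2 powr p"
    by (simp add: powr_diff)
  also have "A * A powr (p - 1) = A powr p"
    using assms by (simp add: powr_diff)
  finally show ?thesis .
qed

text \<open>The factor \<open>1/r\<close> of the residual cancels the length \<open>r\<close> of the
  strip in the second Young term and survives next to \<open>Z_int\<close> in the first. Since
  \<open>K^n = r^(n/(2s))\<close>, the optimised bound carries \<open>r^(n(p-1)/(2s)) / r\<close>,
  which is the stated power.\<close>

lemma weak_sol_main_inequality:
  fixes u0 u1 :: "'a::euclidean_space \<Rightarrow> real" and a b \<sigma> p :: real
  assumes ab: "a > 0" "b > 0" and \<sigma>: "\<sigma> > 0" "\<sigma> \<noteq> 1" and p: "p > 1"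
    and w: "integrable lborel (\<lambda>x. u0 x + u1 x)" "(LINT x|lborel. u0 x + u1 x) > 0"
  defines "s \<equiv> min 1 \<sigma>"
  defines "q \<equiv> real DIM('a) + \<sigma>"
  defines "\<delta> \<equiv> min 1 (max 1 \<sigma> / s - 1)"
  shows "\<exists>C>0. \<exists>r0\<ge>1. \<forall>\<epsilon> T u r. \<epsilon> > 0 \<longrightarrow> weak_sol a b \<sigma> p \<epsilon> u0 u1 T u \<longrightarrow> r \<ge> r0 \<longrightarrow> ereal r < T \<longrightarrow>
    X_int T u p q r (r powr (1 / (2 * s))) < \<infinity> \<and>
    (enn2real (X_int T u p q r (r powr (1 / (2 * s)))) + \<epsilon>) powr p
      \<le> C * r powr (- (1 - real DIM('a) * (p - 1) / (2 * s))) * enn2real (Z_int T u p q \<delta> r (r powr (1 / (2 * s))))"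
proof -
  let ?n = "real DIM('a)" and ?K = "\<lambda>r. r powr (1 / (2 * s))"
  have n: "?n \<ge> 1" by (simp add: Suc_le_eq)
  have s: "s > 0" using \<sigma> by (simp add: s_def)
  have q: "q \<ge> 1" "q \<ge> 0" "q > ?n" unfolding q_def using n \<sigma> by linarith+
  have \<delta>: "\<delta> \<ge> 0" using \<sigma> by (auto simp: \<delta>_def s_def min_def max_def)
  obtain C where C: "C > 0" "\<And>N r t x. r \<ge> 1 \<Longrightarrow> t \<ge> 0 \<Longrightarrow>
    \<bar>residual a b \<sigma> (test_phi r (?K r) q s N) (t, x::'a)\<bar> \<le>
      C / r * (bump 0 (t / r) powr (1 / p) * (weight \<delta> r (?K r) (t, x) * jap q (x /\<^sub>R ?K r)))"
    using residual_bound[OF ab \<sigma> p, where 'a = 'a] unfolding s_def q_def \<delta>_def by blast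
  obtain c where c: "c > 0" "\<And>N. \<And>y::'a. norm y \<le> 2 ^ N / 4 \<Longrightarrow> N \<ge> 1 \<Longrightarrow> c * jap q y \<le> profile q s N y"
    using profile_lower_bound[OF s q(2)] by blast
  obtain c1 K0 where c1: "c1 > 0" "K0 > 0" "\<And>K N. K \<ge> K0 \<Longrightarrow> N \<ge> 1 \<Longrightarrow>
      c1 \<le> bump 0 0 * (LINT x|lborel. (u0 x + u1 x) * profile q s N (x /\<^sub>R K))"
    using data_lower_bound[OF w q(1) s] by blast
  define A0 where "A0 = (LINT x|lborel. jap q (x::'a))"
  have A0: "A0 > 0"
  proof -
    have "A0 \<noteq> 0"
    proof
      assume "A0 = 0"
      then have "AE x::'a in lborel. jap q x = 0"
        unfolding A0_def using integral_nonneg_eq_0_iff_AE[OF integrable_jap[OF q(3)]] less_imp_le[OF jap_pos] by auto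
      then have "AE x::'a in lborel. False"
        by (rule eventually_mono) (metis jap_pos less_irrefl)
      then show False by (simp add: trivial_limit_def[symmetric] ae_filter_eq_bot_iff)
    qed
    moreover have "A0 \<ge> 0" unfolding A0_def by (intro integral_nonneg_AE AE_I2 less_imp_le jap_pos)
    ultimately show ?thesis by simp
  qed
  \<comment> \<open>For \<open>r\<close> beyond this value the spatial scale reaches
    \<open>K0\<close>, from which on the lower bound for the data holds.\<close>
  define r0 where "r0 = max 1 (K0 powr (2 * s))"
  define d where "d = min c c1"
  have d: "d > 0" "d \<le> c" "d \<le> c1" using c c1 by (auto simp: d_def)
  define C2 where "C2 = d powr (- p) * (2 powr p * (C * A0) powr (p - 1) * (C * 3 powr (p - 1)))"
  have C2: "C2 > 0" using d C A0 by (simp add: C2_def)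
  have "X_int T u p q r (?K r) < \<infinity> \<and>
    (enn2real (X_int T u p q r (?K r)) + \<epsilon>) powr p
      \<le> C2 * r powr (- (1 - ?n * (p - 1) / (2 * s))) * enn2real (Z_int T u p q \<delta> r (?K r))"
    if \<epsilon>: "\<epsilon> > 0" and ws: "weak_sol a b \<sigma> p \<epsilon> u0 u1 T u" and r: "r \<ge> r0" and rT: "ereal r < T" for \<epsilon> T u r
  proof -
    have r1: "r \<ge> 1" using r by (simp add: r0_def)
    have K: "?K r > 0" using r1 by simp
    have KK: "?K r \<ge> K0"
    proof -
      have "K0 = (K0 powr (2 * s)) powr (1 / (2 * s))" unfolding powr_powr using s c1 by simp
      also have "\<dots> \<le> ?K r" using r s by (intro powr_mono2) (auto simp: r0_def)
      finally show ?thesis .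
    qed
    let ?X = "X_int T u p q r (?K r)" and ?Z = "Z_int T u p q \<delta> r (?K r)" and ?W = "W_int T u p q \<delta> r (?K r)"
    have Wfin: "?W < \<infinity>" by (rule W_int_finite[OF ws rT r1 K q(3) \<delta> p])
    have XW: "ennreal c * ?X + ennreal (\<epsilon> * c1) \<le> ennreal (C / r) * ?W"
      by (rule X_int_le_W_int[OF ws r1 K p c])
        (auto intro!: weak_sol_tested[OF ws rT r1 K p s \<epsilon> C(1) C(2)[OF r1] c1(1) c1(3)[OF KK] \<delta>])
    have "ennreal c * ?X \<le> ennreal c * ?X + ennreal (\<epsilon> * c1)" by simp
    also note XW
    also have "ennreal (C / r) * ?W < \<infinity>" using Wfin by (simp add: ennreal_mult_less_top)
    finally have Xfin: "?X < \<infinity>" using c(1) by (auto simp: ennreal_mult_less_top)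
    have Zfin: "?Z < \<infinity>"
      using le_less_trans[OF Z_int_le_X_int[OF ws r1 K \<delta> p, of q]] Xfin by (auto simp: ennreal_mult_less_top)
    obtain X where X: "?X = ennreal X" "X \<ge> 0" using Xfin by (cases ?X) auto
    obtain Z where Z: "?Z = ennreal Z" "Z \<ge> 0" using Zfin by (cases ?Z) auto
    define A where "A = d * (X + \<epsilon>)"
    have A: "A > 0" using d X \<epsilon> by (simp add: A_def add_nonneg_pos)
    have fam: "A \<le> l * (C / r * 3 powr (p - 1) * Z) + l powr (- 1 / (p - 1)) * (C * (?K r ^ DIM('a) * A0))" if l: "l > 0" for l
    proof -
      have "ennreal (c * X + \<epsilon> * c1) = ennreal c * ?X + ennreal (\<epsilon> * c1)"
        using X c \<epsilon> c1 by (simp add: ennreal_mult'[symmetric])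
      also note XW
      also have "ennreal (C / r) * ?W \<le> ennreal (C / r) * (ennreal (l * 3 powr (p - 1)) * ?Z
          + ennreal (l powr (- 1 / (p - 1)) * (r * (?K r ^ DIM('a) * A0))))"
        unfolding A0_def by (intro mult_left_mono W_int_le[OF ws r1 K q(3) \<delta> p l]) auto
      also have "\<dots> = ennreal (C / r * (l * 3 powr (p - 1) * Z + l powr (- 1 / (p - 1)) * (r * (?K r ^ DIM('a) * A0))))"
      proof -
        have "ennreal (l * 3 powr (p - 1)) * ?Z = ennreal (l * 3 powr (p - 1) * Z)"
          unfolding Z(1) using l by (intro ennreal_mult'[symmetric]) simp
        moreover have "ennreal (l * 3 powr (p - 1) * Z) + ennreal (l powr (- 1 / (p - 1)) * (r * (?K r ^ DIM('a) * A0)))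
          = ennreal (l * 3 powr (p - 1) * Z + l powr (- 1 / (p - 1)) * (r * (?K r ^ DIM('a) * A0)))"
          using l Z r1 A0 K by (intro ennreal_plus[symmetric] mult_nonneg_nonneg) auto
        moreover have "ennreal (C / r) * ennreal y = ennreal (C / r * y)" for y
          using C(1) r1 by (intro ennreal_mult'[symmetric]) simp
        ultimately show ?thesis by simp
      qed
      finally have "c * X + \<epsilon> * c1 \<le> C / r * (l * 3 powr (p - 1) * Z + l powr (- 1 / (p - 1)) * (r * (?K r ^ DIM('a) * A0)))"
        using C(1) r1 l Z A0 K
        by (subst (asm) ennreal_le_iff) (auto intro!: mult_nonneg_nonneg add_nonneg_nonneg divide_nonneg_nonneg)
      also have "\<dots> = l * (C / r * 3 powr (p - 1) * Z) + l powr (- 1 / (p - 1)) * (C * (?K r ^ DIM('a) * A0))"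
        using r1 by (simp add: field_simps)
      finally have "c * X + \<epsilon> * c1 \<le> l * (C / r * 3 powr (p - 1) * Z) + l powr (- 1 / (p - 1)) * (C * (?K r ^ DIM('a) * A0))" .
      moreover have "A \<le> c * X + \<epsilon> * c1"
        using d X \<epsilon> by (simp add: A_def distrib_left mult.commute add_mono mult_left_mono)
      ultimately show ?thesis by linarith
    qed
    have "A powr p \<le> 2 powr p * (C * (?K r ^ DIM('a) * A0)) powr (p - 1) * (C / r * 3 powr (p - 1) * Z)"
      using A C(1) A0 K p fam by (intro powr_le_of_family) auto
    also have "(C * (?K r ^ DIM('a) * A0)) powr (p - 1) = (C * A0) powr (p - 1) * r powr (?n * (p - 1) / (2 * s))"
    proof -
      have "?K r ^ DIM('a) = r powr (?n / (2 * s))"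
        using K by (subst powr_realpow[symmetric]) (auto simp: powr_powr)
      then have "C * (?K r ^ DIM('a) * A0) = (C * A0) * r powr (?n / (2 * s))" by simp
      then show ?thesis using C(1) A0 by (simp add: powr_mult powr_powr)
    qed
    also have "2 powr p * ((C * A0) powr (p - 1) * r powr (?n * (p - 1) / (2 * s))) * (C / r * 3 powr (p - 1) * Z)
      = (2 powr p * (C * A0) powr (p - 1) * (C * 3 powr (p - 1))) * (r powr (?n * (p - 1) / (2 * s)) / r) * Z"
      by simp
    also have "r powr (?n * (p - 1) / (2 * s)) / r = r powr (- (1 - ?n * (p - 1) / (2 * s)))"
      using r1 by (simp add: powr_diff)
    finally have Ap: "A powr p \<le> (2 powr p * (C * A0) powr (p - 1) * (C * 3 powr (p - 1))) * r powr (- (1 - ?n * (p - 1) / (2 * s))) * Z" .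
    have "(X + \<epsilon>) powr p = d powr (- p) * A powr p"
      unfolding A_def using d X \<epsilon> by (simp add: powr_mult powr_minus)
    also have "\<dots> \<le> d powr (- p) * ((2 powr p * (C * A0) powr (p - 1) * (C * 3 powr (p - 1))) * r powr (- (1 - ?n * (p - 1) / (2 * s))) * Z)"
      using Ap by (intro mult_left_mono) auto
    also have "\<dots> = C2 * r powr (- (1 - ?n * (p - 1) / (2 * s))) * Z"
      by (simp add: C2_def mult.assoc)
    finally show ?thesis using Xfin X Z by simp
  qed
  moreover have "r0 \<ge> 1" by (simp add: r0_def)
  ultimately show ?thesis using C2 by blast
qed

section \<open>Summation over dyadic scales\<close>

text \<open>The spatial part of the weight is dominated by the growth of \<open>jap\<close> when the
  scale increases by the factor \<open>\<rho>\<close>, so sums over scales telescope. The proof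
  rests on \<open>z^q - 1 \<ge> z - 1\<close> for
  \<open>z = (1+y)/(1+y/\<rho>) \<ge> 1\<close>.\<close>

lemma jap_dilation_increment:
  fixes q \<rho> y :: real
  assumes "q \<ge> 1" "\<rho> > 1" "y \<ge> 0"
  shows "(1 - 1 / \<rho>) * (y / (1 + y) * (1 + y) powr (- q)) \<le> (1 + y / \<rho>) powr (- q) - (1 + y) powr (- q)"
proof -
  have d: "1 + y / \<rho> > 0" "1 + y > 0" using assms by (auto simp: add_pos_nonneg)
  have le: "y / \<rho> \<le> y" using assms by (simp add: divide_le_eq mult_le_cancel_left1)
  have "1 \<le> (1 + y) / (1 + y / \<rho>)" using d le by (simp add: le_divide_eq)
  then have "((1 + y) / (1 + y / \<rho>)) powr 1 \<le> ((1 + y) / (1 + y / \<rho>)) powr q"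
    using assms by (intro powr_mono) auto
  then have "(1 + y) / (1 + y / \<rho>) - 1 \<le> ((1 + y) / (1 + y / \<rho>)) powr q - 1"
    using d by simp
  moreover have "(1 + y) / (1 + y / \<rho>) - 1 = (y - y / \<rho>) / (1 + y / \<rho>)"
  proof -
    have "(1 + y) / D - 1 = (1 + y - D) / D" if "D > 0" for D :: real
      using that by (simp add: diff_divide_distrib)
    from this[OF d(1)] show ?thesis by simp
  qed
  moreover have "(y - y / \<rho>) / (1 + y) \<le> (y - y / \<rho>) / (1 + y / \<rho>)"
    using d le by (intro divide_left_mono) auto
  moreover have "(y - y / \<rho>) / (1 + y) = (1 - 1 / \<rho>) * (y / (1 + y))"
    by (simp add: left_diff_distrib)
  ultimately have "(1 - 1 / \<rho>) * (y / (1 + y)) \<le> ((1 + y) / (1 + y / \<rho>)) powr q - 1" by linarith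
  then have "(1 - 1 / \<rho>) * (y / (1 + y)) * (1 + y) powr (- q) \<le> (((1 + y) / (1 + y / \<rho>)) powr q - 1) * (1 + y) powr (- q)"
    by (rule mult_right_mono) simp
  also have "\<dots> = (1 + y / \<rho>) powr (- q) - (1 + y) powr (- q)"
    using d by (simp add: powr_divide powr_minus field_simps)
  finally show ?thesis by (simp only: mult.assoc)
qed

text \<open>All three parts of the weight are summable over dyadic scales: the time part is bounded
  by increments of \<open>1/(1 + t/2^j)\<close>, the spatial part by increments of
  \<open>jap\<close>, and \<open>2^(-\<delta>j)\<close> is geometric. The cutoff and
  \<open>jap\<close> grow with the scale and may be frozen at \<open>N\<close> where they are not
  telescoped.\<close>

lemma dyadic_weight_sum:
  fixes x :: "'a::euclidean_space"
  assumes q: "q \<ge> 1" and s: "s > 0" and \<delta>: "\<delta> > 0" and t: "t \<ge> 0"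
  defines "K \<equiv> \<lambda>j::nat. (2 ^ j) powr (1 / (2 * s))"
  shows "(\<Sum>j\<in>{j0..N}. bump 0 (t / 2 ^ j) * (weight \<delta> (2 ^ j) (K j) (t, x) * jap q (x /\<^sub>R K j)))
    \<le> (4 + 1 / (1 - 1 / 2 powr (1 / (2 * s))) + 1 / (1 - 2 powr (- \<delta>))) * (bump 0 (t / 2 ^ N) * jap q (x /\<^sub>R K N))"
proof -
  define \<rho> where "\<rho> = 2 powr (1 / (2 * s))"
  have \<rho>: "\<rho> > 1" using s by (simp add: \<rho>_def gr_one_powr)
  have K: "K j = \<rho> ^ j" for j unfolding K_def \<rho>_def by (rule two_power_powr)
  define J where "J j = jap q (x /\<^sub>R K j)" for j
  define y where "y j = norm x / K j" for j
  have Kp: "K j > 0" for j using \<rho> by (simp add: K)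
  have y0: "y j \<ge> 0" for j using Kp[of j] by (simp add: y_def)
  have ny: "norm (x /\<^sub>R K j) = y j" for j using Kp[of j] by (simp add: y_def divide_inverse mult.commute)
  have J: "J j = (1 + y j) powr (- q)" for j by (simp only: J_def jap_def ny)
  have ySuc: "y (Suc j) = y j / \<rho>" for j by (simp add: y_def K)
  have J0: "J j > 0" for j unfolding J_def by (rule jap_pos)
  have Jinc: "J j \<le> J (Suc j)" for j
    unfolding J ySuc using q \<rho> y0[of j] by (intro powr_mono2') (auto simp: add_pos_nonneg divide_le_eq mult_le_cancel_left1)
  have JN: "J j \<le> J N" if "j \<le> N" for j using lift_Suc_mono_le[of J, OF Jinc that] .
  define \<beta> where "\<beta> j = bump 0 (t / 2 ^ j)" for j :: nat
  have \<beta>0: "\<beta> j \<ge> 0" for j by (simp add: \<beta>_def bump_0_nonneg)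
  have \<beta>N: "\<beta> j \<le> \<beta> N" if "j \<le> N" for j
    unfolding \<beta>_def using t that by (intro bump_0_antimono) (auto intro!: divide_left_mono power_increasing)
  define \<tau> where "\<tau> j = 1 / (1 + t / 2 ^ j)" for j :: nat
  have \<tau>: "0 \<le> \<tau> j" "\<tau> j \<le> 1" for j
    using frac_le[of 1 1 1 "1 + t / 2 ^ j"] t by (auto simp: \<tau>_def)
  have \<tau>inc: "\<tau> j \<le> \<tau> (Suc j)" for j
  proof -
    have "1 + t / 2 ^ Suc j \<le> 1 + t / 2 ^ j" "0 < 1 + t / 2 ^ Suc j"
      using t by (auto simp: divide_simps intro: add_pos_nonneg add_nonneg_pos)
    then show ?thesis unfolding \<tau>_def by (intro frac_le) auto
  qed
  have 1: "\<beta> j * ((t / 2 ^ j) / (1 + t / 2 ^ j)) \<le> \<beta> j * (3 * (\<tau> (Suc j) - \<tau> j))" for j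
  proof (cases "t / 2 ^ j \<ge> 1")
    case True
    then have "\<beta> j = 0" unfolding \<beta>_def by (intro bump_eq_0) (rule order_trans[OF _ abs_ge_self])
    then show ?thesis by simp
  next
    case False
    \<comment> \<open>The increment equals \<open>v / ((1+v)(2+v))\<close>, and on the support of
      the cutoff \<open>2 + v < 3\<close>; this is the origin of the factor 3.\<close>
    define v where "v = t / 2 ^ j"
    have v: "0 \<le> v" "v < 1" using t False by (auto simp: v_def)
    have "t / 2 ^ Suc j = v / 2" by (simp add: v_def)
    then have "3 * (\<tau> (Suc j) - \<tau> j) = 3 * (1 / (1 + v / 2) - 1 / (1 + v))" by (simp add: \<tau>_def v_def)
    also have "\<dots> = v / (1 + v) * (3 / (2 + v))"
      using v by (simp add: field_simps)
    also have "\<dots> \<ge> v / (1 + v) * 1"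
      using v by (intro mult_left_mono) (auto simp: le_divide_eq)
    finally have "v / (1 + v) \<le> 3 * (\<tau> (Suc j) - \<tau> j)" by simp
    then show ?thesis using \<beta>0[of j] by (intro mult_left_mono) (auto simp: v_def)
  qed
  have 2: "y j / (1 + y j) * J j \<le> 1 / (1 - 1 / \<rho>) * (J (Suc j) - J j)" for j
  proof -
    have "(1 - 1 / \<rho>) * (y j / (1 + y j) * J j) \<le> J (Suc j) - J j"
      using jap_dilation_increment[OF q \<rho> y0[of j]] by (simp only: J ySuc)
    moreover have "1 - 1 / \<rho> > 0" using \<rho> by simp
    ultimately show ?thesis by (simp add: le_divide_eq mult.commute)
  qed
  let ?P = "\<beta> N * J N"
  have P0: "?P \<ge> 0" using \<beta>0 J0[of N] by simp
  \<comment> \<open>At the top scale an increment would involve scale \<open>N + 1\<close>; this one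
    summand is bounded by \<open>?P\<close> itself, which makes the constant 4 = 3 + 1.\<close>
  let ?y = "\<lambda>j. if j = N then ?P else \<beta> N * (1 / (1 - 1 / \<rho>) * (J (Suc j) - J j))"
  have summand: "\<beta> j * (weight \<delta> (2 ^ j) (K j) (t, x) * J j) \<le>
      ?P * (3 * (\<tau> (Suc j) - \<tau> j)) + ?y j + ?P * (2 powr (- \<delta>)) ^ j" if j: "j \<le> N" for j
  proof -
    have PP: "\<beta> j * J j \<le> ?P" using JN[OF j] \<beta>N[OF j] \<beta>0[of j] \<beta>0[of N] J0[of j] by (intro mult_mono) auto
    have "\<beta> j * (weight \<delta> (2 ^ j) (K j) (t, x) * J j) =
      (\<beta> j * ((t / 2 ^ j) / (1 + t / 2 ^ j))) * J j + \<beta> j * (y j / (1 + y j) * J j) + (\<beta> j * J j) * (2 ^ j) powr (- \<delta>)"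
      by (simp add: weight_def y_def algebra_simps)
    also have "\<dots> \<le> ?P * (3 * (\<tau> (Suc j) - \<tau> j)) + ?y j + ?P * (2 powr (- \<delta>)) ^ j"
    proof (intro add_mono)
      have "(\<beta> j * ((t / 2 ^ j) / (1 + t / 2 ^ j))) * J j \<le> (\<beta> j * (3 * (\<tau> (Suc j) - \<tau> j))) * J j"
        using 1 J0[of j] by (intro mult_right_mono) auto
      also have "\<dots> = (\<beta> j * J j) * (3 * (\<tau> (Suc j) - \<tau> j))" by simp
      also have "\<dots> \<le> ?P * (3 * (\<tau> (Suc j) - \<tau> j))"
        using PP \<tau>inc[of j] by (intro mult_right_mono) auto
      finally show "(\<beta> j * ((t / 2 ^ j) / (1 + t / 2 ^ j))) * J j \<le> ?P * (3 * (\<tau> (Suc j) - \<tau> j))" .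
      show "\<beta> j * (y j / (1 + y j) * J j) \<le> ?y j"
      proof (cases "j = N")
        case True
        have "y N / (1 + y N) * J N \<le> 1 * J N"
          using y0[of N] J0[of N] by (intro mult_right_mono) (auto simp: divide_le_eq)
        from mult_left_mono[OF this \<beta>0[of N]] show ?thesis using True by simp
      next
        case False
        have "\<beta> j * (y j / (1 + y j) * J j) \<le> \<beta> N * (y j / (1 + y j) * J j)"
          using \<beta>N[OF j] y0[of j] J0[of j] by (intro mult_right_mono) auto
        also have "\<dots> \<le> \<beta> N * (1 / (1 - 1 / \<rho>) * (J (Suc j) - J j))"
          using 2 \<beta>0 by (intro mult_left_mono) auto
        finally show ?thesis using False by simp
      qed
      show "(\<beta> j * J j) * (2 ^ j) powr (- \<delta>) \<le> ?P * (2 powr (- \<delta>)) ^ j"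
        unfolding two_power_powr using PP by (intro mult_right_mono) auto
    qed
    finally show ?thesis .
  qed
  have "(\<Sum>j\<in>{j0..N}. \<beta> j * (weight \<delta> (2 ^ j) (K j) (t, x) * J j))
    \<le> (\<Sum>j\<in>{j0..N}. ?P * (3 * (\<tau> (Suc j) - \<tau> j)) + ?y j + ?P * (2 powr (- \<delta>)) ^ j)"
    by (intro sum_mono summand) auto
  also have "\<dots> \<le> (\<Sum>j<Suc N. ?P * (3 * (\<tau> (Suc j) - \<tau> j)) + ?y j + ?P * (2 powr (- \<delta>)) ^ j)"
  proof (rule sum_mono2)
    fix j
    have "0 \<le> ?y j" using P0 \<rho> \<beta>0[of N] Jinc[of j] by simp
    then show "0 \<le> ?P * (3 * (\<tau> (Suc j) - \<tau> j)) + ?y j + ?P * (2 powr (- \<delta>)) ^ j"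
      using P0 \<tau>inc[of j] by (intro add_nonneg_nonneg) auto
  qed auto
  also have "\<dots> = ?P * (3 * (\<Sum>j<Suc N. \<tau> (Suc j) - \<tau> j)) + (\<Sum>j<Suc N. ?y j) + ?P * (\<Sum>j<Suc N. (2 powr (- \<delta>)) ^ j)"
    by (simp only: sum.distrib sum_distrib_left)
  also have "\<dots> \<le> ?P * 3 + (1 / (1 - 1 / \<rho>) * ?P + ?P) + ?P * (1 / (1 - 2 powr (- \<delta>)))"
  proof (intro add_mono mult_left_mono P0)
    have "(\<Sum>j<Suc N. \<tau> (Suc j) - \<tau> j) = \<tau> (Suc N) - \<tau> 0"
      by (rule sum_lessThan_telescope)
    then show "3 * (\<Sum>j<Suc N. \<tau> (Suc j) - \<tau> j) \<le> 3" using \<tau>(1)[of 0] \<tau>(2)[of "Suc N"] by linarith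
    have "(\<Sum>j<Suc N. ?y j) = (\<Sum>j<N. \<beta> N * (1 / (1 - 1 / \<rho>) * (J (Suc j) - J j))) + ?P"
      by simp
    also have "(\<Sum>j<N. \<beta> N * (1 / (1 - 1 / \<rho>) * (J (Suc j) - J j))) = \<beta> N * (1 / (1 - 1 / \<rho>) * (J N - J 0))"
      by (simp only: sum_distrib_left[symmetric] sum_lessThan_telescope)
    also have "\<dots> \<le> \<beta> N * (1 / (1 - 1 / \<rho>) * J N)"
      using \<beta>0 \<rho> J0[of 0] by (intro mult_left_mono) auto
    finally show "(\<Sum>j<Suc N. ?y j) \<le> 1 / (1 - 1 / \<rho>) * ?P + ?P" by simp
    show "(\<Sum>j<Suc N. (2 powr (- \<delta>)) ^ j) \<le> 1 / (1 - 2 powr (- \<delta>))"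
      using \<delta> by (intro sum_geometric_le) (auto simp: powr_less_one)
  qed
  also have "\<dots> = (4 + 1 / (1 - 1 / \<rho>) + 1 / (1 - 2 powr (- \<delta>))) * ?P"
    by (simp add: algebra_simps)
  finally show ?thesis unfolding J_def \<beta>_def \<rho>_def .
qed

lemma sum_Z_int_le:
  fixes u :: "real \<Rightarrow> 'a::euclidean_space \<Rightarrow> real"
  assumes ws: "weak_sol a b \<sigma> p \<epsilon> u0 u1 T u" and q: "q \<ge> 1" and s: "s > 0" and \<delta>: "\<delta> > 0" and p: "p > 1"
  shows "(\<Sum>j\<in>{j0..N}. Z_int T u p q \<delta> (2 ^ j) ((2 ^ j) powr (1 / (2 * s))))
    \<le> ennreal (4 + 1 / (1 - 1 / 2 powr (1 / (2 * s))) + 1 / (1 - 2 powr (- \<delta>))) * X_int T u p q (2 ^ N) ((2 ^ N) powr (1 / (2 * s)))"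
proof -
  let ?A = "time_int T \<times> (UNIV :: 'a set)"
  let ?K = "\<lambda>j::nat. (2 ^ j) powr (1 / (2 * s))"
  let ?C = "4 + 1 / (1 - 1 / 2 powr (1 / (2 * s))) + 1 / (1 - 2 powr (- \<delta>))"
  let ?g = "\<lambda>j (z::real \<times> 'a). bump 0 (fst z / 2 ^ j) * (weight \<delta> (2 ^ j) (?K j) z * jap q (snd z /\<^sub>R ?K j))"
  let ?Zf = "\<lambda>j z. indicator ?A z * (\<bar>u (fst z) (snd z)\<bar> powr p * ?g j z)"
  let ?Xf = "\<lambda>z. indicator ?A z * (\<bar>u (fst z) (snd z)\<bar> powr p * (bump 0 (fst z / 2 ^ N) * jap q (snd z /\<^sub>R ?K N)))"
  have C: "?C \<ge> 0"
  proof -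
    have "1 / 2 powr (1 / (2 * s)) < 1" "2 powr (- \<delta>) < 1" using s \<delta> by (auto simp: gr_one_powr powr_less_one)
    then show ?thesis by (intro add_nonneg_nonneg) auto
  qed
  have Zm: "?Zf j \<in> borel_measurable borel" for j
  proof (rule measurable_indicator_mult_abs(1)[OF weak_sol_measurable[OF ws]])
    show "?g j \<in> borel_measurable borel"
      unfolding weight_def[abs_def] borel_prod[symmetric] by measurable
  qed (use p in simp)
  have Xm: "?Xf \<in> borel_measurable borel"
  proof (rule measurable_indicator_mult_abs(1)[OF weak_sol_measurable[OF ws]])
    show "(\<lambda>z::real \<times> 'a. bump 0 (fst z / 2 ^ N) * jap q (snd z /\<^sub>R ?K N)) \<in> borel_measurable borel"
      unfolding borel_prod[symmetric] by measurable
  qed (use p in simp)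
  have "(\<Sum>j\<in>{j0..N}. Z_int T u p q \<delta> (2 ^ j) (?K j)) = (\<integral>\<^sup>+z. (\<Sum>j\<in>{j0..N}. ennreal (?Zf j z)) \<partial>lborel)"
    unfolding Z_int_def using Zm by (intro nn_integral_sum[symmetric]) simp
  also have "\<dots> \<le> (\<integral>\<^sup>+z. ennreal ?C * ennreal (?Xf z) \<partial>lborel)"
  proof (rule nn_integral_mono)
    fix z :: "real \<times> 'a"
    show "(\<Sum>j\<in>{j0..N}. ennreal (?Zf j z)) \<le> ennreal ?C * ennreal (?Xf z)"
    proof (cases "z \<in> ?A")
      case True
      then have t: "fst z \<ge> 0" by (auto simp: time_int_def)
      have "?Zf j z \<ge> 0" for j
        using True t s by (auto simp: weight_def intro!: mult_nonneg_nonneg bump_0_nonneg add_nonneg_nonneg less_imp_le[OF jap_pos])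
      then have "(\<Sum>j\<in>{j0..N}. ennreal (?Zf j z)) = ennreal (\<Sum>j\<in>{j0..N}. ?Zf j z)"
        by (intro sum_ennreal) auto
      also have "(\<Sum>j\<in>{j0..N}. ?Zf j z) = \<bar>u (fst z) (snd z)\<bar> powr p * (\<Sum>j\<in>{j0..N}. ?g j z)"
        using True by (simp add: sum_distrib_left)
      also have "\<dots> \<le> \<bar>u (fst z) (snd z)\<bar> powr p * (?C * (bump 0 (fst z / 2 ^ N) * jap q (snd z /\<^sub>R ?K N)))"
        using dyadic_weight_sum[OF q s \<delta> t, of "snd z" j0 N] by (intro mult_left_mono) auto
      also have "\<dots> = ?C * ?Xf z" using True by simp
      finally have "(\<Sum>j\<in>{j0..N}. ennreal (?Zf j z)) \<le> ennreal (?C * ?Xf z)" by (simp add: ennreal_leI)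
      also have "\<dots> = ennreal ?C * ennreal (?Xf z)" using C by (rule ennreal_mult')
      finally show ?thesis .
    qed simp
  qed
  also have "\<dots> = ennreal ?C * X_int T u p q (2 ^ N) (?K N)"
    unfolding X_int_def using Xm by (intro nn_integral_cmult) simp
  finally show ?thesis .
qed

text \<open>With \<open>\<epsilon>\<close> included in the partial sums \<open>S\<close>, each step
  lowers \<open>S^(1-p)\<close> by at least \<open>(p-1) c / C\<close>. This quantity starts at
  \<open>\<epsilon>^(1-p)\<close> and stays non-negative, so the number of steps is limited.\<close>

lemma discrete_blowup:
  fixes Z :: "nat \<Rightarrow> real" and c C \<epsilon> p :: real
  assumes "c > 0" "C > 0" "\<epsilon> > 0" "p > 1" "\<And>j. Z j \<ge> 0"
    and ineq: "\<And>N. j0 \<le> N \<Longrightarrow> N \<le> N1 \<Longrightarrow> (c * (\<Sum>j\<in>{j0..N}. Z j) + \<epsilon>) powr p \<le> C * Z N"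
    and "j0 \<le> N1"
  shows "real (N1 - j0 + 1) * ((p - 1) * c / C) \<le> \<epsilon> powr (1 - p)"
proof -
  define S where "S k = c * (\<Sum>j<k. Z (j0 + j)) + \<epsilon>" for k
  have S0: "S k > 0" for k unfolding S_def using assms by (intro add_nonneg_pos mult_nonneg_nonneg sum_nonneg) auto
  \<comment> \<open>Convexity of the power, with the slope taken at the right endpoint
    \<open>v\<close>: the hypothesis controls the sum that already contains the newest term.\<close>
  have conv: "u powr (1 - p) - v powr (1 - p) \<ge> (p - 1) * v powr (- p) * (v - u)" if "0 < u" "u \<le> v" for u v :: real
  proof (cases "u = v")
    case False
    then have "u < v" using that by simp
    have "((\<lambda>x. x powr (1 - p)) has_real_derivative (1 - p) * x powr (1 - p - 1)) (at x)" if "u \<le> x" "x \<le> v" for x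
      using that \<open>0 < u\<close> by (intro has_real_derivative_powr) auto
    from MVT2[OF \<open>u < v\<close> this] obtain z where z: "u < z" "z < v"
      "v powr (1 - p) - u powr (1 - p) = (v - u) * ((1 - p) * z powr (1 - p - 1))" by blast
    have "v powr (- p) \<le> z powr (- p)" using z that assms by (intro powr_mono2') auto
    then have "(p - 1) * (v - u) * v powr (- p) \<le> (p - 1) * (v - u) * z powr (- p)"
      using that assms by (intro mult_left_mono) auto
    also have "\<dots> = u powr (1 - p) - v powr (1 - p)"
      using z(3) by (simp add: algebra_simps)
    finally show ?thesis by (simp add: mult_ac)
  qed simp
  have step: "(p - 1) * c / C \<le> S k powr (1 - p) - S (Suc k) powr (1 - p)" if k: "j0 + k \<le> N1" for k
  proof -
    have "(\<Sum>j\<in>{j0..j0 + k}. Z j) = (\<Sum>j<Suc k. Z (j0 + j))"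
    proof -
      have "(\<Sum>j\<in>{j0..j0 + k}. Z j) = (\<Sum>j\<in>{0..k}. Z (j + j0))"
        using sum.shift_bounds_cl_nat_ivl[of Z 0 j0 k] by (simp add: add.commute)
      then show ?thesis by (simp add: atLeast0AtMost lessThan_Suc_atMost add.commute)
    qed
    then have "S (Suc k) powr p \<le> C * Z (j0 + k)"
      using ineq[of "j0 + k"] k by (simp add: S_def)
    then have "(1 / C) * S (Suc k) powr p \<le> Z (j0 + k)" using assms by (simp add: divide_le_eq mult.commute)
    moreover have "S (Suc k) - S k = c * Z (j0 + k)" by (simp add: S_def algebra_simps)
    ultimately have d: "c * ((1 / C) * S (Suc k) powr p) \<le> S (Suc k) - S k"
      using assms(1) by (simp only: mult_left_mono[OF _ less_imp_le])
    have "(p - 1) * c / C = (p - 1) * S (Suc k) powr (- p) * (c * ((1 / C) * S (Suc k) powr p))"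
      using S0[of "Suc k"] by (simp add: powr_minus)
    also have "\<dots> \<le> (p - 1) * S (Suc k) powr (- p) * (S (Suc k) - S k)"
      using d assms by (intro mult_left_mono) auto
    also have "\<dots> \<le> S k powr (1 - p) - S (Suc k) powr (1 - p)"
      using S0[of k] assms by (intro conv) (auto simp: S_def)
    finally show ?thesis .
  qed
  have "real (N1 - j0 + 1) * ((p - 1) * c / C) = (\<Sum>k<Suc (N1 - j0). (p - 1) * c / C)" by simp
  also have "\<dots> \<le> (\<Sum>k<Suc (N1 - j0). S k powr (1 - p) - S (Suc k) powr (1 - p))"
    using assms by (intro sum_mono step) auto
  also have "\<dots> = S 0 powr (1 - p) - S (Suc (N1 - j0)) powr (1 - p)"
    by (rule sum_lessThan_telescope')
  also have "\<dots> \<le> \<epsilon> powr (1 - p)" by (simp add: S_def)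
  finally show ?thesis .
qed

section \<open>Lifespan bounds\<close>

text \<open>One factor \<open>X + \<epsilon>\<close> cancels, which leaves \<open>\<epsilon>^(p-1)
  \<le> (X + \<epsilon>)^(p-1) \<le> 3 C r^(-\<kappa>)\<close> for every \<open>r\<close> from
  \<open>r0\<close> up to \<open>T\<close>. Solving for \<open>r\<close> gives the exponent
  \<open>(p-1)/\<kappa>\<close>.\<close>

lemma subcritical_lifespan:
  fixes u0 u1 :: "'a::euclidean_space \<Rightarrow> real" and a b \<sigma> p :: real
  assumes ab: "a > 0" "b > 0" and \<sigma>: "\<sigma> > 0" "\<sigma> \<noteq> 1" and p: "p > 1"
    and w: "integrable lborel (\<lambda>x. u0 x + u1 x)" "(LINT x|lborel. u0 x + u1 x) > 0"
    and sub: "p < 1 + 2 * min 1 \<sigma> / real DIM('a)"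
  shows "\<exists>C>0. \<exists>r0\<ge>1. \<forall>\<epsilon> T u. \<epsilon> > 0 \<longrightarrow> weak_sol a b \<sigma> p \<epsilon> u0 u1 T u \<longrightarrow>
    T \<le> ereal (max r0 (C * \<epsilon> powr (- (2 * min 1 \<sigma> * (p - 1) / (2 * min 1 \<sigma> - real DIM('a) * (p - 1))))))"
proof -
  define s where "s = min 1 \<sigma>"
  define q where "q = real DIM('a) + \<sigma>"
  define \<delta> where "\<delta> = min 1 (max 1 \<sigma> / s - 1)"
  let ?n = "real DIM('a)" and ?K = "\<lambda>r. r powr (1 / (2 * s))"
  have s: "s > 0" using \<sigma> by (simp add: s_def)
  have \<delta>: "\<delta> \<ge> 0" using \<sigma> by (auto simp: \<delta>_def s_def min_def max_def)
  define \<kappa> where "\<kappa> = 1 - ?n * (p - 1) / (2 * s)"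
  have \<kappa>: "\<kappa> > 0"
    using sub s unfolding \<kappa>_def s_def[symmetric] by (simp add: field_simps)
  have expo: "(p - 1) / \<kappa> = 2 * s * (p - 1) / (2 * s - ?n * (p - 1))"
    using s unfolding \<kappa>_def by (simp add: field_simps)
  obtain C r0 where C: "C > 0" "r0 \<ge> 1" "\<And>\<epsilon> T u r. \<epsilon> > 0 \<Longrightarrow> weak_sol a b \<sigma> p \<epsilon> u0 u1 T u \<Longrightarrow> r \<ge> r0 \<Longrightarrow> ereal r < T \<Longrightarrow>
    X_int T u p q r (?K r) < \<infinity> \<and>
    (enn2real (X_int T u p q r (?K r)) + \<epsilon>) powr p \<le> C * r powr (- \<kappa>) * enn2real (Z_int T u p q \<delta> r (?K r))"
    using weak_sol_main_inequality[OF ab \<sigma> p w] unfolding s_def[symmetric] q_def[symmetric] \<delta>_def[symmetric] \<kappa>_def[symmetric]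
    by blast
  define D where "D = (3 * C) powr (1 / \<kappa>)"
  have D: "D > 0" using C by (simp add: D_def)
  have bound: "r \<le> D * \<epsilon> powr (- ((p - 1) / \<kappa>))"
    if \<epsilon>: "\<epsilon> > 0" and ws: "weak_sol a b \<sigma> p \<epsilon> u0 u1 T u" and r: "r \<ge> r0" "ereal r < T" for \<epsilon> T u r
  proof -
    have r1: "r \<ge> 1" using r C by simp
    have K: "?K r > 0" using r1 by simp
    let ?X = "X_int T u p q r (?K r)" and ?Z = "Z_int T u p q \<delta> r (?K r)"
    have X: "?X < \<infinity>" "(enn2real ?X + \<epsilon>) powr p \<le> C * r powr (- \<kappa>) * enn2real ?Z"
      using C(3)[OF \<epsilon> ws r] by auto
    have "enn2real ?Z \<le> enn2real (3 * ?X)"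
      using X(1) by (intro enn2real_mono Z_int_le_X_int[OF ws r1 K \<delta> p]) (auto simp: ennreal_mult_less_top)
    also have "\<dots> = 3 * enn2real ?X" by (simp add: enn2real_mult)
    finally have Z: "enn2real ?Z \<le> 3 * enn2real ?X" .
    define A where "A = enn2real ?X + \<epsilon>"
    have A: "A \<ge> \<epsilon>" "A > 0" using \<epsilon> by (auto simp: A_def add_nonneg_pos)
    have "A powr (p - 1) * A = A powr p" using A by (simp add: powr_diff)
    also have "\<dots> \<le> C * r powr (- \<kappa>) * (3 * A)"
      unfolding A_def using C(1) Z \<epsilon> by (intro order_trans[OF X(2)] mult_left_mono) auto
    finally have "A powr (p - 1) * A \<le> (3 * C * r powr (- \<kappa>)) * A" by simp
    then have "A powr (p - 1) \<le> 3 * C * r powr (- \<kappa>)" using A by simp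
    moreover have "\<epsilon> powr (p - 1) \<le> A powr (p - 1)" using A \<epsilon> p by (intro powr_mono2) auto
    ultimately have "\<epsilon> powr (p - 1) \<le> 3 * C * r powr (- \<kappa>)" by linarith
    then have "r powr \<kappa> * \<epsilon> powr (p - 1) \<le> 3 * C"
      using r1 by (simp add: powr_minus field_simps)
    then have "r powr \<kappa> \<le> 3 * C / \<epsilon> powr (p - 1)"
      using \<epsilon> by (simp add: le_divide_eq)
    also have "\<dots> = 3 * C * \<epsilon> powr (- (p - 1))"
      by (simp only: powr_minus divide_inverse)
    finally have "r powr \<kappa> \<le> 3 * C * \<epsilon> powr (- (p - 1))" .
    then have "(r powr \<kappa>) powr (1 / \<kappa>) \<le> (3 * C * \<epsilon> powr (- (p - 1))) powr (1 / \<kappa>)"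
      using \<kappa> by (intro powr_mono2) auto
    also have "(r powr \<kappa>) powr (1 / \<kappa>) = r" unfolding powr_powr using \<kappa> r1 by simp
    also have "(3 * C * \<epsilon> powr (- (p - 1))) powr (1 / \<kappa>) = D * \<epsilon> powr (- ((p - 1) / \<kappa>))"
      unfolding D_def powr_mult powr_powr by (simp add: minus_divide_left)
    finally show ?thesis .
  qed
  have "T \<le> ereal (max r0 (D * \<epsilon> powr (- ((p - 1) / \<kappa>))))"
    if \<epsilon>: "\<epsilon> > 0" and ws: "weak_sol a b \<sigma> p \<epsilon> u0 u1 T u" for \<epsilon> T u
  proof (rule ccontr)
    assume "\<not> ?thesis"
    then have "ereal (max r0 (D * \<epsilon> powr (- ((p - 1) / \<kappa>)))) < T" by (simp only: not_le)
    then obtain r where r: "ereal (max r0 (D * \<epsilon> powr (- ((p - 1) / \<kappa>)))) < ereal r" "ereal r < T"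
      using ereal_dense2 by blast
    then have "r0 \<le> r" "D * \<epsilon> powr (- ((p - 1) / \<kappa>)) < r" by auto
    then show False using bound[OF \<epsilon> ws _ r(2)] by linarith
  qed
  then show ?thesis using D C(2) unfolding expo s_def by blast
qed

lemma critical_lifespan:
  fixes u0 u1 :: "'a::euclidean_space \<Rightarrow> real" and a b \<sigma> p :: real
  assumes ab: "a > 0" "b > 0" and \<sigma>: "\<sigma> > 0" "\<sigma> \<noteq> 1" and p: "p > 1"
    and w: "integrable lborel (\<lambda>x. u0 x + u1 x)" "(LINT x|lborel. u0 x + u1 x) > 0"
    and crit: "p = 1 + 2 * min 1 \<sigma> / real DIM('a)"
  shows "\<exists>C>0. \<exists>C'>0. \<forall>\<epsilon> T u. \<epsilon> > 0 \<longrightarrow> weak_sol a b \<sigma> p \<epsilon> u0 u1 T u \<longrightarrow>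
    T \<le> ereal (C' * exp (C * \<epsilon> powr (- (p - 1))))"
proof -
  define s where "s = min 1 \<sigma>"
  define q where "q = real DIM('a) + \<sigma>"
  define \<delta> where "\<delta> = min 1 (max 1 \<sigma> / s - 1)"
  let ?n = "real DIM('a)" and ?K = "\<lambda>r. r powr (1 / (2 * s))"
  have n: "?n \<ge> 1" by (simp add: Suc_le_eq)
  have s: "s > 0" using \<sigma> by (simp add: s_def)
  have q: "q \<ge> 1" unfolding q_def using n \<sigma> by linarith
  have \<delta>: "\<delta> > 0" using \<sigma> by (auto simp: \<delta>_def s_def min_def max_def)
  have \<kappa>: "1 - ?n * (p - 1) / (2 * s) = 0"
    using crit s unfolding s_def[symmetric] by simp
  obtain C r0 where C: "C > 0" "r0 \<ge> 1" "\<And>\<epsilon> T u r. \<epsilon> > 0 \<Longrightarrow> weak_sol a b \<sigma> p \<epsilon> u0 u1 T u \<Longrightarrow> r \<ge> r0 \<Longrightarrow> ereal r < T \<Longrightarrow>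
    X_int T u p q r (?K r) < \<infinity> \<and>
    (enn2real (X_int T u p q r (?K r)) + \<epsilon>) powr p \<le> C * r powr (- (1 - ?n * (p - 1) / (2 * s))) * enn2real (Z_int T u p q \<delta> r (?K r))"
    using weak_sol_main_inequality[OF ab \<sigma> p w] unfolding s_def[symmetric] q_def[symmetric] \<delta>_def[symmetric]
    by blast
  \<comment> \<open>Dyadic scales are counted from \<open>2^j0\<close> on, so that all of them
    exceed \<open>r0\<close>.\<close>
  obtain j0 :: nat where j0: "r0 < 2 ^ j0" using real_arch_pow[of 2 r0] by auto
  define B where "B = 4 + 1 / (1 - 1 / 2 powr (1 / (2 * s))) + 1 / (1 - 2 powr (- \<delta>))"
  have B: "B > 0"
  proof -
    have "1 / 2 powr (1 / (2 * s)) < 1" "2 powr (- \<delta>) < 1" using s \<delta> by (auto simp: gr_one_powr powr_less_one)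
    then show ?thesis unfolding B_def by (intro add_pos_pos) auto
  qed
  define E where "E = C * B / (p - 1)"
  have E: "E > 0" using C B p by (simp add: E_def)
  have steps: "real (N1 - j0 + 1) \<le> E * \<epsilon> powr (- (p - 1))"
    if \<epsilon>: "\<epsilon> > 0" and ws: "weak_sol a b \<sigma> p \<epsilon> u0 u1 T u" and N1: "j0 \<le> N1" "ereal (2 ^ N1) < T" for \<epsilon> T u N1
  proof -
    define X where "X N = X_int T u p q (2 ^ N) (?K (2 ^ N))" for N :: nat
    define Z where "Z N = (if N \<in> {j0..N1} then enn2real (Z_int T u p q \<delta> (2 ^ N) (?K (2 ^ N))) else 0)" for N :: nat
    have key: "X N < \<infinity>" "(enn2real (X N) + \<epsilon>) powr p \<le> C * enn2real (Z_int T u p q \<delta> (2 ^ N) (?K (2 ^ N)))"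
      if N: "j0 \<le> N" "N \<le> N1" for N
    proof -
      have "(2::real) ^ j0 \<le> 2 ^ N" "(2::real) ^ N \<le> 2 ^ N1" using N by (auto intro!: power_increasing)
      then have rN: "r0 \<le> 2 ^ N" and "ereal (2 ^ N) \<le> ereal (2 ^ N1)"
        using j0 by (linarith, simp only: ereal_less_eq)
      from C(3)[OF \<epsilon> ws rN le_less_trans[OF this(2) N1(2)]] show "X N < \<infinity>" "(enn2real (X N) + \<epsilon>) powr p \<le> C * enn2real (Z_int T u p q \<delta> (2 ^ N) (?K (2 ^ N)))"
        unfolding \<kappa> X_def by auto
    qed
    \<comment> \<open>The partial sums of \<open>Z\<close> are at most \<open>B\<close> times the
      value of \<open>X\<close> at the last scale, so the recursion holds with
      \<open>c = 1/B\<close>.\<close>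
    have "real (N1 - j0 + 1) * ((p - 1) * (1 / B) / C) \<le> \<epsilon> powr (1 - p)"
    proof (rule discrete_blowup[where Z = Z])
      fix N assume N: "j0 \<le> N" "N \<le> N1"
      have Zfin: "Z_int T u p q \<delta> (2 ^ j) (?K (2 ^ j)) < \<infinity>" if "j \<in> {j0..N}" for j
      proof -
        have "Z_int T u p q \<delta> (2 ^ j) (?K (2 ^ j)) \<le> 3 * X j"
          unfolding X_def by (rule Z_int_le_X_int[OF ws _ _ less_imp_le[OF \<delta>] p]) auto
        also have "\<dots> < \<infinity>" using key(1)[of j] that N by (simp add: ennreal_mult_less_top)
        finally show ?thesis .
      qed
      have "(\<Sum>j\<in>{j0..N}. Z j) = (\<Sum>j\<in>{j0..N}. enn2real (Z_int T u p q \<delta> (2 ^ j) (?K (2 ^ j))))"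
        using N by (intro sum.cong) (auto simp: Z_def)
      also have "\<dots> = enn2real (\<Sum>j\<in>{j0..N}. Z_int T u p q \<delta> (2 ^ j) (?K (2 ^ j)))"
        using Zfin by (subst enn2real_sum) (auto simp: o_def)
      also have "\<dots> \<le> enn2real (ennreal B * X N)"
        unfolding X_def B_def using key(1)[OF N, unfolded X_def]
        by (intro enn2real_mono sum_Z_int_le[OF ws q s \<delta> p]) (auto simp: ennreal_mult_less_top)
      also have "\<dots> = B * enn2real (X N)" using B by (simp add: enn2real_mult)
      finally have "1 / B * (\<Sum>j\<in>{j0..N}. Z j) \<le> enn2real (X N)" using B by (simp add: divide_le_eq mult.commute)
      then have "(1 / B * (\<Sum>j\<in>{j0..N}. Z j) + \<epsilon>) powr p \<le> (enn2real (X N) + \<epsilon>) powr p"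
        using p B \<epsilon> by (intro powr_mono2 add_right_mono add_nonneg_nonneg mult_nonneg_nonneg sum_nonneg) (auto simp: Z_def)
      also have "\<dots> \<le> C * Z N" using key(2)[OF N] N by (simp add: Z_def)
      finally show "(1 / B * (\<Sum>j\<in>{j0..N}. Z j) + \<epsilon>) powr p \<le> C * Z N" .
    qed (use B C \<epsilon> p N1 in \<open>auto simp: Z_def\<close>)
    then show ?thesis using B C p by (simp add: E_def field_simps)
  qed
  have "T \<le> ereal (2 ^ j0 * exp (E * ln 2 * \<epsilon> powr (- (p - 1))))"
    if \<epsilon>: "\<epsilon> > 0" and ws: "weak_sol a b \<sigma> p \<epsilon> u0 u1 T u" for \<epsilon> T u
  proof (rule ccontr)
    assume "\<not> ?thesis"
    then have T: "ereal (2 ^ j0 * exp (E * ln 2 * \<epsilon> powr (- (p - 1)))) < T" by simp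
    define M where "M = E * \<epsilon> powr (- (p - 1))"
    have M: "M \<ge> 0" using E by (simp add: M_def)
    \<comment> \<open>The scales \<open>j0, ..., N1\<close> number
      \<open>\<lfloor>M\<rfloor> + 1\<close>, which is more than \<open>M\<close>, while
      \<open>2^N1 \<le> 2^j0 2^M\<close> still lies below \<open>T\<close>. Writing
      \<open>2^M\<close> as an exponential produces the factor \<open>ln 2\<close>.\<close>
    define N1 where "N1 = j0 + nat \<lfloor>M\<rfloor>"
    have Nle: "real (nat \<lfloor>M\<rfloor>) \<le> M" using M by simp
    have "(2::real) ^ N1 = 2 ^ j0 * 2 powr real (nat \<lfloor>M\<rfloor>)"
      by (simp add: N1_def power_add powr_realpow)
    also have "\<dots> \<le> 2 ^ j0 * 2 powr M" using Nle by (intro mult_left_mono powr_mono) auto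
    also have "2 powr M = exp (E * ln 2 * \<epsilon> powr (- (p - 1)))" by (simp add: powr_def M_def mult_ac)
    finally have "ereal (2 ^ N1) < T" using T by (meson ereal_less_eq(3) le_less_trans)
    from steps[OF \<epsilon> ws _ this] have "real (nat \<lfloor>M\<rfloor> + 1) \<le> M" by (simp add: N1_def M_def)
    then show False using M by linarith
  qed
  moreover have "E * ln 2 > 0" using E by simp
  moreover have "(2::real) ^ j0 > 0" by simp
  ultimately show ?thesis by blast
qed

theorem theorem2p3:
  fixes u0 u1 :: "'a::euclidean_space \<Rightarrow> real"
    and a b \<sigma> p :: real
  defines "\<sigma>min \<equiv> min 1 \<sigma>"
  defines "pcrit \<equiv> 1 + 2 * \<sigma>min / real DIM('a)"
  assumes "a > 0" and "b > 0"
    and "\<sigma> > 0" and "\<sigma> \<noteq> 1"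
    and "1 < p" and "p \<le> pcrit"
    and "integrable lborel (\<lambda>x. u0 x + u1 x)"
    and "(LINT x|lborel. u0 x + u1 x) > 0"
  shows "(\<forall>\<epsilon>>0. \<not> (\<exists>u. weak_sol a b \<sigma> p \<epsilon> u0 u1 \<infinity> u)) \<and>
         (\<exists>C C'. C > 0 \<and> C' > 0 \<and> (\<exists>\<epsilon>0>0. \<forall>\<epsilon>. 0 < \<epsilon> \<and> \<epsilon> < \<epsilon>0 \<longrightarrow>
            lifespan a b \<sigma> p \<epsilon> u0 u1 \<le>
              ereal (C' * (if p = pcrit then exp (C * \<epsilon> powr (- (p - 1)))
                           else \<epsilon> powr (- (2 * \<sigma>min * (p - 1) / (2 * \<sigma>min - real DIM('a) * (p - 1))))))))"
proof (cases "p = pcrit")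
  case True
  then have crit: "p = 1 + 2 * min 1 \<sigma> / real DIM('a)" by (simp add: pcrit_def \<sigma>min_def)
  obtain C C' where C: "C > 0" "C' > 0" and bound: "\<And>\<epsilon> T u. \<epsilon> > 0 \<Longrightarrow> weak_sol a b \<sigma> p \<epsilon> u0 u1 T u \<Longrightarrow>
      T \<le> ereal (C' * exp (C * \<epsilon> powr (- (p - 1))))"
    using critical_lifespan[OF assms(3-7,9,10) crit] by blast
  \<comment> \<open>A global solution is one with \<open>T = \<infinity>\<close>, which no real
    bound admits.\<close>
  have "\<not> weak_sol a b \<sigma> p \<epsilon> u0 u1 \<infinity> u" if "\<epsilon> > 0" for \<epsilon> u
    using bound[OF that, of \<infinity> u] by auto
  moreover have "lifespan a b \<sigma> p \<epsilon> u0 u1 \<le> ereal (C' * exp (C * \<epsilon> powr (- (p - 1))))" if "\<epsilon> > 0" for \<epsilon>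
    unfolding lifespan_def using bound[OF that] by (intro Sup_least) blast
  ultimately show ?thesis
    using C True by (intro conjI exI[of _ C] exI[of _ C'] exI[of _ "1::real"]) auto
next
  case False
  then have sub: "p < 1 + 2 * min 1 \<sigma> / real DIM('a)" using assms(8) by (simp add: pcrit_def \<sigma>min_def)
  define \<theta> where "\<theta> = 2 * \<sigma>min * (p - 1) / (2 * \<sigma>min - real DIM('a) * (p - 1))"
  have "2 * \<sigma>min - real DIM('a) * (p - 1) > 0"
    using sub unfolding \<sigma>min_def by (simp add: field_simps)
  moreover have "\<sigma>min > 0" using assms(5) by (simp add: \<sigma>min_def)
  ultimately have \<theta>: "\<theta> \<ge> 0" using assms(7) by (simp add: \<theta>_def)
  obtain C r0 where C: "C > 0" "r0 \<ge> 1" and bound: "\<And>\<epsilon> T u. \<epsilon> > 0 \<Longrightarrow> weak_sol a b \<sigma> p \<epsilon> u0 u1 T u \<Longrightarrow>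
      T \<le> ereal (max r0 (C * \<epsilon> powr (- \<theta>)))"
    using subcritical_lifespan[OF assms(3-7,9,10) sub] unfolding \<theta>_def \<sigma>min_def by blast
  have "\<not> \<infinity> \<le> ereal y" for y by simp
  then have "\<not> weak_sol a b \<sigma> p \<epsilon> u0 u1 \<infinity> u" if "\<epsilon> > 0" for \<epsilon> u
    using bound[OF that] by blast
  moreover have "lifespan a b \<sigma> p \<epsilon> u0 u1 \<le> ereal ((r0 + C) * \<epsilon> powr (- \<theta>))" if \<epsilon>: "\<epsilon> > 0" "\<epsilon> < 1" for \<epsilon>
  proof -
    have "lifespan a b \<sigma> p \<epsilon> u0 u1 \<le> ereal (max r0 (C * \<epsilon> powr (- \<theta>)))"
      unfolding lifespan_def using bound[OF \<epsilon>(1)] by (intro Sup_least) blast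
    also have "max r0 (C * \<epsilon> powr (- \<theta>)) \<le> (r0 + C) * \<epsilon> powr (- \<theta>)"
    proof -
      \<comment> \<open>For \<open>\<epsilon> < 1\<close> the power is at least 1 and absorbs the
        constant \<open>r0\<close>; here the smallness of \<open>\<epsilon>\<close> enters.\<close>
      have "1 \<le> \<epsilon> powr (- \<theta>)" using \<epsilon> \<theta> powr_mono'[of "- \<theta>" 0 \<epsilon>] by simp
      then have "r0 * 1 \<le> r0 * \<epsilon> powr (- \<theta>)" using C by (intro mult_left_mono) auto
      moreover have "0 \<le> C * \<epsilon> powr (- \<theta>)" "0 \<le> r0 * \<epsilon> powr (- \<theta>)" using C by auto
      ultimately show ?thesis unfolding distrib_right by linarith
    qed
    finally show ?thesis by simp
  qed
  ultimately show ?thesis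
    using C False unfolding \<theta>_def[symmetric]
    by (intro conjI exI[of _ "1::real"] exI[of _ "r0 + C"]) (auto simp: \<theta>_def)
qed

end
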